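(* Let $M, C$ be positive constants, let $\{\mathcal K_j\}_j$ be an at most countable family of Hilbert spaces, and let $U_j:\mathcal K_j\to\mathcal K_j$ be unitary operators. Set $\mathcal K=\bigoplus_j\mathcal K_j$ and $U=\bigoplus_j U_j$. Suppose that (i) every operator $U_j$ has the following property: if $R$ is an operator such that $\sup_{n\ge 0}\|R^n\|\le M$ and $R\sim U_j$, then $\sup_{n\le 0}\|R^n\|\le C$; (ii) $\mathcal K_j\in\operatorname{Hyplat}U$ for every $j$. Let $T$ be an operator such that $\sup_{n\ge 0}\|T^n\|\le M$ and $T\sim U$. Then $T\approx U$ and $\sup_{n\le 0}\|T^n\|\le M^2C^3$.
   Context: All Hilbert spaces are complex and separable; operators are linear and bounded. For operators $T$ on $\mathcal H$ and $R$ on $\mathcal K$: $T\approx R$ (similar) means there is a bounded invertible $X:\mathcal H\to\mathcal K$ with bounded inverse and $XT=RX$; $T\prec R$ ($T$ is a quasiaffine transform of $R$) means there is a bounded linear $X:\mathcal H\to\mathcal K$ with $\ker X=\{0\}$, dense range, and $XT=RX$; $T\sim R$ (quasisimilar) means $T\prec R$ and $R\prec T$. A bound of the form $\sup_{n\le 0}\|R^n\|\le C$ includes the assertion that $R$ is invertible with bounded inverse (the supremum is over integers $n\le 0$). $\operatorname{Hyplat}U$ denotes the lattice of closed subspaces hyperinvariant for $U$, i.e. invariant under every bounded operator commuting with $U$; each $\mathcal K_j$ is identified with the corresponding summand of $\mathcal K$. *)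

theory Defs
  imports "HOL-Analysis.Analysis"
begin

section \<open>Complex Hilbert spaces\<close>

class complex_hilbert = real_inner + complete_space +
  fixes scaleC :: "complex \<Rightarrow> 'a \<Rightarrow> 'a" (infixr "*\<^sub>C" 75)
    and cinner :: "'a \<Rightarrow> 'a \<Rightarrow> complex"
  assumes scaleC_add_right: "c *\<^sub>C (x + y) = c *\<^sub>C x + c *\<^sub>C y"
    and scaleC_add_left: "(c + d) *\<^sub>C x = c *\<^sub>C x + d *\<^sub>C x"
    and scaleC_scaleC: "c *\<^sub>C (d *\<^sub>C x) = (c * d) *\<^sub>C x"
    and scaleR_eq_scaleC: "r *\<^sub>R x = complex_of_real r *\<^sub>C x"
    and cinner_commute: "cinner x y = cnj (cinner y x)"
    and cinner_add_left: "cinner (x + y) z = cinner x z + cinner y z"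
    and cinner_scaleC_left: "cinner (c *\<^sub>C x) y = c * cinner x y"
    and inner_eq_Re_cinner: "inner x y = Re (cinner x y)"

instantiation complex :: complex_hilbert
begin

definition scaleC_complex :: "complex \<Rightarrow> complex \<Rightarrow> complex"
  where "scaleC_complex c x = c * x"

definition cinner_complex :: "complex \<Rightarrow> complex \<Rightarrow> complex"
  where "cinner_complex x y = x * cnj y"

instance
  by standard
    (simp_all add: scaleC_complex_def cinner_complex_def algebra_simps scaleR_conv_of_real
      inner_complex_def)

end

lemma scaleC_one: "1 *\<^sub>C x = (x::'a::complex_hilbert)"
  using scaleR_eq_scaleC[of 1 x] by simp

lemma cinner_scaleC_right: "cinner x (c *\<^sub>C y) = cnj c * cinner (x::'a::complex_hilbert) y"
proof -
  have "cinner x (c *\<^sub>C y) = cnj (cinner (c *\<^sub>C y) x)"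
    by (rule cinner_commute)
  also have "\<dots> = cnj c * cnj (cinner y x)"
    by (simp add: cinner_scaleC_left)
  finally show ?thesis
    by (simp add: cinner_commute[of x y])
qed

lemma norm_scaleC: "norm (c *\<^sub>C x) = cmod c * norm (x::'a::complex_hilbert)"
proof -
  have "inner (c *\<^sub>C x) (c *\<^sub>C x) = Re ((c * cnj c) * cinner x x)"
    by (simp only: inner_eq_Re_cinner cinner_scaleC_left cinner_scaleC_right mult.assoc mult.left_commute)
  also have "\<dots> = (cmod c)\<^sup>2 * inner x x"
    by (simp only: complex_norm_square[symmetric] inner_eq_Re_cinner)
      (simp flip: of_real_power)
  finally show ?thesis
    by (simp add: norm_eq_sqrt_inner real_sqrt_mult)
qed

lemma norm_cinner_le: "cmod (cinner x y) \<le> norm x * norm (y::'a::complex_hilbert)"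
proof (cases "cinner x y = 0")
  case False
  define c where "c = cnj (cinner x y) / of_real (cmod (cinner x y))"
  have c: "cmod c = 1"
    using False by (simp add: c_def norm_divide)
  have "c * cinner x y = of_real (cmod (cinner x y))"
    using False by (simp add: c_def complex_norm_square[symmetric] mult.commute[of "cnj _"] power2_eq_square)
  hence "cmod (cinner x y) = inner (c *\<^sub>C x) y"
    by (simp add: inner_eq_Re_cinner cinner_scaleC_left)
  also have "\<dots> \<le> norm (c *\<^sub>C x) * norm y"
    by (rule norm_cauchy_schwarz)
  finally show ?thesis
    by (simp add: norm_scaleC c)
qed simp


section \<open>Square-summable families\<close>

text \<open>A type carrying the external Hilbert direct sum of copies of \<open>'a\<close> indexed by \<open>'i\<close>; direct
  sums of families of closed subspaces of \<open>'a\<close> are carved out of it below.\<close>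

typedef (overloaded) ('i, 'a::complex_hilbert) l2sum =
  "{f :: 'i \<Rightarrow> 'a. (\<lambda>i. (norm (f i))\<^sup>2) summable_on UNIV}"
  by (rule exI[of _ "\<lambda>_. 0"]) simp

lemma l2_add:
  fixes f g :: "'i \<Rightarrow> 'a::complex_hilbert"
  assumes f: "(\<lambda>i. (norm (f i))\<^sup>2) summable_on UNIV" and g: "(\<lambda>i. (norm (g i))\<^sup>2) summable_on UNIV"
  shows "(\<lambda>i. (norm (f i + g i))\<^sup>2) summable_on UNIV"
proof (rule summable_on_comparison_test)
  show "(\<lambda>i. 2 * (norm (f i))\<^sup>2 + 2 * (norm (g i))\<^sup>2) summable_on UNIV"
    by (intro summable_on_add summable_on_cmult_right f g)
  fix i
  have "(norm (f i + g i))\<^sup>2 \<le> (norm (f i) + norm (g i))\<^sup>2"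
    by (intro power_mono norm_triangle_ineq) simp
  also have "\<dots> \<le> 2 * (norm (f i))\<^sup>2 + 2 * (norm (g i))\<^sup>2"
    using sum_squares_bound[of "norm (f i)" "norm (g i)"] by (simp add: power2_sum)
  finally show "(norm (f i + g i))\<^sup>2 \<le> 2 * (norm (f i))\<^sup>2 + 2 * (norm (g i))\<^sup>2" .
qed simp

lemma l2_scaleC:
  fixes f :: "'i \<Rightarrow> 'a::complex_hilbert"
  assumes "(\<lambda>i. (norm (f i))\<^sup>2) summable_on UNIV"
  shows "(\<lambda>i. (norm (c *\<^sub>C f i))\<^sup>2) summable_on UNIV"
  by (simp add: norm_scaleC power_mult_distrib summable_on_cmult_right assms)

lemma l2_uminus:
  fixes f :: "'i \<Rightarrow> 'a::complex_hilbert"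
  assumes "(\<lambda>i. (norm (f i))\<^sup>2) summable_on UNIV"
  shows "(\<lambda>i. (norm (- f i))\<^sup>2) summable_on UNIV"
  using assms by simp

lemma l2_diff:
  fixes f g :: "'i \<Rightarrow> 'a::complex_hilbert"
  assumes "(\<lambda>i. (norm (f i))\<^sup>2) summable_on UNIV" and "(\<lambda>i. (norm (g i))\<^sup>2) summable_on UNIV"
  shows "(\<lambda>i. (norm (f i - g i))\<^sup>2) summable_on UNIV"
  using l2_add[OF assms(1) l2_uminus[OF assms(2)]] by simp

lemma l2_cinner:
  fixes f g :: "'i \<Rightarrow> 'a::complex_hilbert"
  assumes "(\<lambda>i. (norm (f i))\<^sup>2) summable_on UNIV" and "(\<lambda>i. (norm (g i))\<^sup>2) summable_on UNIV"
  shows "(\<lambda>i. cinner (f i) (g i)) summable_on UNIV"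
proof -
  have 1: "(\<lambda>i. (norm (f i))\<^sup>2 + (norm (g i))\<^sup>2) summable_on UNIV"
    by (intro summable_on_add assms)
  have 2: "cmod (cinner (f i) (g i)) \<le> (norm (f i))\<^sup>2 + (norm (g i))\<^sup>2" for i
  proof -
    have "2 * (norm (f i) * norm (g i)) \<le> (norm (f i))\<^sup>2 + (norm (g i))\<^sup>2"
      using sum_squares_bound[of "norm (f i)" "norm (g i)"] by simp
    moreover have "0 \<le> norm (f i) * norm (g i)"
      by simp
    ultimately show ?thesis
      using norm_cinner_le[of "f i" "g i"] by linarith
  qed
  show ?thesis
    by (rule abs_summable_summable, rule Infinite_Sum.abs_summable_on_comparison_test'[OF 1 2])
qed

lemma Rep_l2sum_summable: "(\<lambda>i. (norm (Rep_l2sum f i))\<^sup>2) summable_on UNIV"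
  using Rep_l2sum[of f] by simp

lemma l2sum_eqI: "(\<And>i. Rep_l2sum f i = Rep_l2sum g i) \<Longrightarrow> f = g"
  by (metis Rep_l2sum_inject ext)

lemma l2_inner:
  fixes f g :: "'i \<Rightarrow> 'a::complex_hilbert"
  assumes "(\<lambda>i. (norm (f i))\<^sup>2) summable_on UNIV" and "(\<lambda>i. (norm (g i))\<^sup>2) summable_on UNIV"
  shows "(\<lambda>i. inner (f i) (g i)) summable_on UNIV"
  using summable_on_Re[OF l2_cinner[OF assms]] by (simp add: inner_eq_Re_cinner)

instantiation l2sum :: (type, complex_hilbert) real_inner
begin

definition "0 = Abs_l2sum (\<lambda>_. 0)"
definition "f + g = Abs_l2sum (\<lambda>i. Rep_l2sum f i + Rep_l2sum g i)"
definition "- f = Abs_l2sum (\<lambda>i. - Rep_l2sum f i)"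
definition "f - g = Abs_l2sum (\<lambda>i. Rep_l2sum f i - Rep_l2sum g i)"
definition "r *\<^sub>R f = Abs_l2sum (\<lambda>i. r *\<^sub>R Rep_l2sum f i)"
definition "inner f g = (\<Sum>\<^sub>\<infinity>i. inner (Rep_l2sum f i) (Rep_l2sum g i))"
definition "norm f = sqrt (inner f f)" for f :: "('a, 'b) l2sum"
definition "sgn f = inverse (norm f) *\<^sub>R f" for f :: "('a, 'b) l2sum"
definition "dist f g = norm (f - g)" for f g :: "('a, 'b) l2sum"
definition "(uniformity :: (('a, 'b) l2sum \<times> ('a, 'b) l2sum) filter) =
  (INF e\<in>{0<..}. principal {(f, g). dist f g < e})"
definition "open (S :: ('a, 'b) l2sum set) \<longleftrightarrow>
  (\<forall>f\<in>S. \<forall>\<^sub>F (f', g) in uniformity. f' = f \<longrightarrow> g \<in> S)"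

lemma Rep_l2sum_ops:
  "Rep_l2sum (0::('a, 'b) l2sum) i = 0"
  "Rep_l2sum (f + g) i = Rep_l2sum f i + Rep_l2sum g i"
  "Rep_l2sum (- f) i = - Rep_l2sum f i"
  "Rep_l2sum (f - g) i = Rep_l2sum f i - Rep_l2sum g i"
  "Rep_l2sum (r *\<^sub>R f) i = r *\<^sub>R Rep_l2sum f i"
  for f g :: "('a, 'b) l2sum"
  by (simp_all add: zero_l2sum_def plus_l2sum_def uminus_l2sum_def minus_l2sum_def
      scaleR_l2sum_def Abs_l2sum_inverse Rep_l2sum_summable
      l2_add l2_diff l2_scaleC scaleR_eq_scaleC)

lemma inner_l2sum_self: "inner f f = (\<Sum>\<^sub>\<infinity>i. (norm (Rep_l2sum f i))\<^sup>2)"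
  for f :: "('a, 'b) l2sum"
  by (simp add: inner_l2sum_def power2_norm_eq_inner)

lemma sum_norm_l2sum_le: "finite F \<Longrightarrow> (\<Sum>i\<in>F. (norm (Rep_l2sum f i))\<^sup>2) \<le> inner f f"
  for f :: "('a, 'b) l2sum"
  unfolding inner_l2sum_self by (intro finite_sum_le_infsum Rep_l2sum_summable) auto

lemma norm_l2sum_coord_le: "norm (Rep_l2sum f i) \<le> norm f" for f :: "('a, 'b) l2sum"
  using sum_norm_l2sum_le[of "{i}" f] by (simp add: norm_l2sum_def real_le_rsqrt)

instance
proof
  fix f g h :: "('a, 'b) l2sum" and r s :: real
  show "f + g + h = f + (g + h)" "f + g = g + f" "0 + f = f" "- f + f = 0" "f - g = f + - g"
    by (rule l2sum_eqI, simp add: Rep_l2sum_ops algebra_simps)+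
  show "r *\<^sub>R (f + g) = r *\<^sub>R f + r *\<^sub>R g" "(r + s) *\<^sub>R f = r *\<^sub>R f + s *\<^sub>R f"
    "r *\<^sub>R s *\<^sub>R f = (r * s) *\<^sub>R f" "1 *\<^sub>R f = f"
    by (rule l2sum_eqI, simp add: Rep_l2sum_ops algebra_simps)+
  show "sgn f = inverse (norm f) *\<^sub>R f" "dist f g = norm (f - g)"
    by (simp_all add: sgn_l2sum_def dist_l2sum_def)
  show "uniformity = (INF e\<in>{0<..}. principal {(f, g). dist f (g::('a, 'b) l2sum) < e})"
    by (rule uniformity_l2sum_def)
  show "open S \<longleftrightarrow> (\<forall>f\<in>S. \<forall>\<^sub>F (f', g) in uniformity. f' = f \<longrightarrow> g \<in> S)"
    for S :: "('a, 'b) l2sum set"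
    by (rule open_l2sum_def)
  show "inner f g = inner g f"
    by (simp add: inner_l2sum_def inner_commute)
  show "inner (f + g) h = inner f h + inner g h"
    by (simp add: inner_l2sum_def Rep_l2sum_ops inner_add_left infsum_add l2_inner
        Rep_l2sum_summable)
  show "inner (r *\<^sub>R f) g = r * inner f g"
    by (simp add: inner_l2sum_def Rep_l2sum_ops infsum_cmult_right')
  show "0 \<le> inner f f"
    unfolding inner_l2sum_self by (intro infsum_nonneg) simp
  show "inner f f = 0 \<longleftrightarrow> f = 0"
  proof
    assume *: "inner f f = 0"
    have "Rep_l2sum f i = 0" for i
      using norm_l2sum_coord_le[of f i] * by (simp add: norm_l2sum_def)
    thus "f = 0"
      by (intro l2sum_eqI) (simp add: Rep_l2sum_ops)
  qed (simp add: inner_l2sum_self Rep_l2sum_ops)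
  show "norm f = sqrt (inner f f)"
    by (rule norm_l2sum_def)
qed

end

instance l2sum :: (type, complex_hilbert) complete_space
proof
  fix X :: "nat \<Rightarrow> ('a, 'b) l2sum"
  have dist_sq: "(dist f g)\<^sup>2 = inner (f - g) (f - g)" for f g :: "('a, 'b) l2sum"
    by (simp add: dist_norm power2_norm_eq_inner)
  assume X: "Cauchy X"
  have "Cauchy (\<lambda>n. Rep_l2sum (X n) i)" for i
  proof (rule metric_CauchyI)
    fix e :: real assume "e > 0"
    with X obtain N where N: "\<And>m n. m \<ge> N \<Longrightarrow> n \<ge> N \<Longrightarrow> dist (X m) (X n) < e"
      unfolding Cauchy_def by metis
    have "dist (Rep_l2sum (X m) i) (Rep_l2sum (X n) i) < e" if "m \<ge> N" "n \<ge> N" for m n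
      using norm_l2sum_coord_le[of "X m - X n" i] N[OF that]
      by (simp add: dist_norm dist_l2sum_def Rep_l2sum_ops)
    thus "\<exists>N. \<forall>m\<ge>N. \<forall>n\<ge>N. dist (Rep_l2sum (X m) i) (Rep_l2sum (X n) i) < e"
      by blast
  qed
  hence "\<exists>l. (\<lambda>n. Rep_l2sum (X n) i) \<longlonglongrightarrow> l" for i
    by (simp add: Cauchy_convergent_iff convergent_def)
  then obtain l where l: "\<And>i. (\<lambda>n. Rep_l2sum (X n) i) \<longlonglongrightarrow> l i"
    by metis
  have tail: "(\<Sum>i\<in>F. (norm (Rep_l2sum (X m) i - l i))\<^sup>2) \<le> e\<^sup>2"
    if "\<And>n. n \<ge> N \<Longrightarrow> dist (X m) (X n) < e" "finite F" for F e m N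
  proof (rule LIMSEQ_le_const2)
    show "(\<lambda>n. \<Sum>i\<in>F. (norm (Rep_l2sum (X m) i - Rep_l2sum (X n) i))\<^sup>2)
        \<longlonglongrightarrow> (\<Sum>i\<in>F. (norm (Rep_l2sum (X m) i - l i))\<^sup>2)"
      by (intro tendsto_intros l)
    have "(\<Sum>i\<in>F. (norm (Rep_l2sum (X m) i - Rep_l2sum (X n) i))\<^sup>2) \<le> e\<^sup>2" if "n \<ge> N" for n
    proof -
      have "(\<Sum>i\<in>F. (norm (Rep_l2sum (X m) i - Rep_l2sum (X n) i))\<^sup>2) \<le> (dist (X m) (X n))\<^sup>2"
        using sum_norm_l2sum_le[OF \<open>finite F\<close>, of "X m - X n"] by (simp add: dist_sq Rep_l2sum_ops)
      also have "\<dots> \<le> e\<^sup>2"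
        using \<open>\<And>n. n \<ge> N \<Longrightarrow> dist (X m) (X n) < e\<close>[OF that]
        by (intro power_mono) simp_all
      finally show ?thesis .
    qed
    thus "\<exists>N. \<forall>n\<ge>N. (\<Sum>i\<in>F. (norm (Rep_l2sum (X m) i - Rep_l2sum (X n) i))\<^sup>2) \<le> e\<^sup>2"
      by blast
  qed
  have summ: "(\<lambda>i. (norm (Rep_l2sum (X m) i - l i))\<^sup>2) summable_on UNIV"
    if "\<And>n. n \<ge> N \<Longrightarrow> dist (X m) (X n) < e" for e m N
  proof (rule nonneg_bdd_above_summable_on)
    show "bdd_above (sum (\<lambda>i. (norm (Rep_l2sum (X m) i - l i))\<^sup>2) ` {F. F \<subseteq> UNIV \<and> finite F})"
      by (rule bdd_aboveI2[of _ _ "e\<^sup>2"], rule tail[OF that]) simp_all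
  qed simp
  obtain N where N: "\<And>m n. m \<ge> N \<Longrightarrow> n \<ge> N \<Longrightarrow> dist (X m) (X n) < 1"
    using X unfolding Cauchy_def by (metis zero_less_one)
  have "(\<lambda>i. (norm (l i))\<^sup>2) summable_on UNIV"
    using l2_diff[OF Rep_l2sum_summable[of "X N"] summ[of N N 1]] N by simp
  hence L: "Rep_l2sum (Abs_l2sum l) = l"
    by (simp add: Abs_l2sum_inverse)
  have "X \<longlonglongrightarrow> Abs_l2sum l"
  proof (rule metric_LIMSEQ_I)
    fix e :: real assume e: "e > 0"
    then obtain N where N: "\<And>m n. m \<ge> N \<Longrightarrow> n \<ge> N \<Longrightarrow> dist (X m) (X n) < e / 2"
      using X unfolding Cauchy_def by (metis half_gt_zero)
    have "dist (X m) (Abs_l2sum l) < e" if "m \<ge> N" for m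
    proof -
      have "(dist (X m) (Abs_l2sum l))\<^sup>2 = (\<Sum>\<^sub>\<infinity>i. (norm (Rep_l2sum (X m) i - l i))\<^sup>2)"
        by (simp add: dist_sq inner_l2sum_self Rep_l2sum_ops L)
      also have "\<dots> \<le> (e / 2)\<^sup>2"
        by (rule infsum_le_finite_sums[OF summ tail], rule N[OF that], assumption,
            rule N[OF that], assumption+)
      finally have "dist (X m) (Abs_l2sum l) \<le> e / 2"
        by (rule power2_le_imp_le) (use e in simp)
      thus ?thesis
        using e by simp
    qed
    thus "\<exists>N. \<forall>m\<ge>N. dist (X m) (Abs_l2sum l) < e"
      by blast
  qed
  thus "convergent X"
    by (auto simp: convergent_def)
qed

instantiation l2sum :: (type, complex_hilbert) complex_hilbert
begin

definition "c *\<^sub>C f = Abs_l2sum (\<lambda>i. c *\<^sub>C Rep_l2sum f i)"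
definition "cinner f g = (\<Sum>\<^sub>\<infinity>i. cinner (Rep_l2sum f i) (Rep_l2sum g i))"

lemma Rep_l2sum_scaleC: "Rep_l2sum (c *\<^sub>C f) i = c *\<^sub>C Rep_l2sum f i"
  for f :: "('a, 'b) l2sum"
  by (simp add: scaleC_l2sum_def Abs_l2sum_inverse Rep_l2sum_summable l2_scaleC)

instance
proof
  fix f g h :: "('a, 'b) l2sum" and r :: real and c d :: complex
  show "c *\<^sub>C (f + g) = c *\<^sub>C f + c *\<^sub>C g" "(c + d) *\<^sub>C f = c *\<^sub>C f + d *\<^sub>C f"
    "c *\<^sub>C d *\<^sub>C f = (c * d) *\<^sub>C f" "r *\<^sub>R f = complex_of_real r *\<^sub>C f"
    by (rule l2sum_eqI, simp add: Rep_l2sum_ops Rep_l2sum_scaleC scaleC_add_right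
        scaleC_add_left scaleC_scaleC scaleR_eq_scaleC)+
  have "cnj (cinner g f) = (\<Sum>\<^sub>\<infinity>i. cnj (cinner (Rep_l2sum g i) (Rep_l2sum f i)))"
    unfolding cinner_l2sum_def by (rule infsum_cnj[symmetric])
  also have "\<dots> = cinner f g"
    unfolding cinner_l2sum_def by (intro infsum_cong cinner_commute[symmetric])
  finally show "cinner f g = cnj (cinner g f)" ..
  show "cinner (f + g) h = cinner f h + cinner g h"
    by (simp add: cinner_l2sum_def Rep_l2sum_ops cinner_add_left infsum_add l2_cinner
        Rep_l2sum_summable)
  show "cinner (c *\<^sub>C f) g = c * cinner f g"
    by (simp add: cinner_l2sum_def Rep_l2sum_scaleC cinner_scaleC_left infsum_cmult_right')
  show "inner f g = Re (cinner f g)"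
    by (simp add: inner_l2sum_def cinner_l2sum_def inner_eq_Re_cinner infsum_Re l2_cinner
        Rep_l2sum_summable)
qed

end



section \<open>Hilbert spaces as closed subspaces, and operators between them\<close>

text \<open>
  A Hilbert space is represented by a closed complex subspace of a type of class
  \<open>complex_hilbert\<close>, so that families of different Hilbert spaces, and quantification over Hilbert
  spaces inside a formula, become available. Every at most countable family of Hilbert spaces is of
  this form up to isometric isomorphism (embed the family in its direct sum).
  Operators are functions on the ambient types; only their values on the domain space matter.
\<close>

definition closed_csubspace :: "'a::complex_hilbert set \<Rightarrow> bool" where
  "closed_csubspace H \<longleftrightarrow> closed H \<and> 0 \<in> H \<and> (\<forall>x\<in>H. \<forall>y\<in>H. x + y \<in> H) \<and> (\<forall>c. \<forall>x\<in>H. c *\<^sub>C x \<in> H)"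

definition separable_hilbert :: "'a::complex_hilbert set \<Rightarrow> bool" where
  "separable_hilbert H \<longleftrightarrow>
    closed_csubspace H \<and> (\<exists>D. countable D \<and> D \<subseteq> H \<and> H \<subseteq> closure D)"

definition bounded_op ::
    "'a::complex_hilbert set \<Rightarrow> 'b::complex_hilbert set \<Rightarrow> ('a \<Rightarrow> 'b) \<Rightarrow> bool" where
  "bounded_op H K A \<longleftrightarrow>
    A ` H \<subseteq> K \<and>
    (\<forall>x\<in>H. \<forall>y\<in>H. A (x + y) = A x + A y) \<and>
    (\<forall>c. \<forall>x\<in>H. A (c *\<^sub>C x) = c *\<^sub>C A x) \<and>
    (\<exists>B. \<forall>x\<in>H. norm (A x) \<le> B * norm x)"

text \<open>The analogue on \<open>H\<close> of \<^const>\<open>onorm\<close> from the library (with \<open>0 / 0 = 0\<close> for \<open>x = 0\<close>).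
  It is meaningful for bounded operators on \<open>H\<close> only.\<close>

definition onorm_on :: "'a::complex_hilbert set \<Rightarrow> ('a \<Rightarrow> 'b::complex_hilbert) \<Rightarrow> real" where
  "onorm_on H A = (SUP x\<in>H. norm (A x) / norm x)"

definition boundedly_invertible ::
    "'a::complex_hilbert set \<Rightarrow> 'b::complex_hilbert set \<Rightarrow> ('a \<Rightarrow> 'b) \<Rightarrow> bool" where
  "boundedly_invertible H K X \<longleftrightarrow>
    bounded_op H K X \<and> bij_betw X H K \<and> bounded_op K H (inv_into H X)"

definition unitary_op :: "'a::complex_hilbert set \<Rightarrow> ('a \<Rightarrow> 'a) \<Rightarrow> bool" where
  "unitary_op H U \<longleftrightarrow>
    bounded_op H H U \<and> U ` H = H \<and> (\<forall>x\<in>H. \<forall>y\<in>H. cinner (U x) (U y) = cinner x y)"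

definition pos_powers_bounded :: "'a::complex_hilbert set \<Rightarrow> ('a \<Rightarrow> 'a) \<Rightarrow> real \<Rightarrow> bool" where
  "pos_powers_bounded H T M \<longleftrightarrow> (\<forall>n::nat. onorm_on H (T ^^ n) \<le> M)"

definition neg_powers_bounded :: "'a::complex_hilbert set \<Rightarrow> ('a \<Rightarrow> 'a) \<Rightarrow> real \<Rightarrow> bool" where
  "neg_powers_bounded H T C \<longleftrightarrow>
    boundedly_invertible H H T \<and> (\<forall>n::nat. onorm_on H (inv_into H T ^^ n) \<le> C)"


section \<open>Similarity, quasisimilarity, hyperinvariant subspaces\<close>

definition similar ::
    "'a::complex_hilbert set \<Rightarrow> ('a \<Rightarrow> 'a) \<Rightarrow> 'b::complex_hilbert set \<Rightarrow> ('b \<Rightarrow> 'b) \<Rightarrow> bool" where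
  "similar H T K R \<longleftrightarrow> (\<exists>X. boundedly_invertible H K X \<and> (\<forall>x\<in>H. X (T x) = R (X x)))"

definition quasiaffine_transform ::
    "'a::complex_hilbert set \<Rightarrow> ('a \<Rightarrow> 'a) \<Rightarrow> 'b::complex_hilbert set \<Rightarrow> ('b \<Rightarrow> 'b) \<Rightarrow> bool" where
  "quasiaffine_transform H T K R \<longleftrightarrow>
    (\<exists>X. bounded_op H K X \<and> {x \<in> H. X x = 0} = {0} \<and> closure (X ` H) = K \<and>
      (\<forall>x\<in>H. X (T x) = R (X x)))"

definition quasisimilar ::
    "'a::complex_hilbert set \<Rightarrow> ('a \<Rightarrow> 'a) \<Rightarrow> 'b::complex_hilbert set \<Rightarrow> ('b \<Rightarrow> 'b) \<Rightarrow> bool" where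
  "quasisimilar H T K R \<longleftrightarrow> quasiaffine_transform H T K R \<and> quasiaffine_transform K R H T"

definition Hyplat :: "'a::complex_hilbert set \<Rightarrow> ('a \<Rightarrow> 'a) \<Rightarrow> 'a set set" where
  "Hyplat H U = {L. L \<subseteq> H \<and> closed_csubspace L \<and>
    (\<forall>A. bounded_op H H A \<and> (\<forall>x\<in>H. A (U x) = U (A x)) \<longrightarrow> A ` L \<subseteq> L)}"


section \<open>Hilbert direct sums\<close>

definition direct_sum :: "'i set \<Rightarrow> ('i \<Rightarrow> 'a::complex_hilbert set) \<Rightarrow> ('i, 'a) l2sum set" where
  "direct_sum J K =
    {f. (\<forall>j\<in>J. Rep_l2sum f j \<in> K j) \<and> (\<forall>j. j \<notin> J \<longrightarrow> Rep_l2sum f j = 0)}"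

text \<open>On \<open>direct_sum J K\<close> this is the direct sum of the operators \<open>U j\<close> on \<open>K j\<close> whenever these are
  uniformly bounded, since the family under \<open>Abs_l2sum\<close> is then square-summable.\<close>

definition direct_sum_op ::
    "'i set \<Rightarrow> ('i \<Rightarrow> 'a::complex_hilbert \<Rightarrow> 'a) \<Rightarrow> ('i, 'a) l2sum \<Rightarrow> ('i, 'a) l2sum" where
  "direct_sum_op J U f = Abs_l2sum (\<lambda>j. if j \<in> J then U j (Rep_l2sum f j) else 0)"

definition summand ::
    "'i set \<Rightarrow> ('i \<Rightarrow> 'a::complex_hilbert set) \<Rightarrow> 'i \<Rightarrow> ('i, 'a) l2sum set" where
  "summand J K j = {f \<in> direct_sum J K. \<forall>i. i \<noteq> j \<longrightarrow> Rep_l2sum f i = 0}"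

end

theory Submission
  imports Defs
begin

text \<open>
  Write \<open>X : H \<rightarrow> K\<close> and \<open>Y : K \<rightarrow> H\<close> for the two quasiaffinities between \<open>T\<close> and the unitary \<open>U\<close>, and
  \<open>N j\<close> for the summands of \<open>K\<close>. The subspaces \<open>closure (Y (N j))\<close> are invariant under \<open>T\<close>. The product
  \<open>X Y\<close> commutes with \<open>U\<close>, so by hyperinvariance it preserves every \<open>N j\<close>; hence \<open>X\<close> and \<open>Y\<close> restrict
  to quasiaffinities between \<open>closure (Y (N j))\<close> and \<open>N j\<close> (\<open>component_quasisimilar\<close>), and the assumption on
  \<open>U j\<close> gives \<open>norm x \<le> C * norm (T\<^sup>n x)\<close> on each \<open>closure (Y (N j))\<close>. It remains to see that the
  decomposition of \<open>H\<close> into these subspaces is orthogonal up to constants.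

  For this, \<open>H\<close> is given a second inner product \<open>a\<close>, a generalized limit of the Cesaro means of
  \<open>cinner (T\<^sup>n x) (T\<^sup>n y)\<close> (\<open>invariant_form\<close>). It is invariant under \<open>T\<close>, satisfies
  \<open>a x x \<le> (M * norm x)\<^sup>2\<close>, and \<open>a x x \<ge> (norm x / C)\<^sup>2\<close> on each \<open>closure (Y (N j))\<close>. Pulled back along \<open>Y\<close>,
  it becomes a \<open>U\<close>-invariant form on \<open>K\<close>, which is given by an operator in the commutant of \<open>U\<close>; as
  this operator preserves the \<open>N j\<close>, different \<open>Y (N j)\<close> are orthogonal for \<open>a\<close>. So for a finite sum
  \<open>x = (\<Sum>j. x j)\<close> of vectors \<open>x j \<in> Y (N j)\<close> the sum of the \<open>(norm (x j))\<^sup>2\<close> is at most \<open>(C M norm x)\<^sup>2\<close>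
  (\<open>square_sum_bound\<close>).

  The opposite estimate comes from duality. The adjoint \<open>T\<^sup>*\<close> is quasisimilar to \<open>U\<^sup>*\<close> with the quasiaffinities
  \<open>X\<^sup>*\<close> and \<open>Y\<^sup>*\<close>. The assumption speaks of operators quasisimilar to \<open>U j\<close>, so it is applied to
  the adjoint of the restriction of \<open>T\<^sup>*\<close> to \<open>closure (X\<^sup>* (N j))\<close> (\<open>dual_lower_bound\<close>). The first estimate then
  holds for the vectors \<open>y j \<in> X\<^sup>* (N j)\<close>, and since \<open>Y (N i)\<close> and \<open>X\<^sup>* (N j)\<close> are orthogonal for \<open>i \<noteq> j\<close>,
  pairing \<open>x\<close> with such \<open>y\<close> shows that \<open>(norm x)\<^sup>2\<close> is at most \<open>(C M)\<^sup>2\<close> times the sum of the \<open>(norm (x j))\<^sup>2\<close>.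
  Passing from \<open>x\<close> to its components, from these to the components of \<open>T\<^sup>n x\<close>, and from there to \<open>T\<^sup>n x\<close> costs the
  factors \<open>C M\<close>, \<open>C\<close> and \<open>C M\<close>, which is the constant \<open>M\<^sup>2 C\<^sup>3\<close>.

  Now \<open>a\<close> is equivalent to the given inner product and \<open>T\<close> is unitary for \<open>a\<close>, so \<open>Y\<close> intertwines two unitary
  operators. The unitary factor of its polar decomposition intertwines them too (\<open>polar_similarity\<close>), and this is
  the similarity. The same lemma shows that a space carrying an operator quasisimilar to \<open>U j\<close> is isometric to the
  space of \<open>U j\<close> (\<open>neg_powers_bounded_on_isometric_copy\<close>), so that the assumption on \<open>U j\<close>, which is about
  subspaces of one ambient type, applies to subspaces of the type of \<open>H\<close>.
\<close>

section \<open>Subspaces and the inner product\<close>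

instance complex_hilbert \<subseteq> banach ..

lemma cinner_add_right: "cinner x (y + z) = cinner x y + cinner (x::'a::complex_hilbert) z"
  by (metis cinner_add_left cinner_commute complex_cnj_add)

lemma bounded_bilinear_cinner:
  "bounded_bilinear (cinner :: 'a::complex_hilbert \<Rightarrow> 'a \<Rightarrow> complex)"
  by (rule bounded_bilinear.intro, rule cinner_add_left, rule cinner_add_right)
    (auto simp: scaleR_eq_scaleC[where 'a='a] cinner_scaleC_left cinner_scaleC_right
      scaleR_conv_of_real intro!: exI[of _ 1] norm_cinner_le)

interpretation cinner: bounded_bilinear cinner
  by (rule bounded_bilinear_cinner)

lemma cinner_self: "cinner x x = of_real ((norm (x::'a::complex_hilbert))\<^sup>2)"
proof (rule complex_eqI)
  show "Re (cinner x x) = Re (of_real ((norm x)\<^sup>2))"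
    by (simp add: power2_norm_eq_inner inner_eq_Re_cinner)
  show "Im (cinner x x) = Im (of_real ((norm x)\<^sup>2))"
    using arg_cong[OF cinner_commute[of x x], of Im] by simp
qed

lemma cinner_self_eq_0: "cinner x x = 0 \<longleftrightarrow> x = (0::'a::complex_hilbert)"
  by (simp add: cinner_self)

lemma uminus_eq_scaleC: "- x = (- 1) *\<^sub>C (x::'a::complex_hilbert)"
  using scaleR_eq_scaleC[of "-1" x] by simp

definition csubspace :: "'a::complex_hilbert set \<Rightarrow> bool" where
  "csubspace S \<longleftrightarrow> 0 \<in> S \<and> (\<forall>x\<in>S. \<forall>y\<in>S. x + y \<in> S) \<and> (\<forall>c. \<forall>x\<in>S. c *\<^sub>C x \<in> S)"

lemma closed_csubspace_iff: "closed_csubspace S \<longleftrightarrow> closed S \<and> csubspace S"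
  by (auto simp: closed_csubspace_def csubspace_def)

lemma csubspace_zero: "csubspace S \<Longrightarrow> 0 \<in> S"
  and csubspace_add: "csubspace S \<Longrightarrow> x \<in> S \<Longrightarrow> y \<in> S \<Longrightarrow> x + y \<in> S"
  and csubspace_scaleC: "csubspace S \<Longrightarrow> x \<in> S \<Longrightarrow> c *\<^sub>C x \<in> S"
  by (auto simp: csubspace_def)

lemma csubspace_scaleR: "csubspace S \<Longrightarrow> x \<in> S \<Longrightarrow> r *\<^sub>R x \<in> S"
  by (simp add: scaleR_eq_scaleC csubspace_scaleC)

lemma csubspace_minus: "csubspace S \<Longrightarrow> x \<in> S \<Longrightarrow> - x \<in> S"
  using csubspace_scaleC[of S x "-1"] uminus_eq_scaleC[of x] by simp

lemma csubspace_diff: "csubspace S \<Longrightarrow> x \<in> S \<Longrightarrow> y \<in> S \<Longrightarrow> x - y \<in> S"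
  using csubspace_add[of S x "- y"] csubspace_minus[of S y] by simp

lemma csubspace_sum: "csubspace S \<Longrightarrow> (\<And>i. i \<in> I \<Longrightarrow> f i \<in> S) \<Longrightarrow> sum f I \<in> S"
  by (induction I rule: infinite_finite_induct) (auto simp: csubspace_zero csubspace_add)

lemmas csubspace_intros = csubspace_zero csubspace_add csubspace_scaleC csubspace_scaleR
  csubspace_minus csubspace_diff csubspace_sum

lemma closed_csubspaceD: "closed_csubspace S \<Longrightarrow> csubspace S" "closed_csubspace S \<Longrightarrow> closed S"
  by (auto simp: closed_csubspace_iff)

lemma closed_csubspace_limit:
  "closed_csubspace S \<Longrightarrow> (\<And>n. x n \<in> S) \<Longrightarrow> x \<longlonglongrightarrow> l \<Longrightarrow> l \<in> S"
  using closed_sequentially closed_csubspaceD(2) by blast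

lemma bounded_linear_scaleC: "bounded_linear (\<lambda>x::'a::complex_hilbert. c *\<^sub>C x)"
  by (rule bounded_linear_intro[where K = "cmod c"])
    (auto simp: scaleC_add_right scaleR_eq_scaleC scaleC_scaleC norm_scaleC mult.commute)

lemma closed_csubspace_closure:
  fixes S :: "'a::complex_hilbert set"
  assumes S: "csubspace S"
  shows "closed_csubspace (closure S)"
  unfolding closed_csubspace_iff csubspace_def
proof (intro conjI ballI allI)
  show "0 \<in> closure S"
    using csubspace_zero[OF S] closure_subset by blast
next
  fix x y assume "x \<in> closure S" "y \<in> closure S"
  then obtain f g where "\<And>n. f n \<in> S" "f \<longlonglongrightarrow> x" "\<And>n. g n \<in> S" "g \<longlonglongrightarrow> y"
    unfolding closure_sequential by blast
  thus "x + y \<in> closure S"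
    unfolding closure_sequential using csubspace_add[OF S]
    by (intro exI[of _ "\<lambda>n. f n + g n"]) (auto intro: tendsto_add)
next
  fix x c assume "x \<in> closure S"
  then obtain f where "\<And>n. f n \<in> S" "f \<longlonglongrightarrow> x"
    unfolding closure_sequential by blast
  thus "c *\<^sub>C x \<in> closure S"
    unfolding closure_sequential using csubspace_scaleC[OF S]
    by (intro exI[of _ "\<lambda>n. c *\<^sub>C f n"])
      (auto intro: bounded_linear.tendsto[OF bounded_linear_scaleC])
qed simp

section \<open>The Riesz representation theorem\<close>

text \<open>The representing vector is the minimiser of \<open>\<lambda>x. (norm x)\<^sup>2 - 2 * f x\<close>: the parallelogram law
  makes every minimising sequence a Cauchy sequence, and a minimiser is a critical point. The
  real statement gives the projection theorem and, by taking real parts, the complex statement.\<close>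

lemma riesz_real:
  fixes f :: "'a::complex_hilbert \<Rightarrow> real"
  assumes S: "closed_csubspace S"
    and add: "\<And>x y. x \<in> S \<Longrightarrow> y \<in> S \<Longrightarrow> f (x + y) = f x + f y"
    and scale: "\<And>r x. x \<in> S \<Longrightarrow> f (r *\<^sub>R x) = r * f x"
    and bd: "\<And>x. x \<in> S \<Longrightarrow> \<bar>f x\<bar> \<le> B * norm x"
  shows "\<exists>z\<in>S. \<forall>x\<in>S. f x = inner x z"
proof -
  have fdiff: "f (x - y) = f x - f y" if "x \<in> S" "y \<in> S" for x y
    using add[of x "(-1) *\<^sub>R y"] scale[of y "-1"] that by (simp add: csubspace_intros(5)[OF closed_csubspaceD(1)[OF S]])
  define q where "q x = (norm x)\<^sup>2 - 2 * f x" for x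
  define m where "m = Inf (q ` S)"
  have lower: "- B\<^sup>2 \<le> q x" if "x \<in> S" for x
  proof -
    have "0 \<le> (norm x - B)\<^sup>2" by simp
    thus ?thesis
      using bd[OF that] by (simp add: q_def power2_diff mult.commute[of B])
  qed
  have m_le: "m \<le> q x" if "x \<in> S" for x
    unfolding m_def using lower that by (intro cInf_lower bdd_belowI2) auto
  have par: "(norm (x - y))\<^sup>2 \<le> 2 * (q x - m) + 2 * (q y - m)" if "x \<in> S" "y \<in> S" for x y
  proof -
    have "m \<le> q ((1/2) *\<^sub>R (x + y))"
      by (intro m_le csubspace_intros closed_csubspaceD(1)[OF S] that)
    also have "q ((1/2) *\<^sub>R (x + y)) = (norm (x + y))\<^sup>2 / 4 - (f x + f y)"
      using scale[of "x + y" "1/2"] add[OF that] csubspace_add[OF closed_csubspaceD(1)[OF S] that]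
      by (simp add: q_def power_divide)
    finally have "4 * m \<le> (norm (x + y))\<^sup>2 - 4 * f x - 4 * f y"
      by simp
    moreover have "(norm (x - y))\<^sup>2 + (norm (x + y))\<^sup>2 = 2 * (norm x)\<^sup>2 + 2 * (norm y)\<^sup>2"
      by (simp add: power2_norm_eq_inner algebra_simps inner_commute)
    ultimately show ?thesis
      by (simp add: q_def)
  qed
  have "\<exists>x\<in>S. q x < m + 1 / real (Suc n)" for n
  proof -
    have "Inf (q ` S) < m + 1 / real (Suc n)"
      by (simp add: m_def)
    thus ?thesis
      using cInf_lessD[of "q ` S"] csubspace_zero[OF closed_csubspaceD(1)[OF S]] by blast
  qed
  then obtain x where x: "\<And>n. x n \<in> S" "\<And>n. q (x n) < m + 1 / real (Suc n)"
    by metis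
  have "Cauchy x"
  proof (rule metric_CauchyI)
    fix e :: real assume e: "e > 0"
    then obtain N where N: "1 / real (Suc N) < e\<^sup>2 / 4"
      using nat_approx_posE[of "e\<^sup>2 / 4"] by auto
    have "dist (x i) (x j) < e" if "i \<ge> N" "j \<ge> N" for i j
    proof -
      have close: "q (x k) - m < e\<^sup>2 / 4" if "k \<ge> N" for k
      proof -
        have "1 / real (Suc k) \<le> 1 / real (Suc N)"
          using that by (intro divide_left_mono) auto
        thus ?thesis using x(2)[of k] N by linarith
      qed
      have "p < 4 * d" if "p \<le> 2 * a + 2 * b" "a < d" "b < d" for p a b d :: real
        using that by linarith
      from this[OF par[OF x(1)[of i] x(1)[of j]] close[OF that(1)] close[OF that(2)]]
      have "(norm (x i - x j))\<^sup>2 < e\<^sup>2"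
        by simp
      thus ?thesis
        using e by (simp add: dist_norm power2_less_imp_less)
    qed
    thus "\<exists>N. \<forall>i\<ge>N. \<forall>j\<ge>N. dist (x i) (x j) < e" by blast
  qed
  then obtain z where xz: "x \<longlonglongrightarrow> z"
    by (auto simp: Cauchy_convergent_iff convergent_def)
  have z: "z \<in> S"
    by (rule closed_csubspace_limit[OF S x(1) xz])
  have "(\<lambda>n. f (x n)) \<longlonglongrightarrow> f z"
  proof (rule Lim_transform_bound[where g = "\<lambda>n. B * norm (x n - z)" for B, THEN LIM_zero_cancel])
    show "\<forall>\<^sub>F n in sequentially. norm (f (x n) - f z) \<le> norm (B * norm (x n - z))"
    proof (intro always_eventually allI)
      fix n
      have "norm (f (x n) - f z) \<le> B * norm (x n - z)"
        using bd[of "x n - z"] fdiff[OF x(1) z, of n] x(1) z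
        by (simp add: csubspace_diff[OF closed_csubspaceD(1)[OF S]])
      thus "norm (f (x n) - f z) \<le> norm (B * norm (x n - z))"
        by simp
    qed
    show "(\<lambda>n. B * norm (x n - z)) \<longlonglongrightarrow> 0"
      using tendsto_mult_right_zero[OF tendsto_norm_zero[OF LIM_zero[OF xz]]] .
  qed
  hence "(\<lambda>n. q (x n)) \<longlonglongrightarrow> q z"
    unfolding q_def by (intro tendsto_intros xz)
  moreover have "(\<lambda>n. m + 1 / real (Suc n)) \<longlonglongrightarrow> m + 0"
    by (intro tendsto_add tendsto_const LIMSEQ_inverse_real_of_nat[unfolded inverse_eq_divide])
  ultimately have qz: "q z \<le> m"
    using LIMSEQ_le[of "\<lambda>n. q (x n)" "q z"] less_imp_le[OF x(2)] by fastforce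
  have "f y = inner y z" if y: "y \<in> S" for y
  proof -
    have "0 \<le> t\<^sup>2 * (norm y)\<^sup>2 + 2 * t * (inner y z - f y)" for t
    proof -
      have ty: "t *\<^sub>R y \<in> S"
        by (intro csubspace_intros closed_csubspaceD(1)[OF S] y)
      have "q z \<le> q (z + t *\<^sub>R y)"
        using m_le[of "z + t *\<^sub>R y"] qz csubspace_add[OF closed_csubspaceD(1)[OF S] z ty] by linarith
      also have "q (z + t *\<^sub>R y) = q z + t\<^sup>2 * (norm y)\<^sup>2 + 2 * t * (inner y z - f y)"
        using add[OF z ty] scale[OF y]
        by (simp add: q_def power2_norm_eq_inner algebra_simps inner_commute power2_eq_square[of t])
      finally show ?thesis by simp
    qed
    note pos = this
    show ?thesis
    proof (rule ccontr)
      assume ne: "f y \<noteq> inner y z"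
      define d where "d = inner y z - f y"
      have d: "d \<noteq> 0" using ne by (simp add: d_def)
      \<comment> \<open>The increment \<open>t = - d / N\<close> is close to the minimiser of the quadratic polynomial in \<open>pos\<close>, and adding 1
        keeps it meaningful for \<open>y = 0\<close>.\<close>
      define N where "N = (norm y)\<^sup>2 + 1"
      have N: "N > 0" by (simp add: N_def add_nonneg_pos)
      have "(d / N)\<^sup>2 * (norm y)\<^sup>2 \<le> (d / N)\<^sup>2 * N"
        by (intro mult_left_mono) (auto simp: N_def)
      also have "\<dots> = d\<^sup>2 / N"
        using N by (simp add: power2_eq_square)
      finally have "0 \<le> d\<^sup>2 / N - 2 * (d\<^sup>2 / N)"
        using pos[of "- (d / N)"] by (simp add: d_def[symmetric] power2_eq_square)
      moreover have "d\<^sup>2 / N > 0" using d N by simp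
      ultimately show False by linarith
    qed
  qed
  thus ?thesis using z by blast
qed

lemma riesz:
  fixes f :: "'a::complex_hilbert \<Rightarrow> complex"
  assumes S: "closed_csubspace S"
    and add: "\<And>x y. x \<in> S \<Longrightarrow> y \<in> S \<Longrightarrow> f (x + y) = f x + f y"
    and scale: "\<And>c x. x \<in> S \<Longrightarrow> f (c *\<^sub>C x) = c * f x"
    and bd: "\<And>x. x \<in> S \<Longrightarrow> cmod (f x) \<le> B * norm x"
  shows "\<exists>z\<in>S. \<forall>x\<in>S. f x = cinner x z"
proof -
  have "\<exists>z\<in>S. \<forall>x\<in>S. Re (f x) = inner x z"
  proof (rule riesz_real[OF S])
    show "\<bar>Re (f x)\<bar> \<le> B * norm x" if "x \<in> S" for x
      using bd[OF that] abs_Re_le_cmod[of "f x"] by linarith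
  qed (simp_all add: add scale scaleR_eq_scaleC)
  then obtain z where z: "z \<in> S" "\<And>x. x \<in> S \<Longrightarrow> Re (f x) = Re (cinner x z)"
    by (auto simp: inner_eq_Re_cinner)
  have "f x = cinner x z" if x: "x \<in> S" for x
  proof (rule complex_eqI)
    show "Re (f x) = Re (cinner x z)" using z(2)[OF x] .
    have "Re (f (\<i> *\<^sub>C x)) = Re (cinner (\<i> *\<^sub>C x) z)"
      by (intro z(2) csubspace_scaleC closed_csubspaceD(1)[OF S] x)
    thus "Im (f x) = Im (cinner x z)"
      using x by (simp add: scale cinner_scaleC_left)
  qed
  thus ?thesis using z(1) by blast
qed

lemma orthogonal_projection:
  fixes x :: "'a::complex_hilbert"
  assumes L: "closed_csubspace L"
  obtains p where "p \<in> L" "\<And>y. y \<in> L \<Longrightarrow> cinner y (x - p) = 0"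
proof -
  have "\<exists>p\<in>L. \<forall>y\<in>L. cinner y x = cinner y p"
  proof (rule riesz[OF L, where B = "norm x"])
    show "cmod (cinner y x) \<le> norm x * norm y" for y
      using norm_cinner_le[of y x] by (simp add: mult.commute)
  qed (simp_all add: cinner_add_left cinner_scaleC_left)
  then obtain p where "p \<in> L" "\<And>y. y \<in> L \<Longrightarrow> cinner y x = cinner y p"
    by blast
  thus thesis
    by (intro that[of p]) (simp_all add: cinner.diff_right)
qed

text \<open>Density of ranges is always checked through this criterion, since adjoints turn the orthogonality
  condition into a statement about kernels.\<close>

lemma dense_if_orthogonal_trivial:
  assumes S: "csubspace S" "S \<subseteq> H" and H: "closed_csubspace H"
    and triv: "\<And>h. h \<in> H \<Longrightarrow> (\<And>s. s \<in> S \<Longrightarrow> cinner s h = 0) \<Longrightarrow> h = 0"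
  shows "closure S = H"
proof
  show sub: "closure S \<subseteq> H"
    using S(2) closed_csubspaceD(2)[OF H] by (simp add: closure_minimal)
  show "H \<subseteq> closure S"
  proof
    fix h assume h: "h \<in> H"
    obtain p where p: "p \<in> closure S" "\<And>y. y \<in> closure S \<Longrightarrow> cinner y (h - p) = 0"
      using orthogonal_projection[OF closed_csubspace_closure[OF S(1)]] by metis
    have "h - p = 0"
      using p sub h closure_subset[of S]
      by (intro triv csubspace_diff closed_csubspaceD(1)[OF H]) auto
    thus "h \<in> closure S" using p(1) by simp
  qed
qed

lemma orthogonal_dense_trivial:
  assumes "h \<in> closure S" "\<And>s. s \<in> S \<Longrightarrow> cinner s h = 0"
  shows "h = (0::'a::complex_hilbert)"
proof -
  obtain f where f: "\<And>n. f n \<in> S" "f \<longlonglongrightarrow> h"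
    using assms(1) unfolding closure_sequential by blast
  have "(\<lambda>n. cinner (f n) h) \<longlonglongrightarrow> cinner h h"
    by (intro cinner.tendsto f tendsto_const)
  hence "cinner h h = 0"
    using assms(2) f(1) LIMSEQ_unique[OF _ tendsto_const] by simp
  thus ?thesis by (simp add: cinner_self_eq_0)
qed

section \<open>Bounded operators and bounded forms\<close>

lemma bounded_opI:
  assumes "\<And>x. x \<in> H \<Longrightarrow> A x \<in> K"
    and "\<And>x y. x \<in> H \<Longrightarrow> y \<in> H \<Longrightarrow> A (x + y) = A x + A y"
    and "\<And>c x. x \<in> H \<Longrightarrow> A (c *\<^sub>C x) = c *\<^sub>C A x"
    and "\<And>x. x \<in> H \<Longrightarrow> norm (A x) \<le> B * norm x"
  shows "bounded_op H K A"
  using assms unfolding bounded_op_def by blast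

lemma bounded_op_in: "bounded_op H K A \<Longrightarrow> x \<in> H \<Longrightarrow> A x \<in> K"
  and bounded_op_add: "bounded_op H K A \<Longrightarrow> x \<in> H \<Longrightarrow> y \<in> H \<Longrightarrow> A (x + y) = A x + A y"
  and bounded_op_scaleC: "bounded_op H K A \<Longrightarrow> x \<in> H \<Longrightarrow> A (c *\<^sub>C x) = c *\<^sub>C A x"
  unfolding bounded_op_def by blast+

lemma bounded_op_bound:
  assumes "bounded_op H K A"
  obtains B where "B > 0" "\<And>x. x \<in> H \<Longrightarrow> norm (A x) \<le> B * norm x"
proof -
  obtain B where B: "\<And>x. x \<in> H \<Longrightarrow> norm (A x) \<le> B * norm x"
    using assms unfolding bounded_op_def by blast
  have "norm (A x) \<le> max B 1 * norm x" if "x \<in> H" for x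
    using B[OF that] mult_right_mono[of B "max B 1" "norm x"] by simp
  thus thesis by (intro that[of "max B 1"]) auto
qed

lemma bounded_op_zero:
  assumes "bounded_op H K A" "csubspace H"
  shows "A 0 = 0"
proof -
  obtain B where "\<And>x. x \<in> H \<Longrightarrow> norm (A x) \<le> B * norm x"
    using bounded_op_bound[OF assms(1)] by metis
  from this[OF csubspace_zero[OF assms(2)]] show ?thesis by simp
qed

lemma bounded_op_minus: "bounded_op H K A \<Longrightarrow> x \<in> H \<Longrightarrow> A (- x) = - A x"
  using bounded_op_scaleC[of H K A x "-1"] uminus_eq_scaleC[of x] uminus_eq_scaleC[of "A x"] by simp

lemma bounded_op_diff:
  "bounded_op H K A \<Longrightarrow> csubspace H \<Longrightarrow> x \<in> H \<Longrightarrow> y \<in> H \<Longrightarrow> A (x - y) = A x - A y"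
  using bounded_op_add[of H K A x "- y"] bounded_op_minus[of H K A y] csubspace_minus[of H y]
  by simp

lemma bounded_op_sum:
  assumes "bounded_op H K A" "csubspace H" "\<And>i. i \<in> I \<Longrightarrow> f i \<in> H"
  shows "A (sum f I) = (\<Sum>i\<in>I. A (f i))"
  using assms(3)
proof (induction I rule: infinite_finite_induct)
  case (insert i I)
  thus ?case
    using csubspace_sum[OF assms(2), of I f] by (simp add: bounded_op_add[OF assms(1)])
qed (simp_all add: bounded_op_zero[OF assms(1,2)])

lemma bounded_op_tendsto:
  assumes A: "bounded_op H K A" and H: "csubspace H"
    and x: "\<And>n. x n \<in> H" and l: "l \<in> H" and lim: "x \<longlonglongrightarrow> l"
  shows "(\<lambda>n. A (x n)) \<longlonglongrightarrow> A l"
proof -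
  obtain B where B: "B > 0" "\<And>x. x \<in> H \<Longrightarrow> norm (A x) \<le> B * norm x"
    using bounded_op_bound[OF A] by metis
  have "(\<lambda>n. A (x n) - A l) \<longlonglongrightarrow> 0"
  proof (rule Lim_null_comparison)
    show "\<forall>\<^sub>F n in sequentially. norm (A (x n) - A l) \<le> B * norm (x n - l)"
      using B(2) csubspace_diff[OF H x l] by (simp add: bounded_op_diff[OF A H x l, symmetric])
    show "(\<lambda>n. B * norm (x n - l)) \<longlonglongrightarrow> 0"
      using tendsto_mult_right_zero[OF tendsto_norm_zero[OF LIM_zero[OF lim]]] .
  qed
  thus ?thesis by (rule LIM_zero_cancel)
qed

lemma bounded_op_id: "H \<subseteq> K \<Longrightarrow> bounded_op H K (\<lambda>x. x)"
  by (rule bounded_opI[where B = 1]) auto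

lemma bounded_op_compose:
  assumes A: "bounded_op H K A" and B: "bounded_op K L B"
  shows "bounded_op H L (\<lambda>x. B (A x))"
proof -
  obtain a where a: "a > 0" "\<And>x. x \<in> H \<Longrightarrow> norm (A x) \<le> a * norm x"
    using bounded_op_bound[OF A] by metis
  obtain b where b: "b > 0" "\<And>x. x \<in> K \<Longrightarrow> norm (B x) \<le> b * norm x"
    using bounded_op_bound[OF B] by metis
  show ?thesis
  proof (rule bounded_opI[where B = "b * a"])
    fix x assume x: "x \<in> H"
    have "norm (B (A x)) \<le> b * norm (A x)"
      by (intro b bounded_op_in[OF A] x)
    also have "\<dots> \<le> b * (a * norm x)"
      using a(2)[OF x] b(1) by (intro mult_left_mono) auto
    finally show "norm (B (A x)) \<le> b * a * norm x" by simp
  qed (auto simp: bounded_op_in[OF A] bounded_op_in[OF B] bounded_op_add[OF A]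
      bounded_op_add[OF B] bounded_op_scaleC[OF A] bounded_op_scaleC[OF B])
qed

lemma bounded_op_scaleR:
  assumes A: "bounded_op H K A" and K: "csubspace K"
  shows "bounded_op H K (\<lambda>x. r *\<^sub>R A x)"
proof -
  obtain B where B: "B > 0" "\<And>x. x \<in> H \<Longrightarrow> norm (A x) \<le> B * norm x"
    using bounded_op_bound[OF A] by blast
  show ?thesis
  proof (rule bounded_opI[where B = "\<bar>r\<bar> * B"])
    show "r *\<^sub>R A (c *\<^sub>C x) = c *\<^sub>C (r *\<^sub>R A x)" if "x \<in> H" for c x
      by (simp add: bounded_op_scaleC[OF A that] scaleR_eq_scaleC scaleC_scaleC mult.commute)
    show "norm (r *\<^sub>R A x) \<le> \<bar>r\<bar> * B * norm x" if "x \<in> H" for x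
      using mult_left_mono[OF B(2)[OF that], of "\<bar>r\<bar>"] by (simp add: mult.assoc)
  qed (simp_all add: csubspace_scaleR[OF K] bounded_op_in[OF A] bounded_op_add[OF A] scaleR_add_right)
qed

lemma bounded_op_restrict:
  assumes "bounded_op H K A" "H' \<subseteq> H" "A ` H' \<subseteq> K'"
  shows "bounded_op H' K' A"
  using assms unfolding bounded_op_def by blast

lemma bounded_op_image_closure:
  assumes A: "bounded_op H K A" and H: "csubspace H" and S: "closure S \<subseteq> H"
    and L: "closed L" "A ` S \<subseteq> L"
  shows "A ` closure S \<subseteq> L"
proof clarify
  fix x assume x: "x \<in> closure S"
  then obtain f where f: "\<And>n. f n \<in> S" "f \<longlonglongrightarrow> x"
    unfolding closure_sequential by blast
  have "f n \<in> H" "A (f n) \<in> L" for n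
    using f(1)[of n] S L(2) closure_subset[of S] by auto
  moreover have "x \<in> H"
    using S x by blast
  ultimately have "(\<lambda>n. A (f n)) \<longlonglongrightarrow> A x" "\<And>n. A (f n) \<in> L"
    using bounded_op_tendsto[OF A H _ _ f(2)] by simp_all
  thus "A x \<in> L"
    using closed_sequentially[OF L(1)] by metis
qed

lemma bounded_op_eq_on_closure:
  assumes A: "bounded_op H K A" and B: "bounded_op H K B" and H: "closed_csubspace H"
    and S: "closure S = H" and eq: "\<And>s. s \<in> S \<Longrightarrow> A s = B s" and x: "x \<in> H"
  shows "A x = B x"
proof -
  obtain f where f: "\<And>n. f n \<in> S" "f \<longlonglongrightarrow> x"
    using x unfolding S[symmetric] closure_sequential by blast
  have fH: "f n \<in> H" for n
    using f(1) S closure_subset by blast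
  show ?thesis
    using LIMSEQ_unique[OF bounded_op_tendsto[OF A closed_csubspaceD(1)[OF H] fH x f(2)]]
      bounded_op_tendsto[OF B closed_csubspaceD(1)[OF H] fH x f(2)] eq[OF f(1)] by simp
qed

lemma bounded_op_csubspace_image:
  assumes A: "bounded_op H K A" and S: "csubspace S" "S \<subseteq> H"
  shows "csubspace (A ` S)"
  unfolding csubspace_def
proof (intro conjI ballI allI)
  show "0 \<in> A ` S"
    using bounded_op_zero[OF bounded_op_restrict[OF A S(2) subset_refl] S(1)] csubspace_zero[OF S(1)]
    by (metis image_eqI)
next
  fix x y assume "x \<in> A ` S" "y \<in> A ` S"
  then obtain x' y' where "x' \<in> S" "y' \<in> S" "x = A x'" "y = A y'"
    by blast
  thus "x + y \<in> A ` S"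
    using S bounded_op_add[OF A, of x' y'] csubspace_add[OF S(1)] by (metis image_eqI subsetD)
next
  fix c x assume "x \<in> A ` S"
  then obtain x' where "x' \<in> S" "x = A x'"
    by blast
  thus "c *\<^sub>C x \<in> A ` S"
    using S bounded_op_scaleC[OF A, of x' c] csubspace_scaleC[OF S(1)] by (metis image_eqI subsetD)
qed

lemma bounded_op_funpow: "bounded_op H H T \<Longrightarrow> bounded_op H H (T ^^ n)"
proof (induction n)
  case 0
  show ?case by (simp add: id_def bounded_op_id)
next
  case (Suc n)
  thus ?case by (simp add: o_def bounded_op_compose)
qed

lemma funpow_intertwine:
  assumes "\<And>x. x \<in> H \<Longrightarrow> T x \<in> H" "\<And>x. x \<in> H \<Longrightarrow> X (T x) = R (X x)" "x \<in> H"
  shows "X ((T ^^ n) x) = (R ^^ n) (X x)"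
proof -
  have "(T ^^ n) x \<in> H \<and> X ((T ^^ n) x) = (R ^^ n) (X x)"
    using assms by (induction n) auto
  thus ?thesis ..
qed

text \<open>Such a form is an operator from \<open>H\<close> to \<open>K\<close> that has not yet been applied to the Riesz theorem. Inner
  products, adjoints and the invariant form of a power bounded operator all enter in this shape.\<close>

definition bounded_form ::
    "'a::complex_hilbert set \<Rightarrow> 'b::complex_hilbert set \<Rightarrow> ('a \<Rightarrow> 'b \<Rightarrow> complex) \<Rightarrow> bool" where
  "bounded_form H K b \<longleftrightarrow>
    (\<forall>x\<in>H. \<forall>x'\<in>H. \<forall>y\<in>K. b (x + x') y = b x y + b x' y) \<and>
    (\<forall>x\<in>H. \<forall>y\<in>K. \<forall>y'\<in>K. b x (y + y') = b x y + b x y') \<and>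
    (\<forall>x\<in>H. \<forall>y\<in>K. \<forall>c. b (c *\<^sub>C x) y = c * b x y) \<and>
    (\<forall>x\<in>H. \<forall>y\<in>K. \<forall>c. b x (c *\<^sub>C y) = cnj c * b x y) \<and>
    (\<exists>B. \<forall>x\<in>H. \<forall>y\<in>K. cmod (b x y) \<le> B * norm x * norm y)"

lemma bounded_formD:
  assumes "bounded_form H K b" "x \<in> H" "y \<in> K"
  shows "x' \<in> H \<Longrightarrow> b (x + x') y = b x y + b x' y"
    and "y' \<in> K \<Longrightarrow> b x (y + y') = b x y + b x y'"
    and "b (c *\<^sub>C x) y = c * b x y"
    and "b x (c *\<^sub>C y) = cnj c * b x y"
    and "b (- x) y = - b x y"
    and "b x (- y) = - b x y"
  using assms unfolding bounded_form_def uminus_eq_scaleC[of x] uminus_eq_scaleC[of y] by simp_all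

lemma bounded_form_bound:
  assumes "bounded_form H K b"
  obtains B where "B > 0" "\<And>x y. x \<in> H \<Longrightarrow> y \<in> K \<Longrightarrow> cmod (b x y) \<le> B * norm x * norm y"
proof -
  obtain B where B: "\<And>x y. x \<in> H \<Longrightarrow> y \<in> K \<Longrightarrow> cmod (b x y) \<le> B * norm x * norm y"
    using assms unfolding bounded_form_def by blast
  have "cmod (b x y) \<le> max B 1 * norm x * norm y" if "x \<in> H" "y \<in> K" for x y
  proof -
    have "B * (norm x * norm y) \<le> max B 1 * (norm x * norm y)"
      by (intro mult_right_mono) auto
    thus ?thesis using B[OF that] by (simp add: mult.assoc)
  qed
  thus thesis by (intro that[of "max B 1"]) auto
qed

lemma bounded_form_cinner: "bounded_form H H cinner"
  unfolding bounded_form_def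
  by (auto simp: cinner_add_left cinner_add_right cinner_scaleC_left cinner_scaleC_right
      intro!: exI[of _ 1] norm_cinner_le)

lemma bounded_form_compose:
  assumes b: "bounded_form H K b" and A: "bounded_op H' H A" and B: "bounded_op K' K B"
  shows "bounded_form H' K' (\<lambda>x y. b (A x) (B y))"
proof -
  obtain p where p: "p > 0" "\<And>x. x \<in> H' \<Longrightarrow> norm (A x) \<le> p * norm x"
    using bounded_op_bound[OF A] by metis
  obtain q where q: "q > 0" "\<And>x. x \<in> K' \<Longrightarrow> norm (B x) \<le> q * norm x"
    using bounded_op_bound[OF B] by metis
  obtain r where r: "r > 0" "\<And>x y. x \<in> H \<Longrightarrow> y \<in> K \<Longrightarrow> cmod (b x y) \<le> r * norm x * norm y"
    using bounded_form_bound[OF b] by metis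
  have "cmod (b (A x) (B y)) \<le> r * p * q * norm x * norm y" if "x \<in> H'" "y \<in> K'" for x y
  proof -
    have "cmod (b (A x) (B y)) \<le> r * (norm (A x) * norm (B y))"
      using r(2)[OF bounded_op_in[OF A that(1)] bounded_op_in[OF B that(2)]] by (simp add: mult.assoc)
    also have "\<dots> \<le> r * ((p * norm x) * (q * norm y))"
      using p q r that by (intro mult_left_mono mult_mono) auto
    finally show ?thesis by (simp add: ac_simps)
  qed
  thus ?thesis
    using b bounded_op_in[OF A] bounded_op_in[OF B] unfolding bounded_form_def
    by (auto simp: bounded_op_add[OF A] bounded_op_add[OF B] bounded_op_scaleC[OF A]
        bounded_op_scaleC[OF B])
qed

lemma bounded_form_tendsto:
  assumes b: "bounded_form H K b" and H: "csubspace H" and K: "csubspace K"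
    and x: "\<And>n. x n \<in> H" "x' \<in> H" "x \<longlonglongrightarrow> x'" and y: "\<And>n. y n \<in> K" "y' \<in> K" "y \<longlonglongrightarrow> y'"
  shows "(\<lambda>n. b (x n) (y n)) \<longlonglongrightarrow> b x' y'"
proof -
  obtain r where r: "r > 0" "\<And>x y. x \<in> H \<Longrightarrow> y \<in> K \<Longrightarrow> cmod (b x y) \<le> r * norm x * norm y"
    using bounded_form_bound[OF b] by metis
  have split: "b (x n) (y n) - b x' y' = b (x n - x') (y n) + b x' (y n - y')" for n
    using bounded_formD(1)[OF b csubspace_diff[OF H x(1) x(2)] y(1) x(2), of n n]
      bounded_formD(2)[OF b x(2) csubspace_diff[OF K y(1) y(2)] y(2), of n] by simp
  have "(\<lambda>n. b (x n) (y n) - b x' y') \<longlonglongrightarrow> 0"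
  proof (rule Lim_null_comparison)
    show "\<forall>\<^sub>F n in sequentially. norm (b (x n) (y n) - b x' y') \<le>
        r * norm (x n - x') * norm (y n) + r * norm x' * norm (y n - y')"
      unfolding split
      by (intro always_eventually allI norm_triangle_mono r csubspace_diff H K x y)
    have "(\<lambda>n. r * norm (x n - x') * norm (y n) + r * norm x' * norm (y n - y'))
        \<longlonglongrightarrow> r * norm (x' - x') * norm y' + r * norm x' * norm (y' - y')"
      by (intro tendsto_intros x y)
    thus "(\<lambda>n. r * norm (x n - x') * norm (y n) + r * norm x' * norm (y n - y')) \<longlonglongrightarrow> 0"
      by simp
  qed
  thus ?thesis by (rule LIM_zero_cancel)
qed

lemma form_operator:
  fixes K :: "'b::complex_hilbert set"
  assumes b: "bounded_form H K b" and H: "csubspace H" and K: "closed_csubspace K"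
  obtains A where "bounded_op H K A" "\<And>x y. x \<in> H \<Longrightarrow> y \<in> K \<Longrightarrow> cinner (A x) y = b x y"
proof -
  obtain r where r: "r > 0" "\<And>x y. x \<in> H \<Longrightarrow> y \<in> K \<Longrightarrow> cmod (b x y) \<le> r * norm x * norm y"
    using bounded_form_bound[OF b] by metis
  have "\<exists>z\<in>K. \<forall>y\<in>K. cnj (b x y) = cinner y z" if "x \<in> H" for x
    by (rule riesz[OF K, where B = "r * norm x"])
      (use r that in \<open>simp_all add: bounded_formD[OF b]\<close>)
  then obtain A where A: "\<And>x. x \<in> H \<Longrightarrow> A x \<in> K"
    "\<And>x y. x \<in> H \<Longrightarrow> y \<in> K \<Longrightarrow> cnj (b x y) = cinner y (A x)"
    by metis
  have eq: "cinner (A x) y = b x y" if "x \<in> H" "y \<in> K" for x y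
    using A(2)[OF that] cinner_commute[of "A x" y] by (metis complex_cnj_cnj)
  have uniq: "A x = z" if "x \<in> H" "z \<in> K" "\<And>y. y \<in> K \<Longrightarrow> cinner z y = b x y" for x z
  proof -
    have "cinner (A x - z) (A x - z) = 0"
      using that(3)[of "A x - z"] eq[OF that(1), of "A x - z"]
        csubspace_diff[OF closed_csubspaceD(1)[OF K] A(1)[OF that(1)] that(2)]
      by (simp add: cinner.diff_left)
    thus ?thesis by (simp add: cinner_self_eq_0)
  qed
  have "norm (A x) \<le> r * norm x" if x: "x \<in> H" for x
  proof (cases "A x = 0")
    case False
    have "(norm (A x))\<^sup>2 = cmod (cinner (A x) (A x))"
      by (simp add: cinner_self norm_power)
    also have "\<dots> \<le> r * norm x * norm (A x)"
      using r(2)[OF x A(1)[OF x]] eq[OF x A(1)[OF x]] by simp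
    finally show ?thesis
      using False by (simp add: power2_eq_square)
  qed (use r(1) in simp)
  note bound = this
  have "bounded_op H K A"
  proof (rule bounded_opI[where B = r])
    show "A (x + x') = A x + A x'" if x: "x \<in> H" "x' \<in> H" for x x'
      using x by (intro uniq csubspace_add closed_csubspaceD(1)[OF K] H A)
        (auto simp: cinner_add_left eq bounded_formD[OF b])
    show "A (c *\<^sub>C x) = c *\<^sub>C A x" if x: "x \<in> H" for c x
      using x by (intro uniq csubspace_scaleC closed_csubspaceD(1)[OF K] H A)
        (auto simp: cinner_scaleC_left eq bounded_formD[OF b])
  qed (auto intro: A bound)
  thus thesis using eq that by blast
qed

section \<open>Adjoints and quasiaffinities\<close>

definition adjoint_pair ::
    "'a::complex_hilbert set \<Rightarrow> 'b::complex_hilbert set \<Rightarrow> ('a \<Rightarrow> 'b) \<Rightarrow> ('b \<Rightarrow> 'a) \<Rightarrow> bool" where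
  "adjoint_pair H K A A' \<longleftrightarrow> bounded_op H K A \<and> bounded_op K H A' \<and>
    (\<forall>x\<in>H. \<forall>y\<in>K. cinner (A x) y = cinner x (A' y))"

lemma adjoint_pairD:
  assumes "adjoint_pair H K A A'"
  shows "bounded_op H K A" "bounded_op K H A'"
    and "x \<in> H \<Longrightarrow> y \<in> K \<Longrightarrow> cinner (A x) y = cinner x (A' y)"
  using assms unfolding adjoint_pair_def by blast+

lemma adjoint_pair_sym:
  assumes "adjoint_pair H K A A'"
  shows "adjoint_pair K H A' A"
  using assms unfolding adjoint_pair_def by (metis cinner_commute)

lemma adjoint_exists:
  assumes A: "bounded_op H K A" and H: "closed_csubspace H" and K: "closed_csubspace K"
  obtains A' where "adjoint_pair H K A A'"
proof -
  have "bounded_form K H (\<lambda>y x. cinner y (A x))"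
    by (rule bounded_form_compose[OF bounded_form_cinner bounded_op_id[OF subset_refl] A])
  then obtain A' where A': "bounded_op K H A'"
    "\<And>y x. y \<in> K \<Longrightarrow> x \<in> H \<Longrightarrow> cinner (A' y) x = cinner y (A x)"
    using form_operator[OF _ closed_csubspaceD(1)[OF K] H, of "\<lambda>y x. cinner y (A x)"] by blast
  have "adjoint_pair K H A' A"
    using A A' unfolding adjoint_pair_def by blast
  thus thesis
    by (rule that[OF adjoint_pair_sym])
qed

lemma eq_if_cinner_eq:
  assumes H: "csubspace H" "u \<in> H" "v \<in> H"
    and eq: "\<And>x. x \<in> H \<Longrightarrow> cinner x u = cinner x v"
  shows "u = v"
proof -
  have "cinner (u - v) (u - v) = 0"
    using eq[OF csubspace_diff[OF H]] by (simp add: cinner.diff_right)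
  thus ?thesis by (simp add: cinner_self_eq_0)
qed

lemma adjoint_intertwine:
  assumes X: "adjoint_pair H K X X'" and T: "adjoint_pair H H T T'" and R: "adjoint_pair K K R R'"
    and H: "csubspace H" and eq: "\<And>x. x \<in> H \<Longrightarrow> X (T x) = R (X x)" and y: "y \<in> K"
  shows "X' (R' y) = T' (X' y)"
proof (rule eq_if_cinner_eq[OF H])
  show "X' (R' y) \<in> H" "T' (X' y) \<in> H"
    using X T R y by (meson adjoint_pairD bounded_op_in)+
  fix x assume x: "x \<in> H"
  have "cinner x (X' (R' y)) = cinner (X x) (R' y)"
    using adjoint_pairD[OF X] x y bounded_op_in[OF adjoint_pairD(2)[OF R]] by simp
  also have "\<dots> = cinner (R (X x)) y"
    using adjoint_pairD[OF R] x y bounded_op_in[OF adjoint_pairD(1)[OF X]] by simp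
  also have "\<dots> = cinner (T x) (X' y)"
    using adjoint_pairD[OF X] x y bounded_op_in[OF adjoint_pairD(1)[OF T]] by (simp add: eq[symmetric])
  also have "\<dots> = cinner x (T' (X' y))"
    using adjoint_pairD[OF T] x y bounded_op_in[OF adjoint_pairD(2)[OF X]] by simp
  finally show "cinner x (X' (R' y)) = cinner x (T' (X' y))" .
qed

lemma adjoint_funpow:
  assumes T: "adjoint_pair H H T T'" and x: "x \<in> H" and y: "y \<in> H"
  shows "cinner ((T ^^ n) x) y = cinner x ((T' ^^ n) y)"
  using x y
proof (induction n arbitrary: x y)
  case (Suc n)
  have "cinner ((T ^^ Suc n) x) y = cinner ((T ^^ n) x) (T' y)"
    using adjoint_pairD(3)[OF T bounded_op_in[OF bounded_op_funpow[OF adjoint_pairD(1)[OF T]]]] Suc.prems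
    by simp
  also have "\<dots> = cinner x ((T' ^^ n) (T' y))"
    by (intro Suc.IH Suc.prems bounded_op_in[OF adjoint_pairD(2)[OF T]])
  finally show ?case by (simp add: funpow_swap1)
qed simp

lemma adjoint_funpow_bound:
  assumes T: "adjoint_pair H H T T'" and y: "y \<in> H"
    and bd: "\<And>x. x \<in> H \<Longrightarrow> norm ((T ^^ n) x) \<le> M * norm x"
  shows "norm ((T' ^^ n) y) \<le> M * norm y"
proof (cases "(T' ^^ n) y = 0")
  case True
  show ?thesis
    using order_trans[OF norm_ge_zero bd[OF y]] True by simp
next
  case False
  have z: "(T' ^^ n) y \<in> H"
    by (rule bounded_op_in[OF bounded_op_funpow[OF adjoint_pairD(2)[OF T]] y])
  have "(norm ((T' ^^ n) y))\<^sup>2 = cmod (cinner ((T ^^ n) ((T' ^^ n) y)) y)"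
    unfolding adjoint_funpow[OF T z y] by (simp add: cinner_self norm_power)
  also have "\<dots> \<le> norm ((T ^^ n) ((T' ^^ n) y)) * norm y"
    by (rule norm_cinner_le)
  also have "\<dots> \<le> (M * norm ((T' ^^ n) y)) * norm y"
    by (intro mult_right_mono bd z norm_ge_zero)
  finally show ?thesis
    using False by (simp add: power2_eq_square)
qed

definition quasiaffinity ::
    "'a::complex_hilbert set \<Rightarrow> 'b::complex_hilbert set \<Rightarrow> ('a \<Rightarrow> 'b) \<Rightarrow> bool" where
  "quasiaffinity H K X \<longleftrightarrow> bounded_op H K X \<and> {x \<in> H. X x = 0} = {0} \<and> closure (X ` H) = K"

lemma quasiaffine_transform_iff:
  "quasiaffine_transform H T K R \<longleftrightarrow> (\<exists>X. quasiaffinity H K X \<and> (\<forall>x\<in>H. X (T x) = R (X x)))"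
  by (auto simp: quasiaffine_transform_def quasiaffinity_def)

lemma quasiaffinityD:
  assumes "quasiaffinity H K X"
  shows "bounded_op H K X" "closure (X ` H) = K" "x \<in> H \<Longrightarrow> X x = 0 \<Longrightarrow> x = 0"
  using assms unfolding quasiaffinity_def by blast+

lemma quasiaffinityI:
  assumes "bounded_op H K X" "csubspace H" "\<And>x. x \<in> H \<Longrightarrow> X x = 0 \<Longrightarrow> x = 0" "closure (X ` H) = K"
  shows "quasiaffinity H K X"
  using assms bounded_op_zero[OF assms(1,2)] csubspace_zero[OF assms(2)]
  unfolding quasiaffinity_def by auto

lemma quasiaffinity_image_dense:
  assumes X: "quasiaffinity H K X" and H: "csubspace H" and S: "closure S = H"
  shows "closure (X ` S) = K"
proof
  have "S \<subseteq> H" using S closure_subset by blast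
  thus "closure (X ` S) \<subseteq> K"
    using closure_mono[of "X ` S" "X ` H"] quasiaffinityD(2)[OF X] by (simp add: image_mono)
  have "X ` closure S \<subseteq> closure (X ` S)"
    by (rule bounded_op_image_closure[OF quasiaffinityD(1)[OF X] H])
      (simp_all add: S closure_subset)
  hence "closure (X ` H) \<subseteq> closure (X ` S)"
    by (simp add: S closure_minimal)
  thus "K \<subseteq> closure (X ` S)"
    by (simp add: quasiaffinityD(2)[OF X])
qed

lemma quasiaffinity_compose:
  assumes X: "quasiaffinity H K X" and Y: "quasiaffinity K L Y" and H: "csubspace H" and K: "csubspace K"
  shows "quasiaffinity H L (\<lambda>x. Y (X x))"
proof (rule quasiaffinityI[OF bounded_op_compose[OF quasiaffinityD(1)[OF X] quasiaffinityD(1)[OF Y]] H])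
  show "closure ((\<lambda>x. Y (X x)) ` H) = L"
    using quasiaffinity_image_dense[OF Y K quasiaffinityD(2)[OF X]] by (simp add: image_image)
qed (use quasiaffinityD(3)[OF X] quasiaffinityD(3)[OF Y] bounded_op_in[OF quasiaffinityD(1)[OF X]]
      in blast)

lemma quasiaffine_transform_trans:
  assumes "quasiaffine_transform H T K R" "quasiaffine_transform K R L Q"
    and "csubspace H" "csubspace K"
  shows "quasiaffine_transform H T L Q"
proof -
  obtain X where X: "quasiaffinity H K X" "\<And>x. x \<in> H \<Longrightarrow> X (T x) = R (X x)"
    using assms(1) unfolding quasiaffine_transform_iff by blast
  obtain Y where Y: "quasiaffinity K L Y" "\<And>x. x \<in> K \<Longrightarrow> Y (R x) = Q (Y x)"
    using assms(2) unfolding quasiaffine_transform_iff by blast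
  show ?thesis
    unfolding quasiaffine_transform_iff
    using quasiaffinity_compose[OF X(1) Y(1) assms(3,4)] X(2) Y(2)
      bounded_op_in[OF quasiaffinityD(1)[OF X(1)]]
    by (intro exI[of _ "\<lambda>x. Y (X x)"]) simp
qed

lemma quasisimilar_trans:
  assumes "quasisimilar H T K R" "quasisimilar K R L Q" "csubspace H" "csubspace K" "csubspace L"
  shows "quasisimilar H T L Q"
  using assms(1,2) quasiaffine_transform_trans[of H T K R L Q, OF _ _ assms(3,4)]
    quasiaffine_transform_trans[of L Q K R H T, OF _ _ assms(5,4)]
  unfolding quasisimilar_def by simp

lemma quasisimilar_sym: "quasisimilar H T K R \<Longrightarrow> quasisimilar K R H T"
  by (simp add: quasisimilar_def)

lemma boundedly_invertibleI:
  assumes X: "bounded_op H K X" and H: "csubspace H" and onto: "X ` H = K"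
    and lower: "\<And>x. x \<in> H \<Longrightarrow> norm x \<le> c * norm (X x)"
  shows "boundedly_invertible H K X"
proof -
  have inj: "inj_on X H"
  proof (rule inj_onI)
    fix x y assume xy: "x \<in> H" "y \<in> H" "X x = X y"
    have "norm (x - y) \<le> 0"
      using lower[OF csubspace_diff[OF H xy(1,2)]] bounded_op_diff[OF X H xy(1,2)] xy(3) by simp
    thus "x = y" by simp
  qed
  have "bounded_op K H (inv_into H X)"
  proof (rule bounded_opI[where B = c])
    fix y assume "y \<in> K"
    then obtain x where x: "x \<in> H" "y = X x" using onto by blast
    show "inv_into H X y \<in> H" "norm (inv_into H X y) \<le> c * norm y"
      using x lower[OF x(1)] by (simp_all add: inv_into_f_f[OF inj])
    show "inv_into H X (a *\<^sub>C y) = a *\<^sub>C inv_into H X y" for a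
      using x csubspace_scaleC[OF H x(1)]
      by (simp add: inv_into_f_f[OF inj] bounded_op_scaleC[OF X, symmetric])
    fix y' assume "y' \<in> K"
    then obtain x' where x': "x' \<in> H" "y' = X x'" using onto by blast
    show "inv_into H X (y + y') = inv_into H X y + inv_into H X y'"
      using x x' csubspace_add[OF H x(1) x'(1)]
      by (simp add: inv_into_f_f[OF inj] bounded_op_add[OF X, symmetric])
  qed
  thus ?thesis
    using X inj onto by (simp add: boundedly_invertible_def bij_betw_def)
qed

lemma boundedly_invertibleD:
  assumes "boundedly_invertible H K X"
  shows "bounded_op H K X" "X ` H = K" "inj_on X H" "bounded_op K H (inv_into H X)"
    and "x \<in> H \<Longrightarrow> inv_into H X (X x) = x" "y \<in> K \<Longrightarrow> X (inv_into H X y) = y"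
  using assms unfolding boundedly_invertible_def bij_betw_def
  by (auto simp: f_inv_into_f)

lemma similar_imp_quasisimilar:
  assumes X: "boundedly_invertible H K X" and H: "closed_csubspace H" and K: "closed_csubspace K"
    and T: "\<And>x. x \<in> H \<Longrightarrow> T x \<in> H" and eq: "\<And>x. x \<in> H \<Longrightarrow> X (T x) = R (X x)"
  shows "quasisimilar H T K R"
proof -
  note D = boundedly_invertibleD[OF X]
  note H' = closed_csubspaceD(1)[OF H] and K' = closed_csubspaceD(1)[OF K]
  have "quasiaffinity H K X"
  proof (rule quasiaffinityI[OF D(1) H'])
    show "x = 0" if "x \<in> H" "X x = 0" for x
      using inj_onD[OF D(3) _ that(1) csubspace_zero[OF H']] that(2) bounded_op_zero[OF D(1) H']
      by simp
    show "closure (X ` H) = K"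
      using D(2) closed_csubspaceD(2)[OF K] by simp
  qed
  moreover have "quasiaffinity K H (inv_into H X)"
  proof (rule quasiaffinityI[OF D(4) K'])
    show "x = 0" if "x \<in> K" "inv_into H X x = 0" for x
      using D(6)[OF that(1)] that(2) bounded_op_zero[OF D(1) H'] by simp
    have "inv_into H X ` K = H"
      using D by (metis bij_betw_def bij_betw_inv_into)
    thus "closure (inv_into H X ` K) = H"
      using closed_csubspaceD(2)[OF H] by simp
  qed
  moreover have "inv_into H X (R y) = T (inv_into H X y)" if y: "y \<in> K" for y
  proof -
    obtain x where x: "x \<in> H" "y = X x" using D(2) y by blast
    thus ?thesis using eq[OF x(1), symmetric] D(5) T by simp
  qed
  ultimately show ?thesis
    unfolding quasisimilar_def quasiaffine_transform_iff using eq by blast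
qed

text \<open>Kernel and range of the adjoint are dual to each other: the kernel of the adjoint is the
  orthogonal complement of the range.\<close>

lemma quasiaffinity_adjoint:
  assumes X: "quasiaffinity H K X" and X': "adjoint_pair H K X X'"
    and H: "closed_csubspace H" and K: "closed_csubspace K"
  shows "quasiaffinity K H X'"
proof (rule quasiaffinityI[OF adjoint_pairD(2)[OF X'] closed_csubspaceD(1)[OF K]])
  fix y assume y: "y \<in> K" "X' y = 0"
  show "y = 0"
  proof (rule orthogonal_dense_trivial)
    show "y \<in> closure (X ` H)" using y quasiaffinityD(2)[OF X] by simp
  qed (use y adjoint_pairD(3)[OF X' _ y(1)] in \<open>auto simp: cinner.zero_right\<close>)
next
  show "closure (X' ` K) = H"
  proof (rule dense_if_orthogonal_trivial[OF _ _ H])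
    show "csubspace (X' ` K)"
      by (rule bounded_op_csubspace_image[OF adjoint_pairD(2)[OF X'] closed_csubspaceD(1)[OF K] subset_refl])
    show "X' ` K \<subseteq> H"
      using bounded_op_in[OF adjoint_pairD(2)[OF X']] by blast
    fix h assume h: "h \<in> H" "\<And>s. s \<in> X' ` K \<Longrightarrow> cinner s h = 0"
    have Xh: "X h \<in> K"
      by (rule bounded_op_in[OF adjoint_pairD(1)[OF X'] h(1)])
    have "cinner (X h) (X h) = cinner h (X' (X h))"
      by (rule adjoint_pairD(3)[OF X' h(1) Xh])
    also have "\<dots> = 0"
      using h(2)[of "X' (X h)"] Xh cinner_commute[of h "X' (X h)"] by simp
    finally show "h = 0"
      using quasiaffinityD(3)[OF X h(1)] by (simp add: cinner_self_eq_0)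
  qed
qed

lemma quasiaffine_transform_adjoint:
  assumes tr: "quasiaffine_transform H T K R"
    and T: "adjoint_pair H H T T'" and R: "adjoint_pair K K R R'"
    and H: "closed_csubspace H" and K: "closed_csubspace K"
  shows "quasiaffine_transform K R' H T'"
proof -
  obtain X where X: "quasiaffinity H K X" "\<And>x. x \<in> H \<Longrightarrow> X (T x) = R (X x)"
    using tr unfolding quasiaffine_transform_iff by blast
  obtain X' where X': "adjoint_pair H K X X'"
    using adjoint_exists[OF quasiaffinityD(1)[OF X(1)] H K] by metis
  have "X' (R' y) = T' (X' y)" if "y \<in> K" for y
    by (rule adjoint_intertwine[OF X' T R closed_csubspaceD(1)[OF H] _ that])
      (rule X(2))
  thus ?thesis
    unfolding quasiaffine_transform_iff using quasiaffinity_adjoint[OF X(1) X' H K] by blast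
qed

lemma quasisimilar_adjoint:
  assumes "quasisimilar H T K R" "adjoint_pair H H T T'" "adjoint_pair K K R R'"
    "closed_csubspace H" "closed_csubspace K"
  shows "quasisimilar H T' K R'"
  using assms(1) quasiaffine_transform_adjoint[OF _ assms(2-5)]
    quasiaffine_transform_adjoint[OF _ assms(3,2,5,4)]
  unfolding quasisimilar_def by simp

section \<open>Power bounds as norm inequalities\<close>

lemma onorm_on_le_iff:
  assumes A: "bounded_op H K A" and H: "csubspace H" and M: "M \<ge> 0"
  shows "onorm_on H A \<le> M \<longleftrightarrow> (\<forall>x\<in>H. norm (A x) \<le> M * norm x)"
proof -
  obtain B where B: "B > 0" "\<And>x. x \<in> H \<Longrightarrow> norm (A x) \<le> B * norm x"
    using bounded_op_bound[OF A] by metis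
  have ratio: "norm (A x) / norm x \<le> c \<longleftrightarrow> norm (A x) \<le> c * norm x"
    if "x \<in> H" "c \<ge> 0" for x c
    using that bounded_op_zero[OF A H] by (cases "x = 0") (auto simp: pos_divide_le_eq)
  have "bdd_above ((\<lambda>x. norm (A x) / norm x) ` H)"
    using ratio B by (intro bdd_aboveI2[where M = B]) simp
  moreover have "H \<noteq> {}"
    using csubspace_zero[OF H] by blast
  ultimately have "onorm_on H A \<le> M \<longleftrightarrow> (\<forall>x\<in>H. norm (A x) / norm x \<le> M)"
    unfolding onorm_on_def by (intro cSUP_le_iff)
  thus ?thesis using ratio M by blast
qed

lemma pos_powers_bounded_iff:
  assumes "bounded_op H H T" "csubspace H" "M \<ge> 0"
  shows "pos_powers_bounded H T M \<longleftrightarrow> (\<forall>n. \<forall>x\<in>H. norm ((T ^^ n) x) \<le> M * norm x)"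
  unfolding pos_powers_bounded_def
  using onorm_on_le_iff[OF bounded_op_funpow[OF assms(1)] assms(2,3)] by simp

lemma funpow_inv_into:
  assumes D: "boundedly_invertible H H T" and x: "x \<in> H"
  shows "(inv_into H T ^^ n) ((T ^^ n) x) = x" "(T ^^ n) ((inv_into H T ^^ n) x) = x"
proof -
  note D = boundedly_invertibleD[OF D]
  have inv: "(g ^^ n) ((f ^^ n) x) = x"
    if "\<And>y. y \<in> H \<Longrightarrow> g (f y) = y" "bounded_op H H f" for f g :: "'a \<Rightarrow> 'a"
  proof (induction n)
    case (Suc n)
    have "(f ^^ n) x \<in> H"
      by (rule bounded_op_in[OF bounded_op_funpow[OF that(2)] x])
    with Suc show ?case
      by (simp add: funpow_Suc_right[of n g] that(1) del: funpow.simps(2))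
        (simp add: that(1))
  qed simp
  show "(inv_into H T ^^ n) ((T ^^ n) x) = x" "(T ^^ n) ((inv_into H T ^^ n) x) = x"
    using inv D by blast+
qed

lemma neg_powers_bounded_lower:
  assumes T: "neg_powers_bounded H T C" and H: "csubspace H" and C: "C \<ge> 0" and x: "x \<in> H"
  shows "norm x \<le> C * norm ((T ^^ n) x)"
proof -
  have D: "boundedly_invertible H H T" and on: "onorm_on H (inv_into H T ^^ n) \<le> C"
    using T by (auto simp: neg_powers_bounded_def)
  note D' = boundedly_invertibleD[OF D]
  have "norm ((inv_into H T ^^ n) ((T ^^ n) x)) \<le> C * norm ((T ^^ n) x)"
    using onorm_on_le_iff[OF bounded_op_funpow[OF D'(4)] H C] on
      bounded_op_in[OF bounded_op_funpow[OF D'(1)] x] by blast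
  thus ?thesis by (simp add: funpow_inv_into[OF D x])
qed

lemma neg_powers_boundedI:
  assumes T: "bounded_op H H T" and H: "csubspace H" and onto: "T ` H = H" and C: "C \<ge> 0"
    and lower: "\<And>x n. x \<in> H \<Longrightarrow> norm x \<le> C * norm ((T ^^ n) x)"
  shows "neg_powers_bounded H T C"
proof -
  have D: "boundedly_invertible H H T"
    by (rule boundedly_invertibleI[OF T H onto, of C]) (use lower[of _ 1] in simp)
  note D' = boundedly_invertibleD[OF D]
  have "norm ((inv_into H T ^^ n) x) \<le> C * norm x" if x: "x \<in> H" for x n
    using lower[OF bounded_op_in[OF bounded_op_funpow[OF D'(4)] x], of n n]
    by (simp add: funpow_inv_into[OF D x])
  thus ?thesis
    using D onorm_on_le_iff[OF bounded_op_funpow[OF D'(4)] H C] by (simp add: neg_powers_bounded_def)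
qed

lemma closed_range:
  fixes A :: "'a::complex_hilbert \<Rightarrow> 'b::complex_hilbert"
  assumes A: "bounded_op H K A" and H: "closed_csubspace H"
    and lower: "\<And>x. x \<in> H \<Longrightarrow> norm x \<le> c * norm (A x)" and S: "closure (A ` H) = K"
  shows "A ` H = K"
proof
  note H' = closed_csubspaceD(1)[OF H]
  show "A ` H \<subseteq> K" using bounded_op_in[OF A] by blast
  show "K \<subseteq> A ` H"
  proof
    fix y assume "y \<in> K"
    then obtain f where "\<And>n. f n \<in> A ` H" and fy: "f \<longlonglongrightarrow> y"
      unfolding S[symmetric] closure_sequential by blast
    then obtain x where x: "\<And>n. x n \<in> H" "\<And>n. f n = A (x n)"
      unfolding image_iff by metis
    have low: "norm (x m - x n) \<le> max c 1 * norm (f m - f n)" for m n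
    proof -
      have "norm (x m - x n) \<le> c * norm (f m - f n)"
        using lower[OF csubspace_diff[OF H' x(1)[of m] x(1)[of n]]]
          bounded_op_diff[OF A H' x(1)[of m] x(1)[of n]] x(2) by simp
      also have "\<dots> \<le> max c 1 * norm (f m - f n)"
        by (intro mult_right_mono) auto
      finally show ?thesis .
    qed
    have "Cauchy x"
    proof (rule metric_CauchyI)
      fix e :: real assume e: "e > 0"
      hence "e / max c 1 > 0" by simp
      then obtain N where N: "\<And>m n. m \<ge> N \<Longrightarrow> n \<ge> N \<Longrightarrow> dist (f m) (f n) < e / max c 1"
        using LIMSEQ_imp_Cauchy[OF fy] unfolding Cauchy_def by metis
      have "dist (x m) (x n) < e" if "m \<ge> N" "n \<ge> N" for m n
      proof -
        have "max c 1 * norm (f m - f n) < max c 1 * (e / max c 1)"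
          using N[OF that] by (intro mult_strict_left_mono) (auto simp: dist_norm)
        also have "\<dots> = e" by simp
        finally show ?thesis using low[of m n] by (simp add: dist_norm)
      qed
      thus "\<exists>N. \<forall>m\<ge>N. \<forall>n\<ge>N. dist (x m) (x n) < e" by blast
    qed
    then obtain z where xz: "x \<longlonglongrightarrow> z"
      by (auto simp: Cauchy_convergent_iff convergent_def)
    have z: "z \<in> H" by (rule closed_csubspace_limit[OF H x(1) xz])
    have "(\<lambda>n. A (x n)) \<longlonglongrightarrow> A z"
      by (rule bounded_op_tendsto[OF A H' x(1) z xz])
    hence "y = A z"
      using fy x(2) LIMSEQ_unique by (metis ext)
    thus "y \<in> A ` H" using z by blast
  qed
qed

section \<open>Square roots of positive operators\<close>

text \<open>From index 1 on, the coefficients of \<open>sqrt (1 - t)\<close> are nonpositive, and the partial sums of all of them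
  are the coefficients of \<open>(1 - t) powr (- 1/2)\<close>, hence nonnegative. So the absolute values have partial sums
  at most 2.\<close>

lemma summable_gbinomial_half: "summable (\<lambda>n. \<bar>(1/2 :: real) gchoose n\<bar>)"
proof -
  define r where "r n = (-1) ^ n * ((1/2 :: real) gchoose n)" for n
  define w where "w n = (-1) ^ n * ((-1/2 :: real) gchoose n)" for n
  have step: "(-1) ^ Suc n * (a gchoose Suc n) = (-1) ^ n * (a gchoose n) * ((real n - a) / real (Suc n))"
    for a :: real and n
  proof -
    have "real (Suc n) * (a gchoose Suc n) = (a - real n) * (a gchoose n)"
      using gbinomial_mult_1[of a n] by (simp add: algebra_simps)
    hence "(a gchoose Suc n) = (a - real n) * (a gchoose n) / real (Suc n)"
      by (simp add: field_simps del: of_nat_Suc)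
    thus ?thesis
      by (simp add: minus_divide_left algebra_simps del: of_nat_Suc)
  qed
  have r_neg: "r (Suc n) \<le> 0" for n
  proof (induction n)
    case (Suc n)
    have eq: "r (Suc (Suc n)) = r (Suc n) * ((real (Suc n) - 1/2) / real (Suc (Suc n)))"
      unfolding r_def by (rule step)
    show ?case
      unfolding eq by (rule mult_nonpos_nonneg[OF Suc.IH]) simp
  qed (simp add: r_def)
  have w_nonneg: "0 \<le> w n" for n
  proof (induction n)
    case (Suc n)
    have "w (Suc n) = w n * ((real n - (-1/2)) / real (Suc n))"
      unfolding w_def by (rule step)
    thus ?case
      using Suc by simp
  qed (simp add: w_def)
  have partial: "(\<Sum>k\<le>m. r k) = w m" for m
    using gbinomial_sum_lower_neg[of "1/2 :: real" m] by (simp add: r_def w_def mult.commute)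
  have "(\<Sum>k\<le>m. \<bar>r k\<bar>) = 2 - w m" for m
  proof -
    have "\<bar>r k\<bar> = (if k = 0 then 2 else 0) - r k" for k
      using r_neg[of "k - 1"] by (cases k) (auto simp: r_def)
    hence "(\<Sum>k\<le>m. \<bar>r k\<bar>) = (\<Sum>k\<le>m. if k = 0 then 2 else 0) - (\<Sum>k\<le>m. r k)"
      by (simp add: sum_subtractf)
    thus ?thesis by (simp add: partial)
  qed
  hence le2: "(\<Sum>k\<le>m. \<bar>r k\<bar>) \<le> 2" for m
    using w_nonneg[of m] by simp
  have "(\<Sum>k<m. \<bar>r k\<bar>) \<le> 2" for m
    using le2[of "m - 1"] by (cases m) (simp_all add: lessThan_Suc_atMost)
  hence "summable (\<lambda>n. \<bar>r n\<bar>)"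
    by (intro summableI_nonneg_bounded[where x = 2]) auto
  thus ?thesis by (simp add: r_def abs_mult)
qed

text \<open>These are the coefficients of the square of \<open>sqrt (1 + t)\<close>.\<close>

lemma gbinomial_half_convolution:
  "(\<Sum>i\<le>k. ((1/2 :: real) gchoose i) * ((1/2) gchoose (k - i))) = (if k \<le> 1 then 1 else 0)"
proof -
  have "(\<Sum>i\<le>k. ((1/2 :: real) gchoose i) * ((1/2) gchoose (k - i))) = (1 gchoose k)"
    using gbinomial_Vandermonde[of "1/2 :: real" "1/2" k] by (simp add: atLeast0AtMost)
  also have "\<dots> = real (1 choose k)"
    using binomial_gbinomial[of 1 k, where 'a = real] by simp
  also have "\<dots> = (if k \<le> 1 then 1 else 0)"
    by (cases k) (auto simp: le_Suc_eq)
  finally show ?thesis .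
qed

text \<open>A Cauchy product in which the terms of index \<open>(m, n)\<close> carry a weight depending on \<open>m + n\<close>: the
  squares and the triangles of indices give the same limit, since they do so for the absolute values.\<close>

lemma weighted_Cauchy_product:
  fixes c :: "nat \<Rightarrow> real" and f :: "nat \<Rightarrow> complex"
  assumes c: "summable (\<lambda>n. \<bar>c n\<bar>)" and f: "\<And>k. cmod (f k) \<le> F"
    and L: "(\<lambda>k. of_real (\<Sum>i\<le>k. c i * c (k - i)) * f k) sums L"
  shows "(\<lambda>N. \<Sum>m<N. \<Sum>n<N. of_real (c m * c n) * f (m + n)) \<longlonglongrightarrow> L"
proof -
  let ?Q = "\<lambda>N::nat. {..<N} \<times> {..<N}" and ?D = "\<lambda>N::nat. {(m, n). m + n < N}"
  let ?g = "\<lambda>(m, n). of_real (c m * c n) * f (m + n)"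
  let ?h = "\<lambda>(m, n). \<bar>c m\<bar> * \<bar>c n\<bar>"
  have sub: "?D N \<subseteq> ?Q N" for N
    by auto
  have fin: "finite (?Q N)" for N
    by simp
  have h_square: "(\<lambda>N. sum ?h (?Q N)) \<longlonglongrightarrow> (\<Sum>n. \<bar>c n\<bar>) * (\<Sum>n. \<bar>c n\<bar>)"
    using tendsto_mult[OF summable_LIMSEQ[OF c] summable_LIMSEQ[OF c]]
    by (simp add: sum_product sum.cartesian_product)
  have h_triangle: "(\<lambda>N. sum ?h (?D N)) \<longlonglongrightarrow> (\<Sum>n. \<bar>c n\<bar>) * (\<Sum>n. \<bar>c n\<bar>)"
    using Cauchy_product_sums[of "\<lambda>n. \<bar>c n\<bar>" "\<lambda>n. \<bar>c n\<bar>"] c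
    by (simp add: sums_def sum.triangle_reindex)
  have g_triangle: "(\<lambda>N. sum ?g (?D N)) \<longlonglongrightarrow> L"
    using L by (simp add: sums_def sum.triangle_reindex sum_distrib_right)
  have F: "F \<ge> 0"
    using order_trans[OF norm_ge_zero f] .
  have "(\<lambda>N. sum ?g (?Q N) - sum ?g (?D N)) \<longlonglongrightarrow> 0"
  proof (rule Lim_null_comparison)
    show "\<forall>\<^sub>F N in sequentially. norm (sum ?g (?Q N) - sum ?g (?D N)) \<le> F * (sum ?h (?Q N) - sum ?h (?D N))"
    proof (intro always_eventually allI)
      fix N
      have "norm (sum ?g (?Q N) - sum ?g (?D N)) = norm (sum ?g (?Q N - ?D N))"
        by (simp only: sum_diff[OF fin sub])
      also have "\<dots> \<le> (\<Sum>p\<in>?Q N - ?D N. F * ?h p)"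
      proof (rule sum_norm_le)
        fix p show "norm (?g p) \<le> F * ?h p"
          using mult_left_mono[OF f[of "fst p + snd p"], of "\<bar>c (fst p)\<bar> * \<bar>c (snd p)\<bar>"]
          by (simp add: case_prod_unfold norm_mult abs_mult mult.commute[of F])
      qed
      also have "\<dots> = F * (sum ?h (?Q N) - sum ?h (?D N))"
        by (simp only: sum_diff[OF fin sub] sum_distrib_left[symmetric])
      finally show "norm (sum ?g (?Q N) - sum ?g (?D N)) \<le> F * (sum ?h (?Q N) - sum ?h (?D N))" .
    qed
    show "(\<lambda>N. F * (sum ?h (?Q N) - sum ?h (?D N))) \<longlonglongrightarrow> 0"
      using tendsto_mult_left[OF tendsto_diff[OF h_square h_triangle], of F] by simp
  qed
  from tendsto_add[OF this g_triangle] have "(\<lambda>N. sum ?g (?Q N)) \<longlonglongrightarrow> L"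
    by simp
  thus ?thesis by (simp add: sum.cartesian_product)
qed

text \<open>With \<open>A = 1 - G\<close> a contraction, the binomial series of \<open>sqrt (1 - A)\<close> converges absolutely, because
  its coefficients are summable. Being a limit of polynomials in \<open>G\<close>, the sum commutes with everything
  that commutes with \<open>G\<close>.\<close>

lemma positive_sqrt:
  fixes K :: "'a::complex_hilbert set"
  assumes K: "closed_csubspace K" and G: "adjoint_pair K K G G"
    and contr: "\<And>x. x \<in> K \<Longrightarrow> norm (x - G x) \<le> norm x"
  obtains S where "adjoint_pair K K S S"
    "\<And>x y. x \<in> K \<Longrightarrow> y \<in> K \<Longrightarrow> cinner (S x) (S y) = cinner (G x) y"
    "\<And>V x. bounded_op K K V \<Longrightarrow> (\<And>x. x \<in> K \<Longrightarrow> V (G x) = G (V x)) \<Longrightarrow> x \<in> K \<Longrightarrow> V (S x) = S (V x)"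
proof -
  note K' = closed_csubspaceD(1)[OF K]
  note G' = adjoint_pairD(1)[OF G]
  define A where "A x = x - G x" for x
  define c where "c n = (-1) ^ n * ((1/2 :: real) gchoose n)" for n
  define P where "P N x = (\<Sum>n<N. c n *\<^sub>R (A ^^ n) x)" for N x
  define S where "S x = (\<Sum>n. c n *\<^sub>R (A ^^ n) x)" for x
  have c: "summable (\<lambda>n. \<bar>c n\<bar>)"
    using summable_gbinomial_half by (simp add: c_def abs_mult)
  have A: "bounded_op K K A"
    by (rule bounded_opI[where B = 1])
      (simp_all add: A_def contr csubspace_diff[OF K'] bounded_op_in[OF G'] bounded_op_add[OF G']
        bounded_op_scaleC[OF G'] linear_diff[OF bounded_linear.linear[OF bounded_linear_scaleC]])
  have An: "bounded_op K K (A ^^ n)" for n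
    by (rule bounded_op_funpow[OF A])
  have A_adj: "adjoint_pair K K A A"
    using A by (simp add: adjoint_pair_def A_def cinner.diff_left cinner.diff_right adjoint_pairD(3)[OF G])
  have An_contr: "norm ((A ^^ n) x) \<le> norm x" if x: "x \<in> K" for n x
  proof (induction n)
    case (Suc n)
    have "norm (A ((A ^^ n) x)) \<le> norm ((A ^^ n) x)"
      using contr[OF bounded_op_in[OF An x]] by (simp add: A_def)
    with Suc show ?case by simp
  qed simp
  have term_le: "norm (c n *\<^sub>R (A ^^ n) x) \<le> \<bar>c n\<bar> * norm x" if "x \<in> K" for n x
    using An_contr[OF that] by (simp add: mult_left_mono)
  have summ: "summable (\<lambda>n. c n *\<^sub>R (A ^^ n) x)" if "x \<in> K" for x
    by (rule summable_comparison_test'[OF summable_mult2[OF c, of "norm x"], of 0]) (rule term_le[OF that])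
  hence P_S: "(\<lambda>N. P N x) \<longlonglongrightarrow> S x" if "x \<in> K" for x
    using summable_LIMSEQ that unfolding P_def S_def by blast
  have P_in: "P N x \<in> K" if "x \<in> K" for N x
    unfolding P_def by (intro csubspace_sum csubspace_scaleR K' bounded_op_in[OF An] that)
  have S_in: "S x \<in> K" if "x \<in> K" for x
    by (rule closed_csubspace_limit[OF K P_in P_S]) (rule that)+
  have S: "bounded_op K K S"
  proof (rule bounded_opI[where B = "\<Sum>n. \<bar>c n\<bar>"])
    fix x assume x: "x \<in> K"
    have "norm (S x) \<le> (\<Sum>n. \<bar>c n\<bar> * norm x)"
      unfolding S_def using term_le[OF x] by (intro norm_suminf_le summable_mult2 c)
    thus "norm (S x) \<le> (\<Sum>n. \<bar>c n\<bar>) * norm x"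
      using suminf_mult2[OF c, of "norm x"] by simp
    fix a show "S (a *\<^sub>C x) = a *\<^sub>C S x"
      unfolding S_def bounded_linear.suminf[OF bounded_linear_scaleC summ[OF x]]
      by (simp add: bounded_op_scaleC[OF An x] scaleR_eq_scaleC scaleC_scaleC mult.commute)
  next
    fix x y assume "x \<in> K" "y \<in> K"
    thus "S (x + y) = S x + S y"
      unfolding S_def using suminf_add[OF summ[of x] summ[of y]]
      by (simp add: bounded_op_add[OF An] scaleR_add_right)
  qed (rule S_in)
  have P_adj: "cinner (P N x) y = cinner x (P N y)" if "x \<in> K" "y \<in> K" for N x y
    by (simp add: P_def cinner.sum_left cinner.sum_right cinner.scaleR_left cinner.scaleR_right
        adjoint_funpow[OF A_adj that])
  have "cinner (S x) y = cinner x (S y)" if "x \<in> K" "y \<in> K" for x y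
  proof (rule LIMSEQ_unique)
    show "(\<lambda>N. cinner (P N x) y) \<longlonglongrightarrow> cinner (S x) y"
      by (intro cinner.tendsto P_S that tendsto_const)
    show "(\<lambda>N. cinner (P N x) y) \<longlonglongrightarrow> cinner x (S y)"
      unfolding P_adj[OF that] by (intro cinner.tendsto P_S that tendsto_const)
  qed
  hence S_adj: "adjoint_pair K K S S"
    using S by (simp add: adjoint_pair_def)
  have "cinner (S x) (S y) = cinner (G x) y" if x: "x \<in> K" and y: "y \<in> K" for x y
  proof (rule LIMSEQ_unique)
    define f where "f k = cinner ((A ^^ k) x) y" for k
    show "(\<lambda>N. cinner (P N x) (P N y)) \<longlonglongrightarrow> cinner (S x) (S y)"
      by (intro cinner.tendsto P_S x y)
    have "cinner ((A ^^ m) x) ((A ^^ n) y) = f (m + n)" for m n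
      unfolding f_def using adjoint_funpow[OF A_adj bounded_op_in[OF An x] y, of n m]
      by (simp add: funpow_add add.commute[of m])
    hence "cinner (P N x) (P N y) = (\<Sum>m<N. \<Sum>n<N. of_real (c m * c n) * f (m + n))" for N
      by (simp add: P_def cinner.sum_left cinner.sum_right cinner.scaleR_left cinner.scaleR_right
          scaleR_conv_of_real sum_distrib_left mult.assoc add.commute)
    moreover have "(\<lambda>N. \<Sum>m<N. \<Sum>n<N. of_real (c m * c n) * f (m + n)) \<longlonglongrightarrow> cinner (G x) y"
    proof (rule weighted_Cauchy_product[OF c])
      show "cmod (f k) \<le> norm x * norm y" for k
        using norm_cinner_le[of "(A ^^ k) x" y] mult_right_mono[OF An_contr[OF x, of k], of "norm y"]
        by (simp add: f_def)
      have "c i * c (k - i) = (-1) ^ k * (((1/2) gchoose i) * ((1/2) gchoose (k - i)))"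
        if "i \<le> k" for i k
      proof -
        have sign: "(-1) ^ k = (-1) ^ i * (-1 :: real) ^ (k - i)"
          using that by (simp add: power_add[symmetric])
        show ?thesis
          unfolding c_def sign by (simp only: mult_ac)
      qed
      hence "(\<Sum>i\<le>k. c i * c (k - i)) = (-1) ^ k * (\<Sum>i\<le>k. ((1/2) gchoose i) * ((1/2) gchoose (k - i)))" for k
        unfolding sum_distrib_left by (intro sum.cong) simp_all
      hence conv: "(\<Sum>i\<le>k. c i * c (k - i)) = (if k = 0 then 1 else if k = 1 then -1 else 0)" for k
        unfolding gbinomial_half_convolution by (auto simp: le_Suc_eq)
      have "(\<lambda>k. of_real (\<Sum>i\<le>k. c i * c (k - i)) * f k) sums
          (\<Sum>k\<in>{0, 1}. of_real (\<Sum>i\<le>k. c i * c (k - i)) * f k)"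
        by (rule sums_finite) (simp_all add: conv)
      thus "(\<lambda>k. of_real (\<Sum>i\<le>k. c i * c (k - i)) * f k) sums cinner (G x) y"
        unfolding conv by (simp add: f_def A_def cinner.diff_left)
    qed
    ultimately show "(\<lambda>N. cinner (P N x) (P N y)) \<longlonglongrightarrow> cinner (G x) y"
      by simp
  qed
  moreover have "V (S x) = S (V x)"
    if V: "bounded_op K K V" and comm: "\<And>x. x \<in> K \<Longrightarrow> V (G x) = G (V x)" and x: "x \<in> K" for V x
  proof (rule LIMSEQ_unique)
    have "V (A x) = A (V x)" if "x \<in> K" for x
      using that bounded_op_diff[OF V K' that bounded_op_in[OF G' that]] comm[OF that]
      by (simp add: A_def)
    hence "V ((A ^^ n) x) = (A ^^ n) (V x)" for n
      using funpow_intertwine[of K A V A x n] bounded_op_in[OF A] x by blast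
    hence "V (P N x) = P N (V x)" for N
      unfolding P_def
      by (subst bounded_op_sum[OF V K'])
        (auto simp: scaleR_eq_scaleC bounded_op_scaleC[OF V] bounded_op_in[OF An] x csubspace_scaleC[OF K'])
    thus "(\<lambda>N. P N (V x)) \<longlonglongrightarrow> V (S x)"
      using bounded_op_tendsto[OF V K' P_in[OF x] S_in[OF x] P_S[OF x]] by simp
    show "(\<lambda>N. P N (V x)) \<longlonglongrightarrow> S (V x)"
      by (rule P_S[OF bounded_op_in[OF V x]])
  qed
  ultimately show thesis
    using that[OF S_adj] by blast
qed

section \<open>Polar decomposition of an intertwining quasiaffinity\<close>

text \<open>Two maps with dense ranges that induce the same form on their common domain differ by an
  isometry between the targets, obtained as the continuous extension of \<open>Y u \<mapsto> S u\<close>.\<close>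

lemma isometric_extension:
  fixes H :: "'b::complex_hilbert set" and L :: "'c::complex_hilbert set"
  assumes H: "closed_csubspace H" and L: "closed_csubspace L" and K': "csubspace K"
    and Y: "bounded_op K H Y" "closure (Y ` K) = H" and S: "bounded_op K L S" "closure (S ` K) = L"
    and a: "bounded_form H H a" and c: "c > 0" and low: "\<And>x. x \<in> H \<Longrightarrow> c * (norm x)\<^sup>2 \<le> Re (a x x)"
    and eq: "\<And>u v. u \<in> K \<Longrightarrow> v \<in> K \<Longrightarrow> a (Y u) (Y v) = cinner (S u) (S v)"
  obtains Z where "boundedly_invertible H L Z" "\<And>u. u \<in> K \<Longrightarrow> Z (Y u) = S u"
    "\<And>x y. x \<in> H \<Longrightarrow> y \<in> H \<Longrightarrow> cinner (Z x) (Z y) = a x y"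
proof -
  note H' = closed_csubspaceD(1)[OF H] and L' = closed_csubspaceD(1)[OF L]
  obtain B where B: "B > 0" "\<And>x y. x \<in> H \<Longrightarrow> y \<in> H \<Longrightarrow> cmod (a x y) \<le> B * norm x * norm y"
    using bounded_form_bound[OF a] by blast
  have S_bound: "norm (S u) \<le> sqrt B * norm (Y u)" if u: "u \<in> K" for u
  proof (rule power2_le_imp_le)
    have "(norm (S u))\<^sup>2 = cmod (a (Y u) (Y u))"
      by (simp add: eq u cinner_self norm_power)
    also have "\<dots> \<le> B * norm (Y u) * norm (Y u)"
      by (intro B bounded_op_in[OF Y(1)] u)
    finally show "(norm (S u))\<^sup>2 \<le> (sqrt B * norm (Y u))\<^sup>2"
      using B(1) by (simp add: power_mult_distrib power2_eq_square[of "norm (Y u)"] mult.assoc)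
  qed (use B(1) in simp)
  have Cauchy_S: "Cauchy (\<lambda>n. S (p n))" if p: "\<And>n. p n \<in> K" and lim: "(\<lambda>n. Y (p n)) \<longlonglongrightarrow> h" for p h
  proof (rule metric_CauchyI)
    fix e :: real assume e: "e > 0"
    then obtain N where N: "\<And>m n. m \<ge> N \<Longrightarrow> n \<ge> N \<Longrightarrow> dist (Y (p m)) (Y (p n)) < e / sqrt B"
      using LIMSEQ_imp_Cauchy[OF lim] B(1) unfolding Cauchy_def
      by (metis divide_pos_pos real_sqrt_gt_zero)
    have "dist (S (p m)) (S (p n)) < e" if "m \<ge> N" "n \<ge> N" for m n
    proof -
      have "norm (S (p m) - S (p n)) \<le> sqrt B * norm (Y (p m) - Y (p n))"
        using S_bound[OF csubspace_diff[OF K' p p]] bounded_op_diff[OF S(1) K' p p]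
          bounded_op_diff[OF Y(1) K' p p] by simp
      also have "\<dots> < sqrt B * (e / sqrt B)"
        using N[OF that] B(1) by (intro mult_strict_left_mono) (auto simp: dist_norm)
      also have "\<dots> = e" using B(1) by simp
      finally show ?thesis by (simp add: dist_norm)
    qed
    thus "\<exists>N. \<forall>m\<ge>N. \<forall>n\<ge>N. dist (S (p m)) (S (p n)) < e" by blast
  qed
  have "\<exists>p. (\<forall>n. p n \<in> K) \<and> (\<lambda>n. Y (p n)) \<longlonglongrightarrow> h" if h: "h \<in> H" for h
  proof -
    obtain f where f: "\<And>n. f n \<in> Y ` K" "f \<longlonglongrightarrow> h"
      using h unfolding Y(2)[symmetric] closure_sequential by blast
    then obtain p where "\<And>n. p n \<in> K" "\<And>n. f n = Y (p n)"
      unfolding image_iff by metis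
    thus ?thesis using f(2) by (metis (no_types, lifting) ext)
  qed
  then obtain p where p: "\<And>h n. h \<in> H \<Longrightarrow> p h n \<in> K" "\<And>h. h \<in> H \<Longrightarrow> (\<lambda>n. Y (p h n)) \<longlonglongrightarrow> h"
    by metis
  define Z where "Z h = lim (\<lambda>n. S (p h n))" for h
  have pZ: "(\<lambda>n. S (p h n)) \<longlonglongrightarrow> Z h" if "h \<in> H" for h
    using Cauchy_S[of "p h" h] p that unfolding Z_def
    by (simp add: Cauchy_convergent_iff convergent_LIMSEQ_iff)
  have Z_lim: "(\<lambda>n. S (q n)) \<longlonglongrightarrow> Z h"
    if h: "h \<in> H" and q: "\<And>n. q n \<in> K" "(\<lambda>n. Y (q n)) \<longlonglongrightarrow> h" for q h
  proof -
    have "(\<lambda>n. S (q n) - S (p h n)) \<longlonglongrightarrow> 0"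
    proof (rule Lim_null_comparison)
      show "\<forall>\<^sub>F n in sequentially. norm (S (q n) - S (p h n)) \<le> sqrt B * norm (Y (q n) - Y (p h n))"
        using S_bound[OF csubspace_diff[OF K' q(1) p(1)[OF h]]] bounded_op_diff[OF S(1) K' q(1) p(1)[OF h]]
          bounded_op_diff[OF Y(1) K' q(1) p(1)[OF h]] by simp
      have "(\<lambda>n. sqrt B * norm (Y (q n) - Y (p h n))) \<longlonglongrightarrow> sqrt B * norm (h - h)"
        by (intro tendsto_intros q p h)
      thus "(\<lambda>n. sqrt B * norm (Y (q n) - Y (p h n))) \<longlonglongrightarrow> 0" by simp
    qed
    from tendsto_add[OF this pZ[OF h]] show ?thesis by simp
  qed
  have Z_Y: "Z (Y u) = S u" if "u \<in> K" for u
    using Z_lim[of "Y u" "\<lambda>_. u"] bounded_op_in[OF Y(1)] that by (simp add: LIMSEQ_const_iff)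
  have Z_in: "Z h \<in> L" if "h \<in> H" for h
    by (rule closed_csubspace_limit[OF L _ pZ[OF that]]) (rule bounded_op_in[OF S(1) p(1)[OF that]])
  have Z_a: "cinner (Z x) (Z y) = a x y" if "x \<in> H" "y \<in> H" for x y
  proof (rule LIMSEQ_unique)
    show "(\<lambda>n. cinner (S (p x n)) (S (p y n))) \<longlonglongrightarrow> cinner (Z x) (Z y)"
      by (intro cinner.tendsto pZ that)
    show "(\<lambda>n. cinner (S (p x n)) (S (p y n))) \<longlonglongrightarrow> a x y"
      unfolding eq[OF p(1)[OF that(1)] p(1)[OF that(2)], symmetric]
      by (rule bounded_form_tendsto[OF a H' H']) (use that p bounded_op_in[OF Y(1)] in simp_all)
  qed
  have Z_bound: "norm (Z x) \<le> sqrt B * norm x" if x: "x \<in> H" for x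
  proof (rule power2_le_imp_le)
    have "(norm (Z x))\<^sup>2 = cmod (a x x)"
      by (simp add: Z_a[symmetric] x cinner_self norm_power)
    also have "\<dots> \<le> B * norm x * norm x"
      by (intro B x)
    finally show "(norm (Z x))\<^sup>2 \<le> (sqrt B * norm x)\<^sup>2"
      using B(1) by (simp add: power_mult_distrib power2_eq_square[of "norm x"] mult.assoc)
  qed (use B(1) in simp)
  have Z: "bounded_op H L Z"
  proof (rule bounded_opI[OF Z_in _ _ Z_bound])
    fix x y assume xy: "x \<in> H" "y \<in> H"
    show "Z (x + y) = Z x + Z y"
    proof (rule LIMSEQ_unique)
      show "(\<lambda>n. S (p x n + p y n)) \<longlonglongrightarrow> Z (x + y)"
        using tendsto_add[OF p(2)[OF xy(1)] p(2)[OF xy(2)]] p(1) xy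
        by (intro Z_lim csubspace_add H' K') (simp_all add: bounded_op_add[OF Y(1)])
      show "(\<lambda>n. S (p x n + p y n)) \<longlonglongrightarrow> Z x + Z y"
        using tendsto_add[OF pZ[OF xy(1)] pZ[OF xy(2)]] p(1) xy by (simp add: bounded_op_add[OF S(1)])
    qed
  next
    fix r x assume x: "x \<in> H"
    show "Z (r *\<^sub>C x) = r *\<^sub>C Z x"
    proof (rule LIMSEQ_unique)
      show "(\<lambda>n. S (r *\<^sub>C p x n)) \<longlonglongrightarrow> Z (r *\<^sub>C x)"
        using bounded_linear.tendsto[OF bounded_linear_scaleC p(2)[OF x], of r] p(1) x
        by (intro Z_lim csubspace_scaleC H' K') (simp_all add: bounded_op_scaleC[OF Y(1)])
      show "(\<lambda>n. S (r *\<^sub>C p x n)) \<longlonglongrightarrow> r *\<^sub>C Z x"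
        using bounded_linear.tendsto[OF bounded_linear_scaleC pZ[OF x], of r] p(1) x
        by (simp add: bounded_op_scaleC[OF S(1)])
    qed
  qed
  have Z_low: "norm x \<le> (1 / sqrt c) * norm (Z x)" if x: "x \<in> H" for x
  proof -
    have "(sqrt c * norm x)\<^sup>2 \<le> (norm (Z x))\<^sup>2"
      using low[OF x] c by (simp add: Z_a[OF x x, symmetric] cinner_self power_mult_distrib flip: of_real_power)
    hence "sqrt c * norm x \<le> norm (Z x)"
      by (rule power2_le_imp_le) simp
    thus ?thesis using c by (simp add: field_simps)
  qed
  have "closure (Z ` H) = L"
  proof
    show "closure (Z ` H) \<subseteq> L"
      using Z_in closed_csubspaceD(2)[OF L] by (intro closure_minimal) auto
    have "S ` K \<subseteq> Z ` H"
      using Z_Y bounded_op_in[OF Y(1)] by (metis image_eqI image_subsetI)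
    thus "L \<subseteq> closure (Z ` H)"
      using closure_mono S(2) by blast
  qed
  hence "Z ` H = L"
    by (intro closed_range[OF Z H Z_low])
  hence "boundedly_invertible H L Z"
    by (intro boundedly_invertibleI[OF Z H' _ Z_low])
  thus thesis
    using that Z_Y Z_a by blast
qed

lemma unitary_opD:
  assumes "unitary_op K U"
  shows "bounded_op K K U" "U ` K = K"
    and "x \<in> K \<Longrightarrow> y \<in> K \<Longrightarrow> cinner (U x) (U y) = cinner x y"
  using assms unfolding unitary_op_def by blast+

lemma unitary_op_id: "unitary_op K (\<lambda>x. x)"
  by (simp add: unitary_op_def bounded_op_id)

text \<open>Invariant forms are the source of elements of the commutant, the only operators about which
  hyperinvariance says something. Surjectivity of \<open>U\<close> matters: \<open>A U\<close> and \<open>U A\<close> are compared by testing against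
  vectors of the form \<open>U v\<close>.\<close>

lemma invariant_form_operator:
  assumes K: "closed_csubspace K" and U: "unitary_op K U" and g: "bounded_form K K g"
    and inv: "\<And>x y. x \<in> K \<Longrightarrow> y \<in> K \<Longrightarrow> g (U x) (U y) = g x y"
  obtains A where "bounded_op K K A" "\<And>x y. x \<in> K \<Longrightarrow> y \<in> K \<Longrightarrow> cinner (A x) y = g x y"
    "\<And>x. x \<in> K \<Longrightarrow> A (U x) = U (A x)"
proof -
  note K' = closed_csubspaceD(1)[OF K] and Uin = bounded_op_in[OF unitary_opD(1)[OF U]]
  obtain A where A: "bounded_op K K A" "\<And>x y. x \<in> K \<Longrightarrow> y \<in> K \<Longrightarrow> cinner (A x) y = g x y"
    using form_operator[OF g K' K] by blast
  note Ain = bounded_op_in[OF A(1)]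
  have "A (U x) = U (A x)" if x: "x \<in> K" for x
  proof (rule eq_if_cinner_eq[OF K' Ain[OF Uin[OF x]] Uin[OF Ain[OF x]]])
    fix y assume "y \<in> K"
    then obtain v where v: "v \<in> K" "y = U v"
      using unitary_opD(2)[OF U] by blast
    have "cinner (A (U x)) (U v) = cinner (U (A x)) (U v)"
      by (simp add: A(2) inv unitary_opD(3)[OF U] Uin Ain x v)
    thus "cinner y (A (U x)) = cinner y (U (A x))"
      unfolding v(2) by (metis cinner_commute)
  qed
  thus thesis using that A by blast
qed

text \<open>If \<open>a\<close> is regarded as the inner product of \<open>H\<close>, then \<open>T\<close> is an isometry and \<open>Y\<close> intertwines it with
  the unitary \<open>U\<close>. Hence \<open>Y\<^sup>*Y\<close> and its square root commute with \<open>U\<close>, and the isometry \<open>Z\<close> given by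
  \<open>Z (Y u) = sqrt (Y\<^sup>*Y) u\<close>, the inverse of the unitary factor of \<open>Y\<close>, intertwines \<open>T\<close> with \<open>U\<close>.\<close>

lemma polar_similarity:
  fixes H :: "'b::complex_hilbert set" and K :: "'a::complex_hilbert set"
  assumes H: "closed_csubspace H" and K: "closed_csubspace K"
    and Y: "quasiaffinity K H Y" and U: "unitary_op K U" and T: "bounded_op H H T"
    and YU: "\<And>x. x \<in> K \<Longrightarrow> Y (U x) = T (Y x)"
    and a: "bounded_form H H a" and herm: "\<And>x y. x \<in> H \<Longrightarrow> y \<in> H \<Longrightarrow> a x y = cnj (a y x)"
    and inv: "\<And>x y. x \<in> H \<Longrightarrow> y \<in> H \<Longrightarrow> a (T x) (T y) = a x y"
    and c: "c > 0" and low: "\<And>x. x \<in> H \<Longrightarrow> c * (norm x)\<^sup>2 \<le> Re (a x x)"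
  obtains Z where "boundedly_invertible H K Z" "\<And>x. x \<in> H \<Longrightarrow> Z (T x) = U (Z x)"
    "\<And>x y. x \<in> H \<Longrightarrow> y \<in> H \<Longrightarrow> cinner (Z x) (Z y) = a x y"
proof -
  note K' = closed_csubspaceD(1)[OF K] and H' = closed_csubspaceD(1)[OF H]
  note Yb = quasiaffinityD(1)[OF Y] and Yin = bounded_op_in[OF quasiaffinityD(1)[OF Y]]
  note Ub = unitary_opD(1)[OF U] and Uin = bounded_op_in[OF unitary_opD(1)[OF U]]
  define g where "g u v = a (Y u) (Y v)" for u v
  have g: "bounded_form K K g"
    unfolding g_def by (rule bounded_form_compose[OF a Yb Yb])
  obtain b where b: "b > 0" "\<And>x y. x \<in> K \<Longrightarrow> y \<in> K \<Longrightarrow> cmod (g x y) \<le> b * norm x * norm y"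
    using bounded_form_bound[OF g] by blast
  have g_nonneg: "0 \<le> Re (g u u)" if "u \<in> K" for u
    using low[OF Yin[OF that]] c unfolding g_def
    by (meson less_imp_le mult_nonneg_nonneg order_trans zero_le_power2)
  have "g (U u) (U v) = g u v" if "u \<in> K" "v \<in> K" for u v
    using that by (simp add: g_def YU inv Yin)
  then obtain G1 where G1: "bounded_op K K G1"
    "\<And>x y. x \<in> K \<Longrightarrow> y \<in> K \<Longrightarrow> cinner (G1 x) y = g x y" "\<And>x. x \<in> K \<Longrightarrow> G1 (U x) = U (G1 x)"
    using invariant_form_operator[OF K U g] by blast
  \<comment> \<open>\<open>G1\<close> is \<open>Y\<^sup>*Y\<close>; dividing by the bound \<open>b\<close> of the form makes \<open>1 - G\<close> a contraction.\<close>
  define G where "G x = (1 / b) *\<^sub>R G1 x" for x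
  have G: "bounded_op K K G"
    unfolding G_def by (rule bounded_op_scaleR[OF G1(1) K'])
  have Gg: "cinner (G x) y = (1 / b) *\<^sub>R g x y" if "x \<in> K" "y \<in> K" for x y
    using G1(2)[OF that] by (simp add: G_def cinner.scaleR_left)
  have g_herm: "g x y = cnj (g y x)" if "x \<in> K" "y \<in> K" for x y
    unfolding g_def by (intro herm Yin that)
  have G_adj: "adjoint_pair K K G G"
    unfolding adjoint_pair_def
  proof (intro conjI G ballI)
    fix x y assume xy: "x \<in> K" "y \<in> K"
    have "cinner x (G y) = cnj (cinner (G y) x)"
      by (rule cinner_commute)
    thus "cinner (G x) y = cinner x (G y)"
      using g_herm[OF xy] by (simp add: Gg xy)
  qed
  have contr: "norm (u - G u) \<le> norm u" if u: "u \<in> K" for u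
  proof (rule power2_le_imp_le)
    define w where "w = G u"
    have w: "w \<in> K" unfolding w_def by (rule bounded_op_in[OF G u])
    have nw: "(norm w)\<^sup>2 = Re (cinner w w)"
      by (simp add: cinner_self flip: of_real_power)
    have "Re (g w w) \<le> cmod (g w w)"
      by (rule complex_Re_le_cmod)
    also have "\<dots> \<le> b * (norm w)\<^sup>2"
      using b(2)[OF w w] by (simp add: power2_eq_square mult.assoc)
    finally have gw: "Re (g w w) \<le> b * (norm w)\<^sup>2" .
    have uw: "Re (g u w) = b * (norm w)\<^sup>2" and uu: "Re (g u u) = b * Re (cinner w u)"
      using Gg[OF u w] Gg[OF u u] b(1) by (simp_all add: nw w_def[symmetric])
    have wu: "Re (g w u) = Re (g u w)"
      using g_herm[OF w u] by simp
    \<comment> \<open>Positivity of the form at \<open>u - G u\<close> gives \<open>(norm (G u))\<^sup>2 \<le> cinner (G u) u\<close>, which is more than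
      the contraction property needs.\<close>
    have "g (u + - w) (u + - w) = g u u - g u w - g w u + g w w"
      using u w csubspace_minus[OF K' w] csubspace_add[OF K' u csubspace_minus[OF K' w]]
      by (simp add: bounded_formD[OF g] del: add_uminus_conv_diff)
    hence "Re (g u u) - 2 * Re (g u w) + Re (g w w) \<ge> 0"
      using g_nonneg[OF csubspace_add[OF K' u csubspace_minus[OF K' w]]] wu by simp
    hence "b * (norm w)\<^sup>2 \<le> b * Re (cinner w u)"
      using gw uw uu by linarith
    hence "(norm w)\<^sup>2 \<le> Re (cinner w u)"
      using b(1) by simp
    moreover have "(norm (u - w))\<^sup>2 = (norm u)\<^sup>2 - 2 * Re (cinner w u) + (norm w)\<^sup>2"
      by (simp add: power2_norm_eq_inner inner_eq_Re_cinner[symmetric] algebra_simps inner_commute)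
    moreover have "0 \<le> Re (cinner w u)"
      using calculation(1) order_trans[OF zero_le_power2] by blast
    ultimately show "(norm (u - G u))\<^sup>2 \<le> (norm u)\<^sup>2"
      unfolding w_def by linarith
  qed simp
  obtain S where S: "adjoint_pair K K S S"
    "\<And>x y. x \<in> K \<Longrightarrow> y \<in> K \<Longrightarrow> cinner (S x) (S y) = cinner (G x) y"
    "\<And>V x. bounded_op K K V \<Longrightarrow> (\<And>x. x \<in> K \<Longrightarrow> V (G x) = G (V x)) \<Longrightarrow> x \<in> K \<Longrightarrow> V (S x) = S (V x)"
    using positive_sqrt[OF K G_adj contr] by blast
  note Sb = adjoint_pairD(1)[OF S(1)]
  have "U (G x) = G (U x)" if x: "x \<in> K" for x
    using bounded_op_scaleC[OF Ub bounded_op_in[OF G1(1) x], of "of_real (1 / b)"] G1(3)[OF x]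
    unfolding G_def scaleR_eq_scaleC by simp
  hence US: "U (S x) = S (U x)" if "x \<in> K" for x
    using S(3)[OF Ub _ that] by blast
  define R where "R x = sqrt b *\<^sub>R S x" for x
  have R: "bounded_op K K R"
    unfolding R_def by (rule bounded_op_scaleR[OF Sb K'])
  have Rg: "a (Y u) (Y v) = cinner (R u) (R v)" if "u \<in> K" "v \<in> K" for u v
    using b(1) by (simp add: R_def cinner.scaleR_left cinner.scaleR_right S(2) that Gg g_def)
  have "closure (R ` K) = K"
  proof (rule dense_if_orthogonal_trivial[OF bounded_op_csubspace_image[OF R K' subset_refl] _ K])
    show "R ` K \<subseteq> K" using bounded_op_in[OF R] by blast
    fix h assume h: "h \<in> K" "\<And>s. s \<in> R ` K \<Longrightarrow> cinner s h = 0"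
    have "cinner (R (S h)) h = 0"
      by (intro h(2) imageI bounded_op_in[OF Sb] h(1))
    hence "cinner (S h) (S h) = 0"
      using b(1) adjoint_pairD(3)[OF S(1) bounded_op_in[OF Sb h(1)] h(1)]
      by (simp add: R_def cinner.scaleR_left)
    hence "a (Y h) (Y h) = 0"
      by (simp add: Rg h(1) R_def cinner.scaleR_left cinner.scaleR_right)
    hence "c * (norm (Y h))\<^sup>2 \<le> 0"
      using low[OF Yin[OF h(1)]] by simp
    hence "Y h = 0"
      using c by (simp add: mult_le_0_iff)
    thus "h = 0"
      by (rule quasiaffinityD(3)[OF Y h(1)])
  qed
  then obtain Z where Z: "boundedly_invertible H K Z" "\<And>u. u \<in> K \<Longrightarrow> Z (Y u) = R u"
    "\<And>x y. x \<in> H \<Longrightarrow> y \<in> H \<Longrightarrow> cinner (Z x) (Z y) = a x y"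
    using isometric_extension[OF H K K' Yb quasiaffinityD(2)[OF Y] R _ a c low Rg] by blast
  note Zb = boundedly_invertibleD(1)[OF Z(1)]
  have "Z (T x) = U (Z x)" if x: "x \<in> H" for x
  proof (rule bounded_op_eq_on_closure[OF bounded_op_compose[OF T Zb] bounded_op_compose[OF Zb Ub] H _ _ x])
    show "closure (Y ` K) = H" by (rule quasiaffinityD(2)[OF Y])
    fix s assume "s \<in> Y ` K"
    then obtain u where u: "u \<in> K" "s = Y u" by blast
    have "U (R u) = R (U u)"
      using US[OF u(1)] bounded_op_scaleC[OF Ub bounded_op_in[OF Sb u(1)]]
      by (simp add: R_def scaleR_eq_scaleC)
    thus "Z (T s) = U (Z s)"
      using u Uin[OF u(1)] by (simp add: Z(2) YU[symmetric])
  qed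
  thus thesis using that Z by blast
qed

section \<open>The invariant form of a power bounded operator\<close>

text \<open>The sequence of evaluations \<open>f \<mapsto> f n\<close> lives in a product of compact discs; a filter along which it
  converges to one of its cluster points makes all bounded sequences converge.\<close>

lemma generalized_limit_filter:
  obtains F :: "nat filter" where "F \<noteq> bot" "F \<le> sequentially"
    "\<And>f :: nat \<Rightarrow> complex. bounded (range f) \<Longrightarrow> \<exists>l. (f \<longlongrightarrow> l) F"
proof -
  \<comment> \<open>Unbounded sequences also index a factor of the product; they are evaluated to 0.\<close>
  define e :: "nat \<Rightarrow> (nat \<Rightarrow> complex) \<Rightarrow> complex"
    where "e n f = (if bounded (range f) then f n else 0)" for n f
  have "\<exists>r. \<forall>n. e n f \<in> cball 0 r" for f
  proof (cases "bounded (range f)")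
    case True
    thus ?thesis by (auto simp: e_def bounded_iff)
  next
    case False
    thus ?thesis by (intro exI[of _ 0]) (simp add: e_def)
  qed
  then obtain r where r: "\<And>n f. e n f \<in> cball 0 (r f)"
    by metis
  define S where "S = (\<Pi>\<^sub>E f\<in>UNIV. cball (0::complex) (r f))"
  have "compactin (product_topology (\<lambda>_. euclidean) UNIV) S"
    unfolding S_def by (subst compactin_PiE) simp
  hence "compact S"
    by (simp add: euclidean_product_topology)
  moreover have "filtermap e sequentially \<noteq> bot"
    by (simp add: filtermap_bot_iff)
  moreover have "eventually (\<lambda>\<phi>. \<phi> \<in> S) (filtermap e sequentially)"
    using r by (simp add: eventually_filtermap S_def PiE_UNIV_domain Pi_iff)
  ultimately obtain \<phi> where \<phi>: "inf (nhds \<phi>) (filtermap e sequentially) \<noteq> bot"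
    unfolding compact_filter by blast
  define F where "F = inf (filtercomap e (nhds \<phi>)) sequentially"
  have "F \<noteq> bot"
  proof
    assume "F = bot"
    hence "eventually (\<lambda>_. False) F" by simp
    then obtain P' Q where P': "eventually P' (filtercomap e (nhds \<phi>))" "eventually Q sequentially"
      "\<forall>n. P' n \<and> Q n \<longrightarrow> False"
      unfolding F_def eventually_inf by blast
    obtain P where P: "eventually P (nhds \<phi>)" "\<forall>n. P (e n) \<longrightarrow> P' n"
      using P'(1) unfolding eventually_filtercomap by blast
    have "eventually (\<lambda>\<psi>. \<exists>n. \<psi> = e n \<and> Q n) (filtermap e sequentially)"
      unfolding eventually_filtermap by (rule eventually_mono[OF P'(2)]) blast
    hence "eventually (\<lambda>_. False) (inf (nhds \<phi>) (filtermap e sequentially))"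
      unfolding eventually_inf using P P'(3) by blast
    thus False using \<phi> by (simp add: trivial_limit_def)
  qed
  moreover have "F \<le> sequentially"
    by (simp add: F_def)
  moreover have "\<exists>l. (f \<longlongrightarrow> l) F" if f: "bounded (range f)" for f :: "nat \<Rightarrow> complex"
  proof -
    have "filterlim e (nhds \<phi>) F"
      unfolding F_def by (meson filterlim_filtercomap filterlim_mono inf_le1 order_refl)
    moreover have "((\<lambda>\<psi>. \<psi> f) \<longlongrightarrow> \<phi> f) (nhds \<phi>)"
      using continuous_on_product_coordinates[of f, where 'b = complex]
        tendsto_at_iff_tendsto_nhds[of "\<lambda>\<psi>. \<psi> f" \<phi>]
      by (simp add: continuous_on_def)
    ultimately have "((\<lambda>n. e n f) \<longlongrightarrow> \<phi> f) F"
      by (rule filterlim_compose[rotated])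
    thus ?thesis using f by (auto simp: e_def)
  qed
  ultimately show thesis
    using that by blast
qed

text \<open>A generalized limit of the Cesaro means of \<open>cinner (T\<^sup>n x) (T\<^sup>n y)\<close>. Passing from the orbit
  of \<open>x\<close> to that of \<open>T x\<close> changes the means by \<open>O(1/N)\<close>, so the form is invariant under \<open>T\<close>; and any
  two-sided bound for the orbit carries over to the form.\<close>

lemma invariant_form:
  assumes H: "csubspace H" and T: "bounded_op H H T"
    and M: "\<And>n x. x \<in> H \<Longrightarrow> norm ((T ^^ n) x) \<le> M * norm x" and M0: "M \<ge> 0"
  obtains a where "bounded_form H H a" "\<forall>x\<in>H. \<forall>y\<in>H. a x y = cnj (a y x)"
    "\<forall>x\<in>H. \<forall>y\<in>H. a (T x) (T y) = a x y" "\<forall>x\<in>H. Re (a x x) \<le> (M * norm x)\<^sup>2"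
    "\<forall>x\<in>H. \<forall>d\<ge>0. (\<forall>n. d \<le> norm ((T ^^ n) x)) \<longrightarrow> d\<^sup>2 \<le> Re (a x x)"
proof -
  obtain F :: "nat filter" where F: "F \<noteq> bot" "F \<le> sequentially"
    "\<And>f :: nat \<Rightarrow> complex. bounded (range f) \<Longrightarrow> \<exists>l. (f \<longlongrightarrow> l) F"
    using generalized_limit_filter by blast
  define A where "A x y N = (\<Sum>n<Suc N. cinner ((T ^^ n) x) ((T ^^ n) y)) / of_nat (Suc N)" for x y N
  note Tn = bounded_op_funpow[OF T]
  have term_le: "cmod (cinner ((T ^^ n) x) ((T ^^ n) y)) \<le> M\<^sup>2 * norm x * norm y" if "x \<in> H" "y \<in> H" for x y n
  proof -
    have "cmod (cinner ((T ^^ n) x) ((T ^^ n) y)) \<le> (M * norm x) * (M * norm y)"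
      by (rule order_trans[OF norm_cinner_le]) (use M M0 that in \<open>intro mult_mono; simp\<close>)
    thus ?thesis by (simp add: power2_eq_square mult_ac)
  qed
  have mean_le: "cmod ((\<Sum>n<Suc N. z n) / of_nat (Suc N)) \<le> b" if "\<And>n. cmod (z n) \<le> b" for z b N
  proof -
    have "cmod (\<Sum>n<Suc N. z n) \<le> of_nat (card {..<Suc N}) * b"
      by (rule sum_norm_bound) (rule that)
    thus ?thesis by (simp add: norm_divide pos_divide_le_eq mult.commute del: sum.lessThan_Suc of_nat_Suc)
  qed
  have A_le: "cmod (A x y N) \<le> M\<^sup>2 * norm x * norm y" if "x \<in> H" "y \<in> H" for x y N
    unfolding A_def by (rule mean_le) (rule term_le[OF that])
  have "\<exists>l. (A x y \<longlongrightarrow> l) F" if "x \<in> H" "y \<in> H" for x y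
    by (rule F(3)) (use A_le[OF that] in \<open>auto simp: bounded_iff\<close>)
  then obtain a where a: "\<And>x y. x \<in> H \<Longrightarrow> y \<in> H \<Longrightarrow> (A x y \<longlongrightarrow> a x y) F"
    by metis
  note uniq = tendsto_unique[OF F(1)]
  have "cmod (a x y) \<le> M\<^sup>2 * norm x * norm y" if "x \<in> H" "y \<in> H" for x y
    by (rule tendsto_upperbound[OF tendsto_norm[OF a[OF that]] _ F(1)]) (simp add: A_le that)
  moreover have "a (x + x') y = a x y + a x' y" if "x \<in> H" "x' \<in> H" "y \<in> H" for x x' y
  proof (rule uniq[OF a])
    have "A (x + x') y = (\<lambda>N. A x y N + A x' y N)"
      by (simp add: A_def fun_eq_iff bounded_op_add[OF Tn] that cinner_add_left sum.distrib add_divide_distrib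
          del: sum.lessThan_Suc)
    thus "(A (x + x') y \<longlongrightarrow> a x y + a x' y) F"
      using tendsto_add[OF a[of x y] a[of x' y]] that by simp
  qed (use that csubspace_add[OF H] in auto)
  moreover have "a (c *\<^sub>C x) y = c * a x y" if "x \<in> H" "y \<in> H" for x y c
  proof (rule uniq[OF a])
    have "A (c *\<^sub>C x) y = (\<lambda>N. c * A x y N)"
      by (simp add: A_def fun_eq_iff bounded_op_scaleC[OF Tn] that cinner_scaleC_left sum_distrib_left
          del: sum.lessThan_Suc)
    thus "(A (c *\<^sub>C x) y \<longlongrightarrow> c * a x y) F"
      using tendsto_mult_left[OF a[OF that], of c] by simp
  qed (use that csubspace_scaleC[OF H] in auto)
  moreover have herm: "a x y = cnj (a y x)" if "x \<in> H" "y \<in> H" for x y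
  proof (rule uniq[OF a[OF that]])
    have "A x y = (\<lambda>N. cnj (A y x N))"
      by (simp add: A_def fun_eq_iff flip: cinner_commute del: sum.lessThan_Suc)
    thus "(A x y \<longlongrightarrow> cnj (a y x)) F"
      using tendsto_cnj[OF a[of y x]] that by simp
  qed
  ultimately have form: "bounded_form H H a"
    unfolding bounded_form_def
  proof (intro conjI ballI allI)
    fix x y y' assume *: "x \<in> H" "y \<in> H" "y' \<in> H"
    assume add: "\<And>x x' y. x \<in> H \<Longrightarrow> x' \<in> H \<Longrightarrow> y \<in> H \<Longrightarrow> a (x + x') y = a x y + a x' y"
    show "a x (y + y') = a x y + a x y'"
      using add[OF *(2,3,1)] herm[OF *(1) csubspace_add[OF H *(2,3)]] herm[OF *(1,2)] herm[OF *(1,3)] by simp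
  next
    fix x y c assume *: "x \<in> H" "y \<in> H"
    assume scale: "\<And>x y c. x \<in> H \<Longrightarrow> y \<in> H \<Longrightarrow> a (c *\<^sub>C x) y = c * a x y"
    show "a x (c *\<^sub>C y) = cnj c * a x y"
      using scale[OF *(2,1)] herm[OF *(1) csubspace_scaleC[OF H *(2)]] herm[OF *] by simp
  qed blast+
  have inv: "a (T x) (T y) = a x y" if x: "x \<in> H" and y: "y \<in> H" for x y
  proof -
    define z where "z n = cinner ((T ^^ n) x) ((T ^^ n) y)" for n
    have "A (T x) (T y) N - A x y N = (z (Suc N) - z 0) / of_nat (Suc N)" for N
    proof -
      have "(\<Sum>n<Suc N. cinner ((T ^^ n) (T x)) ((T ^^ n) (T y))) = (\<Sum>n<Suc N. z (Suc n))"
        by (simp add: z_def funpow_swap1 del: sum.lessThan_Suc)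
      also have "\<dots> = (\<Sum>n<Suc N. z n) + (z (Suc N) - z 0)"
        using sum_lessThan_telescope[of z "Suc N"] by (simp add: sum_subtractf algebra_simps)
      finally show ?thesis
        by (simp add: A_def z_def[symmetric] add_divide_distrib del: sum.lessThan_Suc)
    qed
    hence diff: "A (T x) (T y) = (\<lambda>N. A x y N + (z (Suc N) - z 0) / of_nat (Suc N))"
      by (simp add: fun_eq_iff algebra_simps)
    have "(\<lambda>N. (z (Suc N) - z 0) / of_nat (Suc N)) \<longlonglongrightarrow> 0"
    proof (rule Lim_null_comparison)
      let ?b = "2 * (M\<^sup>2 * norm x * norm y)"
      show "\<forall>\<^sub>F N in sequentially. norm ((z (Suc N) - z 0) / of_nat (Suc N)) \<le> ?b * inverse (real (Suc N))"
      proof (intro always_eventually allI)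
        fix N
        have "cmod (z (Suc N) - z 0) \<le> ?b"
          using norm_triangle_ineq4[of "z (Suc N)" "z 0"] term_le[OF x y, of "Suc N"] term_le[OF x y, of 0]
          unfolding z_def by linarith
        hence "cmod (z (Suc N) - z 0) / real (Suc N) \<le> ?b / real (Suc N)"
          by (rule divide_right_mono) simp
        thus "norm ((z (Suc N) - z 0) / of_nat (Suc N)) \<le> ?b * inverse (real (Suc N))"
          by (simp only: norm_divide norm_of_nat divide_inverse[of ?b])
      qed
      show "(\<lambda>N. ?b * inverse (real (Suc N))) \<longlonglongrightarrow> 0"
        using tendsto_mult_left[OF LIMSEQ_inverse_real_of_nat, of ?b] by simp
    qed
    hence "((\<lambda>N. (z (Suc N) - z 0) / of_nat (Suc N)) \<longlongrightarrow> 0) F"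
      by (rule tendsto_mono[OF F(2)])
    from tendsto_add[OF a[OF x y] this] have "(A (T x) (T y) \<longlongrightarrow> a x y) F"
      by (simp add: diff)
    thus ?thesis
      by (intro uniq[OF a]) (use x y bounded_op_in[OF T] in auto)
  qed
  have upper: "Re (a x x) \<le> (M * norm x)\<^sup>2" if x: "x \<in> H" for x
  proof (rule tendsto_upperbound[OF tendsto_Re[OF a[OF x x]] _ F(1)])
    have "Re (A x x N) \<le> (M * norm x)\<^sup>2" for N
      using A_le[OF x x, of N] complex_Re_le_cmod[of "A x x N"]
      by (simp add: power2_eq_square mult_ac)
    thus "\<forall>\<^sub>F N in F. Re (A x x N) \<le> (M * norm x)\<^sup>2" by simp
  qed
  have lower: "d\<^sup>2 \<le> Re (a x x)" if x: "x \<in> H" and d: "d \<ge> 0" "\<forall>n. d \<le> norm ((T ^^ n) x)" for x d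
  proof (rule tendsto_lowerbound[OF tendsto_Re[OF a[OF x x]] _ F(1)])
    have "d\<^sup>2 \<le> Re (A x x N)" for N
    proof -
      have "of_nat (card {..<Suc N}) * d\<^sup>2 \<le> (\<Sum>n<Suc N. (norm ((T ^^ n) x))\<^sup>2)"
        by (rule sum_bounded_below) (use d in \<open>simp add: power_mono\<close>)
      hence "d\<^sup>2 \<le> (\<Sum>n<Suc N. (norm ((T ^^ n) x))\<^sup>2) / real (Suc N)"
        by (simp add: pos_le_divide_eq mult.commute del: sum.lessThan_Suc of_nat_Suc)
      also have "\<dots> = Re (of_real ((\<Sum>n<Suc N. (norm ((T ^^ n) x))\<^sup>2) / real (Suc N)))"
        by simp
      also have "of_real ((\<Sum>n<Suc N. (norm ((T ^^ n) x))\<^sup>2) / real (Suc N)) = A x x N"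
        by (simp add: A_def cinner_self del: sum.lessThan_Suc)
      finally show ?thesis .
    qed
    thus "\<forall>\<^sub>F N in F. d\<^sup>2 \<le> Re (A x x N)" by simp
  qed
  show thesis
  proof (rule that[OF form])
    show "\<forall>x\<in>H. \<forall>y\<in>H. a x y = cnj (a y x)"
      by (intro ballI herm)
    show "\<forall>x\<in>H. \<forall>y\<in>H. a (T x) (T y) = a x y"
      by (intro ballI inv)
    show "\<forall>x\<in>H. Re (a x x) \<le> (M * norm x)\<^sup>2"
      by (intro ballI upper)
    show "\<forall>x\<in>H. \<forall>d\<ge>0. (\<forall>n. d \<le> norm ((T ^^ n) x)) \<longrightarrow> d\<^sup>2 \<le> Re (a x x)"
      using lower by blast
  qed
qed

section \<open>Independence of the ambient space\<close>

text \<open>A Hilbert space containing the dense range of a quasiaffinity from \<open>K\<close> is isometric to \<open>K\<close>: take the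
  polar decomposition of the quasiaffinity. Hence an operator quasisimilar to an operator on \<open>K\<close> has
  a unitarily equivalent copy on \<open>K\<close>, with the same norms of powers.\<close>

lemma neg_powers_bounded_on_isometric_copy:
  fixes K :: "'a::complex_hilbert set" and L :: "'b::complex_hilbert set"
  assumes K: "closed_csubspace K" and L: "closed_csubspace L"
    and R: "bounded_op L L R" "pos_powers_bounded L R M" and qs: "quasisimilar L R K U"
    and M: "M \<ge> 0" and C: "C \<ge> 0"
    and hyp: "\<And>Q. bounded_op K K Q \<Longrightarrow> pos_powers_bounded K Q M \<Longrightarrow> quasisimilar K Q K U \<Longrightarrow>
      neg_powers_bounded K Q C"
  shows "neg_powers_bounded L R C"
proof -
  note K' = closed_csubspaceD(1)[OF K] and L' = closed_csubspaceD(1)[OF L]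
  obtain Y where Y: "quasiaffinity K L Y"
    using qs unfolding quasisimilar_def quasiaffine_transform_iff by blast
  obtain Z where Z: "boundedly_invertible L K Z"
    "\<And>x y. x \<in> L \<Longrightarrow> y \<in> L \<Longrightarrow> cinner (Z x) (Z y) = cinner x y"
    by (rule polar_similarity[OF L K Y unitary_op_id bounded_op_id[OF subset_refl] _ bounded_form_cinner,
          where c = 1]) (auto simp: cinner_self cinner_commute[symmetric])
  note D = boundedly_invertibleD[OF Z(1)]
  have Z_norm: "norm (Z x) = norm x" if "x \<in> L" for x
    using Z(2)[OF that that] by (simp add: cinner_self flip: of_real_power)
  define Q where "Q v = Z (R (inv_into L Z v))" for v
  have Q: "bounded_op K K Q"
    unfolding Q_def by (rule bounded_op_compose[OF bounded_op_compose[OF D(4) R(1)] D(1)])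
  have ZR: "Z (R x) = Q (Z x)" if "x \<in> L" for x
    by (simp add: Q_def D(5) that)
  have ZRn: "Z ((R ^^ n) x) = (Q ^^ n) (Z x)" if "x \<in> L" for n x
    by (rule funpow_intertwine[where X = Z and T = R, OF bounded_op_in[OF R(1)] ZR that])
  have norms: "norm ((Q ^^ n) (Z x)) = norm ((R ^^ n) x)" if "x \<in> L" for n x
    using Z_norm[OF bounded_op_in[OF bounded_op_funpow[OF R(1)] that]] by (simp add: ZRn[OF that])
  have "norm ((Q ^^ n) v) \<le> M * norm v" if v: "v \<in> K" for n v
  proof -
    obtain x where "x \<in> L" "v = Z x" using v D(2) by blast
    thus ?thesis
      using R(2) by (simp add: norms Z_norm pos_powers_bounded_iff[OF R(1) L' M])
  qed
  hence "pos_powers_bounded K Q M"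
    by (simp add: pos_powers_bounded_iff[OF Q K' M])
  moreover have "quasisimilar L R K Q"
    by (rule similar_imp_quasisimilar[OF Z(1) L K]) (simp_all add: bounded_op_in[OF R(1)] ZR)
  hence "quasisimilar K Q K U"
    by (rule quasisimilar_trans[OF quasisimilar_sym qs K' L' K'])
  ultimately have neg: "neg_powers_bounded K Q C"
    using hyp Q by blast
  have "R ` L = L"
  proof
    show "R ` L \<subseteq> L" using bounded_op_in[OF R(1)] by blast
    show "L \<subseteq> R ` L"
    proof
      fix x assume x: "x \<in> L"
      have "Q ` K = K"
        using neg by (simp add: neg_powers_bounded_def boundedly_invertibleD(2))
      then obtain v where v: "v \<in> K" "Z x = Q v"
        using bounded_op_in[OF D(1) x] by blast
      then obtain y where y: "y \<in> L" "v = Z y" using D(2) by blast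
      have "Z x = Z (R y)" using v y ZR by simp
      hence "x = R y"
        using inj_onD[OF D(3)] x bounded_op_in[OF R(1) y(1)] by blast
      thus "x \<in> R ` L" using y by blast
    qed
  qed
  moreover have "norm x \<le> C * norm ((R ^^ n) x)" if "x \<in> L" for x n
    using neg_powers_bounded_lower[OF neg K' C bounded_op_in[OF D(1) that], of n]
    by (simp add: norms Z_norm that)
  ultimately show ?thesis
    by (intro neg_powers_boundedI[OF R(1) L' _ C])
qed

text \<open>Solve \<open>x = R\<^sup>n z\<close> with \<open>norm z \<le> C * norm x\<close> and test \<open>Q\<^sup>n x\<close> against \<open>z\<close>.\<close>

lemma neg_powers_bounded_adjoint_lower:
  assumes L: "csubspace L" and Q: "adjoint_pair L L Q R" and R: "neg_powers_bounded L R C"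
    and C: "C \<ge> 0" and x: "x \<in> L"
  shows "norm x \<le> C * norm ((Q ^^ n) x)"
proof (cases "x = 0")
  case False
  have D: "boundedly_invertible L L R"
    using R by (simp add: neg_powers_bounded_def)
  define z where "z = (inv_into L R ^^ n) x"
  have z: "z \<in> L" "(R ^^ n) z = x"
    unfolding z_def using bounded_op_in[OF bounded_op_funpow[OF boundedly_invertibleD(4)[OF D]] x]
      funpow_inv_into(2)[OF D x] by auto
  have "(norm x)\<^sup>2 = cmod (cinner ((Q ^^ n) x) z)"
    using adjoint_funpow[OF Q x z(1), of n] by (simp add: z(2) cinner_self norm_power)
  also have "\<dots> \<le> norm ((Q ^^ n) x) * norm z"
    by (rule norm_cinner_le)
  also have "\<dots> \<le> norm ((Q ^^ n) x) * (C * norm x)"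
    using neg_powers_bounded_lower[OF R L C z(1), of n] by (simp add: z(2) mult_left_mono)
  finally show ?thesis
    using False by (simp add: power2_eq_square mult_ac)
qed (use C in simp)

section \<open>Orthogonal decompositions into hyperinvariant subspaces\<close>

lemma unitary_op_adjoint:
  assumes K: "closed_csubspace K" and V: "unitary_op K V"
  obtains V' where "adjoint_pair K K V V'" "unitary_op K V'"
    "\<And>x. x \<in> K \<Longrightarrow> V' (V x) = x" "\<And>x. x \<in> K \<Longrightarrow> V (V' x) = x"
proof -
  note K' = closed_csubspaceD(1)[OF K] and Vin = bounded_op_in[OF unitary_opD(1)[OF V]]
  obtain V' where V': "adjoint_pair K K V V'"
    using adjoint_exists[OF unitary_opD(1)[OF V] K K] by blast
  note V'in = bounded_op_in[OF adjoint_pairD(2)[OF V']]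
  have left: "V' (V x) = x" if x: "x \<in> K" for x
    by (rule eq_if_cinner_eq[OF K' V'in[OF Vin[OF x]] x])
      (simp add: adjoint_pairD(3)[OF V', symmetric] unitary_opD(3)[OF V] Vin x)
  have right: "V (V' x) = x" if "x \<in> K" for x
  proof -
    obtain y where "y \<in> K" "x = V y"
      using \<open>x \<in> K\<close> unitary_opD(2)[OF V] by blast
    thus ?thesis by (simp add: left)
  qed
  have "V' ` K = K"
  proof
    show "V' ` K \<subseteq> K" using V'in by blast
    show "K \<subseteq> V' ` K" using left Vin by (metis image_eqI subsetI)
  qed
  hence "unitary_op K V'"
    unfolding unitary_op_def using adjoint_pairD(2)[OF V'] V'in
    by (simp add: adjoint_pairD(3)[OF V', symmetric] right)
  thus thesis using that V' left right by blast
qed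

text \<open>The internal form of the direct sum of the theorem. That the summands span \<open>K\<close> is expressed by a trivial
  orthogonal complement, which for square-summable families is a statement about single coordinates.\<close>

locale hyperinvariant_decomposition =
  fixes K :: "'k::complex_hilbert set" and V :: "'k \<Rightarrow> 'k"
    and J :: "'i set" and N :: "'i \<Rightarrow> 'k set"
  assumes K: "closed_csubspace K" and V: "unitary_op K V"
    and N_Hyplat: "j \<in> J \<Longrightarrow> N j \<in> Hyplat K V"
    and N_orth: "i \<in> J \<Longrightarrow> j \<in> J \<Longrightarrow> i \<noteq> j \<Longrightarrow> x \<in> N i \<Longrightarrow> y \<in> N j \<Longrightarrow> cinner x y = 0"
    and N_total: "x \<in> K \<Longrightarrow> (\<And>j y. j \<in> J \<Longrightarrow> y \<in> N j \<Longrightarrow> cinner y x = 0) \<Longrightarrow> x = 0"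
begin

lemmas K' = closed_csubspaceD(1)[OF K]
lemmas Vb = unitary_opD(1)[OF V]
lemmas Vin = bounded_op_in[OF unitary_opD(1)[OF V]]

lemma N: "j \<in> J \<Longrightarrow> closed_csubspace (N j)" and N_sub: "j \<in> J \<Longrightarrow> N j \<subseteq> K"
  using N_Hyplat unfolding Hyplat_def by blast+

lemma N_K: "j \<in> J \<Longrightarrow> x \<in> N j \<Longrightarrow> x \<in> K"
  using N_sub by blast

lemma commutant_N:
  assumes "bounded_op K K A" "\<And>x. x \<in> K \<Longrightarrow> A (V x) = V (A x)" "j \<in> J" "x \<in> N j"
  shows "A x \<in> N j"
  using N_Hyplat[OF assms(3)] assms unfolding Hyplat_def by blast

lemma V_N: "j \<in> J \<Longrightarrow> x \<in> N j \<Longrightarrow> V x \<in> N j"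
  using commutant_N[OF Vb] by blast

text \<open>Commuting with a unitary operator is the same as commuting with its inverse, so hyperinvariance for \<open>V\<close>
  and for its adjoint agree. This makes every result of this section applicable to adjoints.\<close>

lemma adjoint_decomposition:
  obtains V' where "adjoint_pair K K V V'" "hyperinvariant_decomposition K V' J N"
proof -
  obtain V' where V': "adjoint_pair K K V V'" "unitary_op K V'"
    "\<And>x. x \<in> K \<Longrightarrow> V' (V x) = x" "\<And>x. x \<in> K \<Longrightarrow> V (V' x) = x"
    using unitary_op_adjoint[OF K V] by blast
  note V'in = bounded_op_in[OF unitary_opD(1)[OF V'(2)]]
  have comm: "A (V x) = V (A x)"
    if A: "bounded_op K K A" and c: "\<And>x. x \<in> K \<Longrightarrow> A (V' x) = V' (A x)" and x: "x \<in> K" for A x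
  proof -
    note Ain = bounded_op_in[OF A]
    have "V (A x) = V (A (V' (V x)))" by (simp add: V'(3) x)
    also have "\<dots> = V (V' (A (V x)))" by (simp add: c Vin x)
    also have "\<dots> = A (V x)" by (simp add: V'(4) Ain Vin x)
    finally show ?thesis ..
  qed
  have "N j \<in> Hyplat K V'" if j: "j \<in> J" for j
    unfolding Hyplat_def
  proof (intro CollectI conjI allI impI N[OF j] N_sub[OF j] image_subsetI)
    fix A x assume A: "bounded_op K K A \<and> (\<forall>x\<in>K. A (V' x) = V' (A x))" and x: "x \<in> N j"
    have "A (V y) = V (A y)" if "y \<in> K" for y
      using comm[OF _ _ that] A by blast
    thus "A x \<in> N j"
      using commutant_N[OF _ _ j x] A by blast
  qed
  note Hyp = this
  have "hyperinvariant_decomposition K V' J N"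
  proof (rule hyperinvariant_decomposition.intro[OF K V'(2)])
    show "N j \<in> Hyplat K V'" if "j \<in> J" for j
      by (rule Hyp[OF that])
    show "cinner x y = 0" if "i \<in> J" "j \<in> J" "i \<noteq> j" "x \<in> N i" "y \<in> N j" for i j x y
      by (rule N_orth[OF that])
    show "x = 0" if "x \<in> K" "\<And>j y. j \<in> J \<Longrightarrow> y \<in> N j \<Longrightarrow> cinner y x = 0" for x
      by (rule N_total[OF that])
  qed
  thus thesis using that V'(1) by blast
qed

definition finite_sums :: "'k set" where
  "finite_sums = {\<Sum>j\<in>F. u j | F u. finite F \<and> F \<subseteq> J \<and> (\<forall>j\<in>F. u j \<in> N j)}"

lemma finite_sumsI: "finite F \<Longrightarrow> F \<subseteq> J \<Longrightarrow> (\<And>j. j \<in> F \<Longrightarrow> u j \<in> N j) \<Longrightarrow> (\<Sum>j\<in>F. u j) \<in> finite_sums"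
  unfolding finite_sums_def by blast

lemma finite_sumsE:
  assumes "x \<in> finite_sums"
  obtains F u where "x = (\<Sum>j\<in>F. u j)" "finite F" "F \<subseteq> J" "\<And>j. j \<in> F \<Longrightarrow> u j \<in> N j"
  using assms unfolding finite_sums_def by blast

lemma finite_sums_sub: "finite_sums \<subseteq> K"
  by (auto elim!: finite_sumsE intro!: csubspace_sum[OF K'] N_K)

lemma csubspace_finite_sums: "csubspace finite_sums"
  unfolding csubspace_def
proof (intro conjI ballI allI)
  show "0 \<in> finite_sums"
    using finite_sumsI[of "{}"] by simp
next
  fix x y assume "x \<in> finite_sums" "y \<in> finite_sums"
  then obtain F u G v where F: "x = (\<Sum>j\<in>F. u j)" "finite F" "F \<subseteq> J" "\<And>j. j \<in> F \<Longrightarrow> u j \<in> N j"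
    and G: "y = (\<Sum>j\<in>G. v j)" "finite G" "G \<subseteq> J" "\<And>j. j \<in> G \<Longrightarrow> v j \<in> N j"
    by (elim finite_sumsE) blast
  have "x + y = (\<Sum>j\<in>F \<union> G. (if j \<in> F then u j else 0) + (if j \<in> G then v j else 0))"
    using F(2) G(2) by (simp add: sum.distrib F(1) G(1) sum.If_cases Int_absorb1 Int_absorb2 Un_commute)
  also have "\<dots> \<in> finite_sums"
    using F G by (intro finite_sumsI csubspace_add closed_csubspaceD(1)[OF N])
      (auto intro: csubspace_zero[OF closed_csubspaceD(1)[OF N]])
  finally show "x + y \<in> finite_sums" .
next
  fix c x assume "x \<in> finite_sums"
  then obtain F u where F: "x = (\<Sum>j\<in>F. u j)" "finite F" "F \<subseteq> J" "\<And>j. j \<in> F \<Longrightarrow> u j \<in> N j"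
    by (elim finite_sumsE) blast
  have "c *\<^sub>C x = (\<Sum>j\<in>F. c *\<^sub>C u j)"
    using linear_sum[OF bounded_linear.linear[OF bounded_linear_scaleC]] by (simp add: F(1))
  also have "\<dots> \<in> finite_sums"
    using F by (intro finite_sumsI csubspace_scaleC closed_csubspaceD(1)[OF N]) auto
  finally show "c *\<^sub>C x \<in> finite_sums" .
qed

lemma finite_sums_dense: "closure finite_sums = K"
proof (rule dense_if_orthogonal_trivial[OF csubspace_finite_sums finite_sums_sub K])
  fix x assume x: "x \<in> K" "\<And>s. s \<in> finite_sums \<Longrightarrow> cinner s x = 0"
  have "cinner y x = 0" if "j \<in> J" "y \<in> N j" for j y
    using x(2) finite_sumsI[of "{j}" "\<lambda>_. y"] that by simp
  thus "x = 0" by (rule N_total[OF x(1)])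
qed

text \<open>The product \<open>X Y\<close> commutes with \<open>V\<close> and so maps every summand into itself. This makes \<open>X\<close> map the
  closure of \<open>Y (N j)\<close> into \<open>N j\<close>; the image is dense, because \<open>X Y\<close> has dense range and the other
  summands are mapped into the orthogonal complement of \<open>N j\<close>.\<close>

lemma component_quasisimilar:
  fixes H :: "'h::complex_hilbert set"
  assumes H: "closed_csubspace H" and T: "bounded_op H H T"
    and X: "quasiaffinity H K X" "\<And>x. x \<in> H \<Longrightarrow> X (T x) = V (X x)"
    and Y: "quasiaffinity K H Y" "\<And>x. x \<in> K \<Longrightarrow> Y (V x) = T (Y x)"
    and j: "j \<in> J"
  defines "L \<equiv> closure (Y ` N j)"
  shows "closed_csubspace L" "L \<subseteq> H" "bounded_op L L T" "quasisimilar L T (N j) V"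
proof -
  note H' = closed_csubspaceD(1)[OF H] and Nj = closed_csubspaceD(1)[OF N[OF j]]
  note Xb = quasiaffinityD(1)[OF X(1)] and Yb = quasiaffinityD(1)[OF Y(1)]
  note Xin = bounded_op_in[OF Xb] and Yin = bounded_op_in[OF Yb]
  have XY: "bounded_op K K (\<lambda>x. X (Y x))"
    by (rule bounded_op_compose[OF Yb Xb])
  have XY_N: "X (Y x) \<in> N i" if "i \<in> J" "x \<in> N i" for i x
    by (rule commutant_N[OF XY _ that]) (simp add: X(2) Y(2) Yin)
  show L: "closed_csubspace L"
    unfolding L_def
    by (intro closed_csubspace_closure bounded_op_csubspace_image[OF Yb Nj N_sub[OF j]])
  note L' = closed_csubspaceD(1)[OF L]
  have YN: "Y ` N j \<subseteq> L"
    unfolding L_def by (rule closure_subset)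
  show LH: "L \<subseteq> H"
    unfolding L_def using Yin N_K[OF j] closed_csubspaceD(2)[OF H] by (intro closure_minimal) auto
  have "T ` L \<subseteq> L"
    unfolding L_def
  proof (rule bounded_op_image_closure[OF T H'])
    have "T (Y x) \<in> Y ` N j" if "x \<in> N j" for x
      using Y(2)[OF N_K[OF j that]] V_N[OF j that] by (metis image_eqI)
    thus "T ` Y ` N j \<subseteq> closure (Y ` N j)"
      using closure_subset by blast
  qed (use LH L_def in auto)
  thus T_L: "bounded_op L L T"
    by (rule bounded_op_restrict[OF T LH])
  have X_L: "X ` L \<subseteq> N j"
    unfolding L_def
    by (rule bounded_op_image_closure[OF Xb H'])
      (use LH L_def XY_N[OF j] closed_csubspaceD(2)[OF N[OF j]] in auto)
  have X_Lb: "bounded_op L (N j) X"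
    by (rule bounded_op_restrict[OF Xb LH X_L])
  have "closure (X ` L) = N j"
  proof (rule dense_if_orthogonal_trivial[OF bounded_op_csubspace_image[OF Xb L' LH] X_L N[OF j]])
    fix h assume h: "h \<in> N j" "\<And>s. s \<in> X ` L \<Longrightarrow> cinner s h = 0"
    have "cinner (X (Y x)) h = 0" if "i \<in> J" "x \<in> N i" for i x
    proof (cases "i = j")
      case True
      have "Y x \<in> L" using YN that(2) True by blast
      thus ?thesis using h(2) by blast
    next
      case False
      thus ?thesis using N_orth[OF that(1) j False XY_N[OF that] h(1)] by blast
    qed
    hence orth: "cinner (X (Y s)) h = 0" if "s \<in> finite_sums" for s
    proof -
      assume *: "\<And>i x. i \<in> J \<Longrightarrow> x \<in> N i \<Longrightarrow> cinner (X (Y x)) h = 0"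
      from that obtain F u where F: "s = (\<Sum>j\<in>F. u j)" "finite F" "F \<subseteq> J" "\<And>j. j \<in> F \<Longrightarrow> u j \<in> N j"
        by (elim finite_sumsE) blast
      have uK: "u j \<in> K" if "j \<in> F" for j
        using F that N_K by blast
      have "X (Y s) = (\<Sum>j\<in>F. X (Y (u j)))"
        unfolding F(1) by (rule bounded_op_sum[OF XY K' uK])
      moreover have "cinner (X (Y (u j))) h = 0" if "j \<in> F" for j
        using * F(3) F(4)[OF that] that by blast
      ultimately show ?thesis
        by (simp add: cinner.sum_left)
    qed
    have "closure ((\<lambda>x. X (Y x)) ` finite_sums) = K"
      by (rule quasiaffinity_image_dense[OF quasiaffinity_compose[OF Y(1) X(1) K' H'] K' finite_sums_dense])
    thus "h = 0"
      using orth N_K[OF j h(1)] by (intro orthogonal_dense_trivial[of h "(\<lambda>x. X (Y x)) ` finite_sums"]) auto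
  qed
  hence "quasiaffinity L (N j) X"
    using quasiaffinityD(3)[OF X(1)] LH by (intro quasiaffinityI[OF X_Lb L']) auto
  moreover have "quasiaffinity (N j) L Y"
    using quasiaffinityD(3)[OF Y(1)] N_K[OF j]
    by (intro quasiaffinityI[OF bounded_op_restrict[OF Yb N_sub[OF j] YN] Nj])
      (auto simp: L_def)
  ultimately show "quasisimilar L T (N j) V"
    unfolding quasisimilar_def quasiaffine_transform_iff
    using X(2) Y(2) LH N_K[OF j] by (intro conjI exI[of _ X] exI[of _ Y]) auto
qed

text \<open>The vectors \<open>Y (u j)\<close> are orthogonal with respect to the \<open>T\<close>-invariant form \<open>a\<close>: pulled back to \<open>K\<close>
  along \<open>Y\<close>, this form is \<open>V\<close>-invariant, hence given by an operator in the commutant of \<open>V\<close>, which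
  leaves every \<open>N j\<close> invariant. Comparing \<open>a\<close> with the norm from above by \<open>M\<close> and from below
  by \<open>1/C\<close> gives the estimate.\<close>

lemma square_sum_bound:
  fixes H :: "'h::complex_hilbert set"
  assumes H: "closed_csubspace H" and T: "bounded_op H H T" and M0: "M \<ge> 0" and C: "C > 0"
    and M: "\<And>n x. x \<in> H \<Longrightarrow> norm ((T ^^ n) x) \<le> M * norm x"
    and Y: "bounded_op K H Y" "\<And>x. x \<in> K \<Longrightarrow> Y (V x) = T (Y x)"
    and lower: "\<And>j u n. j \<in> J \<Longrightarrow> u \<in> N j \<Longrightarrow> norm (Y u) \<le> C * norm ((T ^^ n) (Y u))"
    and F: "finite F" "F \<subseteq> J" "\<And>j. j \<in> F \<Longrightarrow> u j \<in> N j"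
  shows "L2_set (\<lambda>j. norm (Y (u j))) F \<le> C * M * norm (Y (\<Sum>j\<in>F. u j))"
proof -
  note Yin = bounded_op_in[OF Y(1)]
  obtain a where a: "bounded_form H H a" "\<forall>x\<in>H. \<forall>y\<in>H. a x y = cnj (a y x)"
    "\<forall>x\<in>H. \<forall>y\<in>H. a (T x) (T y) = a x y" "\<forall>x\<in>H. Re (a x x) \<le> (M * norm x)\<^sup>2"
    "\<forall>x\<in>H. \<forall>d\<ge>0. (\<forall>n. d \<le> norm ((T ^^ n) x)) \<longrightarrow> d\<^sup>2 \<le> Re (a x x)"
    by (rule invariant_form[OF closed_csubspaceD(1)[OF H] T M M0])
  define g where "g x y = a (Y x) (Y y)" for x y
  have "bounded_form K K g"
    unfolding g_def by (rule bounded_form_compose[OF a(1) Y(1) Y(1)])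
  moreover have "g (V x) (V y) = g x y" if "x \<in> K" "y \<in> K" for x y
    using that by (simp add: g_def Y(2) a(3) Yin)
  ultimately obtain A where A: "bounded_op K K A"
    "\<And>x y. x \<in> K \<Longrightarrow> y \<in> K \<Longrightarrow> cinner (A x) y = g x y" "\<And>x. x \<in> K \<Longrightarrow> A (V x) = V (A x)"
    using invariant_form_operator[OF K V] by blast
  have uN: "u j \<in> N j" and uK: "u j \<in> K" and jJ: "j \<in> J" if "j \<in> F" for j
    using F that N_K by auto
  define w where "w = (\<Sum>j\<in>F. u j)"
  have w: "w \<in> K" unfolding w_def by (intro csubspace_sum[OF K'] uK)
  have orth: "cinner (A (u i)) (u j) = (if i = j then a (Y (u i)) (Y (u i)) else 0)" if "i \<in> F" "j \<in> F" for i j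
    using N_orth[OF jJ jJ _ commutant_N[OF A(1,3) jJ uN] uN] that
    by (auto simp: A(2)[OF uK uK] g_def)
  have "a (Y w) (Y w) = cinner (A w) w"
    by (simp add: A(2) w g_def)
  also have "A w = (\<Sum>j\<in>F. A (u j))"
    unfolding w_def by (rule bounded_op_sum[OF A(1) K' uK])
  also have "cinner \<dots> w = (\<Sum>i\<in>F. \<Sum>j\<in>F. cinner (A (u i)) (u j))"
    by (simp add: w_def cinner.sum_left cinner.sum_right) (rule sum.swap)
  also have "\<dots> = (\<Sum>i\<in>F. a (Y (u i)) (Y (u i)))"
    using F(1) by (simp add: orth)
  finally have split: "Re (a (Y w) (Y w)) = (\<Sum>j\<in>F. Re (a (Y (u j)) (Y (u j))))"
    by simp
  have "(norm (Y (u j)))\<^sup>2 \<le> C\<^sup>2 * Re (a (Y (u j)) (Y (u j)))" if j: "j \<in> F" for j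
  proof -
    have "(norm (Y (u j)) / C)\<^sup>2 \<le> Re (a (Y (u j)) (Y (u j)))"
    proof -
      have "norm (Y (u j)) / C \<le> norm ((T ^^ n) (Y (u j)))" for n
        using lower[OF jJ[OF j] uN[OF j]] C by (simp add: pos_divide_le_eq mult.commute)
      moreover have "0 \<le> norm (Y (u j)) / C" using C by simp
      ultimately show ?thesis
        using a(5) Yin[OF uK[OF j]] by blast
    qed
    thus ?thesis using C by (simp add: power_divide pos_divide_le_eq mult.commute)
  qed
  hence "(\<Sum>j\<in>F. (norm (Y (u j)))\<^sup>2) \<le> C\<^sup>2 * Re (a (Y w) (Y w))"
    unfolding split sum_distrib_left by (intro sum_mono)
  also have "\<dots> \<le> C\<^sup>2 * (M * norm (Y w))\<^sup>2"
    using a(4) Yin[OF w] by (intro mult_left_mono) auto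
  also have "\<dots> = (C * M * norm (Y w))\<^sup>2"
    by (simp add: power_mult_distrib)
  finally have "L2_set (\<lambda>j. norm (Y (u j))) F \<le> sqrt ((C * M * norm (Y w))\<^sup>2)"
    unfolding L2_set_def by (rule real_sqrt_le_mono)
  also have "\<dots> = C * M * norm (Y w)"
    using C M0 by simp
  finally show ?thesis by (simp add: w_def)
qed

text \<open>The hypothesis concerns operators quasisimilar to \<open>V\<close> on \<open>N j\<close>, whereas the restriction of \<open>T'\<close> to the
  closure of \<open>X' (N j)\<close> is quasisimilar to the adjoint of \<open>V\<close>. It applies to the adjoint \<open>R\<close> of this
  restriction, and bounds on powers pass between \<open>R\<close> and the restriction.\<close>

lemma dual_lower_bound:
  fixes H :: "'h::complex_hilbert set"
  assumes H: "closed_csubspace H" and M0: "M \<ge> 0" and C0: "C \<ge> 0"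
    and T: "adjoint_pair H H T T'" and V': "adjoint_pair K K V V'"
    and M: "\<And>n x. x \<in> H \<Longrightarrow> norm ((T ^^ n) x) \<le> M * norm x"
    and X: "adjoint_pair H K X X'" "quasiaffinity H K X" "\<And>x. x \<in> H \<Longrightarrow> X (T x) = V (X x)"
    and Y: "adjoint_pair K H Y Y'" "quasiaffinity K H Y" "\<And>x. x \<in> K \<Longrightarrow> Y (V x) = T (Y x)"
    and hyp: "\<And>L R. closed_csubspace L \<Longrightarrow> bounded_op L L R \<Longrightarrow> pos_powers_bounded L R M \<Longrightarrow>
      quasisimilar L R (N j) V \<Longrightarrow> neg_powers_bounded (L :: 'h set) R C"
    and dual: "hyperinvariant_decomposition K V' J N"
    and j: "j \<in> J" and u: "u \<in> N j"
  shows "norm (X' u) \<le> C * norm ((T' ^^ n) (X' u))"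
proof -
  interpret dual: hyperinvariant_decomposition K V' J N by (rule dual)
  note H' = closed_csubspaceD(1)[OF H]
  note qX' = quasiaffinity_adjoint[OF X(2,1) H K] and qY' = quasiaffinity_adjoint[OF Y(2,1) K H]
  have X'V': "X' (V' x) = T' (X' x)" if "x \<in> K" for x
    by (rule adjoint_intertwine[OF X(1) T V' H' _ that]) (rule X(3))
  have Y'T': "Y' (T' x) = V' (Y' x)" if "x \<in> H" for x
    by (rule adjoint_intertwine[OF Y(1) V' T K' _ that]) (rule Y(3))
  define L where "L = closure (X' ` N j)"
  have L: "closed_csubspace L" "L \<subseteq> H" "bounded_op L L T'" "quasisimilar L T' (N j) V'"
    unfolding L_def
    by (rule dual.component_quasisimilar[OF H adjoint_pairD(2)[OF T] qY' Y'T' qX' X'V' j]; assumption)+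
  note L' = closed_csubspaceD(1)[OF L(1)]
  obtain R where R: "adjoint_pair L L T' R"
    using adjoint_exists[OF L(3,1,1)] by blast
  have "adjoint_pair (N j) (N j) V' V"
    using V_N[OF j] dual.V_N[OF j] adjoint_pairD(3)[OF V'] N_K[OF j]
      bounded_op_restrict[OF adjoint_pairD(1)[OF V'] N_sub[OF j]]
      bounded_op_restrict[OF adjoint_pairD(2)[OF V'] N_sub[OF j]]
    by (intro adjoint_pair_sym[of "N j" "N j" V V']) (auto simp: adjoint_pair_def image_subset_iff)
  hence "quasisimilar L R (N j) V"
    by (rule quasisimilar_adjoint[OF L(4) R _ L(1) N[OF j]])
  moreover have "norm ((R ^^ n) x) \<le> M * norm x" if "x \<in> L" for n x
  proof (rule adjoint_funpow_bound[OF R that])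
    fix y assume "y \<in> L"
    thus "norm ((T' ^^ n) y) \<le> M * norm y"
      using adjoint_funpow_bound[OF T _ M] L(2) by blast
  qed
  hence "pos_powers_bounded L R M"
    by (simp add: pos_powers_bounded_iff[OF adjoint_pairD(2)[OF R] L' M0])
  ultimately have "neg_powers_bounded L R C"
    using hyp[OF L(1) adjoint_pairD(2)[OF R]] by blast
  moreover have "X' u \<in> L"
    unfolding L_def by (rule subsetD[OF closure_subset imageI[OF u]])
  ultimately show ?thesis
    by (rule neg_powers_bounded_adjoint_lower[OF L' R _ C0])
qed

text \<open>The finite sums \<open>(\<Sum>j. Y (u j))\<close> are dense in \<open>H\<close>, and on them the norm is equivalent, with constant
  \<open>C * M\<close> in both directions, to the norm of the orthogonal sum of the components. On the components \<open>T\<^sup>n\<close> is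
  bounded below by \<open>1 / C\<close>.\<close>

lemma similar_and_neg_powers_bounded:
  fixes H :: "'h::complex_hilbert set"
  assumes H: "closed_csubspace H" and T: "bounded_op H H T" and M0: "M > 0" and C0: "C > 0"
    and pos: "pos_powers_bounded H T M" and qs: "quasisimilar H T K V"
    and hyp: "\<And>j L R. j \<in> J \<Longrightarrow> closed_csubspace L \<Longrightarrow> bounded_op L L R \<Longrightarrow>
      pos_powers_bounded L R M \<Longrightarrow> quasisimilar L R (N j) V \<Longrightarrow> neg_powers_bounded (L :: 'h set) R C"
  shows "similar H T K V \<and> neg_powers_bounded H T (M\<^sup>2 * C ^ 3)"
proof -
  note H' = closed_csubspaceD(1)[OF H] and Tin = bounded_op_in[OF T]
  have M0': "M \<ge> 0" and C0': "C \<ge> 0" and CM: "C * M > 0"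
    using M0 C0 by auto
  have M: "\<And>n x. x \<in> H \<Longrightarrow> norm ((T ^^ n) x) \<le> M * norm x"
    using pos by (simp add: pos_powers_bounded_iff[OF T H' M0'])
  obtain X where X: "quasiaffinity H K X" "\<And>x. x \<in> H \<Longrightarrow> X (T x) = V (X x)"
    using qs unfolding quasisimilar_def quasiaffine_transform_iff by blast
  obtain Y where Y: "quasiaffinity K H Y" "\<And>x. x \<in> K \<Longrightarrow> Y (V x) = T (Y x)"
    using qs unfolding quasisimilar_def quasiaffine_transform_iff by blast
  note Xb = quasiaffinityD(1)[OF X(1)] and Yb = quasiaffinityD(1)[OF Y(1)]
  note Xin = bounded_op_in[OF Xb] and Yin = bounded_op_in[OF Yb]
  obtain V' where V': "adjoint_pair K K V V'" "hyperinvariant_decomposition K V' J N"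
    by (rule adjoint_decomposition)
  interpret dual: hyperinvariant_decomposition K V' J N by (rule V'(2))
  obtain T' where T': "adjoint_pair H H T T'" using adjoint_exists[OF T H H] by blast
  obtain X' where X': "adjoint_pair H K X X'" using adjoint_exists[OF Xb H K] by blast
  obtain Y' where Y': "adjoint_pair K H Y Y'" using adjoint_exists[OF Yb K H] by blast
  note qX' = quasiaffinity_adjoint[OF X(1) X' H K]
  have X'V': "X' (V' x) = T' (X' x)" if "x \<in> K" for x
    by (rule adjoint_intertwine[OF X' T' V'(1) H' _ that]) (rule X(2))
  have XY_N: "X (Y x) \<in> N i" if "i \<in> J" "x \<in> N i" for i x
    by (rule commutant_N[OF bounded_op_compose[OF Yb Xb] _ that]) (simp add: X(2) Y(2) Yin)

  have lower: "norm (Y u) \<le> C * norm ((T ^^ n) (Y u))" if j: "j \<in> J" and u: "u \<in> N j" for j u n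
  proof -
    have L: "closed_csubspace (closure (Y ` N j))" "closure (Y ` N j) \<subseteq> H"
      "bounded_op (closure (Y ` N j)) (closure (Y ` N j)) T" "quasisimilar (closure (Y ` N j)) T (N j) V"
      by (rule component_quasisimilar[OF H T X Y j]; assumption)+
    note L' = closed_csubspaceD(1)[OF L(1)]
    have "pos_powers_bounded (closure (Y ` N j)) T M"
      using M L(2) by (auto simp: pos_powers_bounded_iff[OF L(3) L' M0'])
    hence "neg_powers_bounded (closure (Y ` N j)) T C"
      by (rule hyp[OF j L(1) L(3) _ L(4)])
    moreover have "Y u \<in> closure (Y ` N j)"
      by (rule subsetD[OF closure_subset imageI[OF u]])
    ultimately show ?thesis
      by (rule neg_powers_bounded_lower[OF _ L' C0'])
  qed
  have dual_lower: "norm (X' u) \<le> C * norm ((T' ^^ n) (X' u))" if "j \<in> J" "u \<in> N j" for j u n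
    by (rule dual_lower_bound[OF H M0' C0' T' V'(1) M X' X Y' Y hyp[OF that(1)] V'(2) that])

  have sum_le: "L2_set (\<lambda>j. norm (Y (u j))) F \<le> C * M * norm (Y (\<Sum>j\<in>F. u j))"
    if "finite F" "F \<subseteq> J" "\<And>j. j \<in> F \<Longrightarrow> u j \<in> N j" for F u
    by (rule square_sum_bound[OF H T M0' C0 M Yb Y(2) lower that])
  have dual_sum_le: "L2_set (\<lambda>j. norm (X' (u j))) F \<le> C * M * norm (X' (\<Sum>j\<in>F. u j))"
    if "finite F" "F \<subseteq> J" "\<And>j. j \<in> F \<Longrightarrow> u j \<in> N j" for F u
    by (rule dual.square_sum_bound[OF H adjoint_pairD(2)[OF T'] M0' C0 adjoint_funpow_bound[OF T' _ M]
          adjoint_pairD(2)[OF X'] X'V' dual_lower that])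

  have biorth: "cinner (Y x) (X' y) = 0" if "i \<in> J" "j \<in> J" "i \<noteq> j" "x \<in> N i" "y \<in> N j" for i j x y
    using that N_orth[OF that(1-3) XY_N[OF that(1,4)] that(5)]
      adjoint_pairD(3)[OF X' Yin[OF N_K[OF that(1,4)]] N_K[OF that(2,5)]] by simp
  have le_sum: "norm (Y (\<Sum>j\<in>F. u j)) \<le> C * M * L2_set (\<lambda>j. norm (Y (u j))) F"
    if F: "finite F" "F \<subseteq> J" "\<And>j. j \<in> F \<Longrightarrow> u j \<in> N j" for F u
  proof -
    define q where "q = L2_set (\<lambda>j. norm (Y (u j))) F"
    define x where "x = Y (\<Sum>j\<in>F. u j)"
    have uK: "u j \<in> K" if "j \<in> F" for j
      using F that N_K by blast
    have x: "x \<in> H" unfolding x_def by (intro Yin csubspace_sum[OF K'] uK)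
    have x_sum: "x = (\<Sum>j\<in>F. Y (u j))"
      unfolding x_def by (rule bounded_op_sum[OF Yb K' uK])
    \<comment> \<open>The norm of \<open>x\<close> is computed by duality: the vectors \<open>y\<close> are dense, and only equal indices contribute to
      the pairing with \<open>x\<close>.\<close>
    have pair: "cmod (cinner x y) \<le> C * M * q * norm y" if "y \<in> X' ` finite_sums" for y
    proof -
      obtain G v where y: "y = X' (\<Sum>j\<in>G. v j)" and G: "finite G" "G \<subseteq> J" "\<And>j. j \<in> G \<Longrightarrow> v j \<in> N j"
        using \<open>y \<in> X' ` finite_sums\<close> by (auto elim!: finite_sumsE)
      have vK: "v j \<in> K" if "j \<in> G" for j
        using G that N_K by blast
      have y_sum: "y = (\<Sum>j\<in>G. X' (v j))"
        unfolding y by (rule bounded_op_sum[OF adjoint_pairD(2)[OF X'] K' vK])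
      have "cinner x y = (\<Sum>i\<in>F. \<Sum>j\<in>G. cinner (Y (u i)) (X' (v j)))"
        unfolding x_sum y_sum by (simp add: cinner.sum_left cinner.sum_right) (rule sum.swap)
      also have "\<dots> = (\<Sum>i\<in>F. \<Sum>j\<in>G. if i = j then cinner (Y (u i)) (X' (v i)) else 0)"
      proof (intro sum.cong refl)
        fix i j assume "i \<in> F" "j \<in> G"
        thus "cinner (Y (u i)) (X' (v j)) = (if i = j then cinner (Y (u i)) (X' (v i)) else 0)"
          using biorth[OF subsetD[OF F(2)] subsetD[OF G(2)] _ F(3) G(3)] by simp
      qed
      also have "\<dots> = (\<Sum>i\<in>F \<inter> G. cinner (Y (u i)) (X' (v i)))"
        using F(1) G(1) by (simp add: sum.inter_restrict)
      finally have "cmod (cinner x y) \<le> (\<Sum>i\<in>F \<inter> G. cmod (cinner (Y (u i)) (X' (v i))))"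
        by (simp add: norm_sum)
      also have "\<dots> \<le> (\<Sum>i\<in>F \<inter> G. \<bar>norm (Y (u i))\<bar> * \<bar>norm (X' (v i))\<bar>)"
        by (intro sum_mono) (simp add: norm_cinner_le)
      also have "\<dots> \<le> L2_set (\<lambda>j. norm (Y (u j))) (F \<inter> G) * L2_set (\<lambda>j. norm (X' (v j))) (F \<inter> G)"
        by (rule L2_set_mult_ineq)
      also have "\<dots> \<le> q * L2_set (\<lambda>j. norm (X' (v j))) G"
        unfolding q_def L2_set_def using F(1) G(1)
        by (intro mult_mono real_sqrt_le_mono sum_mono2 real_sqrt_ge_zero sum_nonneg) auto
      also have "\<dots> \<le> q * (C * M * norm y)"
        unfolding y by (intro mult_left_mono dual_sum_le G) (simp_all add: q_def)
      finally show ?thesis by (simp add: mult_ac)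
    qed
    have "closure (X' ` finite_sums) = H"
      by (rule quasiaffinity_image_dense[OF qX' K' finite_sums_dense])
    then obtain f where f: "\<And>n. f n \<in> X' ` finite_sums" "f \<longlonglongrightarrow> x"
      using x closure_sequential by blast
    have "cmod (cinner x x) \<le> C * M * q * norm x"
    proof (rule LIMSEQ_le)
      show "(\<lambda>n. cmod (cinner x (f n))) \<longlonglongrightarrow> cmod (cinner x x)"
        by (intro tendsto_norm cinner.tendsto tendsto_const f)
      show "(\<lambda>n. C * M * q * norm (f n)) \<longlonglongrightarrow> C * M * q * norm x"
        by (intro tendsto_intros f)
    qed (use pair[OF f(1)] in blast)
    hence "norm x * norm x \<le> (C * M * q) * norm x"
      by (simp add: cinner_self norm_mult power2_eq_square)
    moreover have "0 \<le> C * M * q" using CM by (simp add: q_def)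
    ultimately have "norm x \<le> C * M * q"
      by (cases "x = 0") auto
    thus ?thesis by (simp add: x_def q_def)
  qed

  \<comment> \<open>One factor \<open>C * M\<close> for splitting \<open>Y w\<close>, one factor \<open>C\<close> for the components, one factor \<open>C * M\<close> for
    reassembling \<open>T\<^sup>n (Y w)\<close>.\<close>
  define B where "B = M\<^sup>2 * C ^ 3"
  have B: "B > 0" using M0 C0 by (simp add: B_def)
  have on_sums: "norm (Y w) \<le> B * norm ((T ^^ n) (Y w))" if w: "w \<in> finite_sums" for w n
  proof -
    obtain F u where F: "w = (\<Sum>j\<in>F. u j)" "finite F" "F \<subseteq> J" "\<And>j. j \<in> F \<Longrightarrow> u j \<in> N j"
      using finite_sumsE[OF w] by blast
    have uK: "u j \<in> K" if "j \<in> F" for j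
      using F that N_K by blast
    have TY: "(T ^^ n) (Y x) = Y ((V ^^ n) x)" if "x \<in> K" for x
      by (rule funpow_intertwine[where X = Y and T = V, OF Vin Y(2) that, symmetric])
    have VnN: "(V ^^ n) (u j) \<in> N j" if "j \<in> F" for j
    proof -
      have "j \<in> J" using F(3) that by blast
      thus ?thesis using F(4)[OF that] V_N by (induction n) auto
    qed
    have "norm (Y w) \<le> C * M * L2_set (\<lambda>j. norm (Y (u j))) F"
      unfolding F(1) by (rule le_sum[OF F(2-4)])
    also have "\<dots> \<le> C * M * L2_set (\<lambda>j. C * norm (Y ((V ^^ n) (u j)))) F"
    proof (intro mult_left_mono L2_set_mono)
      fix j assume j: "j \<in> F"
      show "norm (Y (u j)) \<le> C * norm (Y ((V ^^ n) (u j)))"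
        using lower[of j "u j" n] F(3) F(4)[OF j] j by (simp add: TY[OF uK[OF j]] subset_iff)
    qed (use CM in auto)
    also have "\<dots> = C * M * (C * L2_set (\<lambda>j. norm (Y ((V ^^ n) (u j)))) F)"
      using C0 by (simp add: L2_set_right_distrib)
    also have "\<dots> \<le> C * M * (C * (C * M * norm (Y (\<Sum>j\<in>F. (V ^^ n) (u j)))))"
      using CM C0 by (intro mult_left_mono sum_le F VnN) auto
    also have "(\<Sum>j\<in>F. (V ^^ n) (u j)) = (V ^^ n) w"
      unfolding F(1) by (rule bounded_op_sum[OF bounded_op_funpow[OF Vb] K' uK, symmetric])
    also have "Y ((V ^^ n) w) = (T ^^ n) (Y w)"
      using TY finite_sums_sub w by auto
    finally show ?thesis by (simp add: B_def power2_eq_square power3_eq_cube mult_ac)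
  qed
  have all: "norm x \<le> B * norm ((T ^^ n) x)" if x: "x \<in> H" for x n
  proof -
    have "closure (Y ` finite_sums) = H"
      by (rule quasiaffinity_image_dense[OF Y(1) K' finite_sums_dense])
    then obtain f where f: "\<And>n. f n \<in> Y ` finite_sums" "f \<longlonglongrightarrow> x"
      using x closure_sequential by blast
    have fH: "f k \<in> H" for k
      using f(1)[of k] Yin[OF subsetD[OF finite_sums_sub]] by auto
    show ?thesis
    proof (rule LIMSEQ_le)
      show "(\<lambda>k. norm (f k)) \<longlonglongrightarrow> norm x"
        by (intro tendsto_norm f)
      show "(\<lambda>k. B * norm ((T ^^ n) (f k))) \<longlonglongrightarrow> B * norm ((T ^^ n) x)"
        by (intro tendsto_intros bounded_op_tendsto[OF bounded_op_funpow[OF T] H'] fH x f)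
      show "\<exists>N. \<forall>k\<ge>N. norm (f k) \<le> B * norm ((T ^^ n) (f k))"
      proof (intro exI[of _ 0] allI impI)
        fix k
        obtain w where "w \<in> finite_sums" "f k = Y w" using f(1)[of k] by blast
        thus "norm (f k) \<le> B * norm ((T ^^ n) (f k))" using on_sums by simp
      qed
    qed
  qed
  have "closure (T ` H) = H"
  proof
    show "closure (T ` H) \<subseteq> H"
      using Tin closed_csubspaceD(2)[OF H] by (intro closure_minimal) auto
    have "Y ` K \<subseteq> T ` H"
    proof
      fix h assume "h \<in> Y ` K"
      then obtain k where "k \<in> K" "h = Y k" by blast
      moreover then obtain l where "l \<in> K" "k = V l"
        using unitary_opD(2)[OF V] by blast
      ultimately show "h \<in> T ` H"
        using Y(2) Yin by blast
    qed
    thus "H \<subseteq> closure (T ` H)"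
      using closure_mono quasiaffinityD(2)[OF Y(1)] by blast
  qed
  hence "T ` H = H"
    by (intro closed_range[OF T H, of B]) (use all[of _ 1] in simp)
  hence neg: "neg_powers_bounded H T B"
    using B all by (intro neg_powers_boundedI[OF T H']) auto

  obtain a where a: "bounded_form H H a" "\<forall>x\<in>H. \<forall>y\<in>H. a x y = cnj (a y x)"
    "\<forall>x\<in>H. \<forall>y\<in>H. a (T x) (T y) = a x y" "\<forall>x\<in>H. Re (a x x) \<le> (M * norm x)\<^sup>2"
    "\<forall>x\<in>H. \<forall>d\<ge>0. (\<forall>n. d \<le> norm ((T ^^ n) x)) \<longrightarrow> d\<^sup>2 \<le> Re (a x x)"
    by (rule invariant_form[OF H' T M M0'])
  have low: "(1 / B)\<^sup>2 * (norm x)\<^sup>2 \<le> Re (a x x)" if x: "x \<in> H" for x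
  proof -
    have "(norm x / B) \<le> norm ((T ^^ n) x)" for n
      using all[OF x, of n] B by (simp add: pos_divide_le_eq mult.commute)
    moreover have "0 \<le> norm x / B" using B by simp
    ultimately have "(norm x / B)\<^sup>2 \<le> Re (a x x)"
      using a(5) x by blast
    thus ?thesis by (simp add: power_divide)
  qed
  have "similar H T K V"
  proof (rule polar_similarity[OF H K Y(1) V T _ a(1), where c = "(1 / B)\<^sup>2"])
    fix Z assume "boundedly_invertible H K Z" "\<And>x. x \<in> H \<Longrightarrow> Z (T x) = V (Z x)"
    thus "similar H T K V"
      unfolding similar_def by blast
  next
    show "Y (V x) = T (Y x)" if "x \<in> K" for x
      by (rule Y(2)[OF that])
    show "a x y = cnj (a y x)" "a (T x) (T y) = a x y" if "x \<in> H" "y \<in> H" for x y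
      using a(2,3) that by blast+
    show "(1 / B)\<^sup>2 > 0"
      using B by simp
    show "(1 / B)\<^sup>2 * (norm x)\<^sup>2 \<le> Re (a x x)" if "x \<in> H" for x
      by (rule low[OF that])
  qed
  thus ?thesis using neg by (simp add: B_def)
qed

end

section \<open>The Hilbert direct sum as an orthogonal decomposition\<close>

lemma bounded_linear_l2sum_coord: "bounded_linear (\<lambda>f. Rep_l2sum f i)"
  by (rule bounded_linear_intro[where K = 1]) (simp_all add: Rep_l2sum_ops norm_l2sum_coord_le)

lemma direct_sum_coord:
  "f \<in> direct_sum J K \<Longrightarrow> j \<in> J \<Longrightarrow> Rep_l2sum f j \<in> K j"
  "f \<in> direct_sum J K \<Longrightarrow> j \<notin> J \<Longrightarrow> Rep_l2sum f j = 0"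
  unfolding direct_sum_def by blast+

lemma direct_sumI:
  "(\<And>j. j \<in> J \<Longrightarrow> Rep_l2sum f j \<in> K j) \<Longrightarrow> (\<And>j. j \<notin> J \<Longrightarrow> Rep_l2sum f j = 0) \<Longrightarrow> f \<in> direct_sum J K"
  unfolding direct_sum_def by blast

lemma closed_csubspace_direct_sum:
  assumes K: "\<And>j. j \<in> J \<Longrightarrow> closed_csubspace (K j)"
  shows "closed_csubspace (direct_sum J K)"
  unfolding closed_csubspace_iff csubspace_def
proof (intro conjI ballI allI)
  have "direct_sum J K = (\<Inter>j. (\<lambda>f. Rep_l2sum f j) -` (if j \<in> J then K j else {0}))"
    by (auto simp: direct_sum_def split: if_splits)
  moreover have "closed ((\<lambda>f. Rep_l2sum f j) -` (if j \<in> J then K j else {0}))" for j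
    using closed_csubspaceD(2)[OF K]
    by (intro continuous_closed_vimage linear_continuous_at bounded_linear_l2sum_coord) auto
  ultimately show "closed (direct_sum J K)"
    by (metis (no_types, lifting) closed_INT)
next
  show "0 \<in> direct_sum J K"
    by (rule direct_sumI) (simp_all add: Rep_l2sum_ops csubspace_zero[OF closed_csubspaceD(1)[OF K]])
next
  fix f g assume "f \<in> direct_sum J K" "g \<in> direct_sum J K"
  thus "f + g \<in> direct_sum J K"
    by (intro direct_sumI)
      (simp_all add: Rep_l2sum_ops direct_sum_coord csubspace_add[OF closed_csubspaceD(1)[OF K]])
next
  fix c f assume "f \<in> direct_sum J K"
  thus "c *\<^sub>C f \<in> direct_sum J K"
    by (intro direct_sumI)
      (simp_all add: Rep_l2sum_scaleC direct_sum_coord csubspace_scaleC[OF closed_csubspaceD(1)[OF K]]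
        linear_0[OF bounded_linear.linear[OF bounded_linear_scaleC]])
qed

lemma unitary_op_norm: "unitary_op K U \<Longrightarrow> x \<in> K \<Longrightarrow> norm (U x) = norm x"
  using unitary_opD(3)[of K U x x] by (simp add: cinner_self flip: of_real_power)

text \<open>The operators \<open>U j\<close> preserve norms, so the family of images is again square-summable and passes through
  \<open>Abs_l2sum\<close> unchanged.\<close>

lemma direct_sum_op_coord:
  assumes U: "\<And>j. j \<in> J \<Longrightarrow> unitary_op (K j) (U j)" and f: "f \<in> direct_sum J K"
  shows "Rep_l2sum (direct_sum_op J U f) j = (if j \<in> J then U j (Rep_l2sum f j) else 0)"
proof -
  have "(norm (if j \<in> J then U j (Rep_l2sum f j) else 0))\<^sup>2 = (norm (Rep_l2sum f j))\<^sup>2" for j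
    using unitary_op_norm[OF U direct_sum_coord(1)[OF f]] direct_sum_coord(2)[OF f] by auto
  hence "(\<lambda>j. (norm (if j \<in> J then U j (Rep_l2sum f j) else 0))\<^sup>2) summable_on UNIV"
    using Rep_l2sum_summable[of f] by simp
  thus ?thesis
    unfolding direct_sum_op_def by (simp add: Abs_l2sum_inverse)
qed

lemma unitary_op_direct_sum:
  fixes K :: "'i \<Rightarrow> 'a::complex_hilbert set"
  assumes K: "\<And>j. j \<in> J \<Longrightarrow> closed_csubspace (K j)" and U: "\<And>j. j \<in> J \<Longrightarrow> unitary_op (K j) (U j)"
  shows "unitary_op (direct_sum J K) (direct_sum_op J U)"
proof -
  let ?K = "direct_sum J K" and ?U = "direct_sum_op J U"
  have K': "csubspace ?K"
    by (rule closed_csubspaceD(1)[OF closed_csubspace_direct_sum[OF K]])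
  note coord = direct_sum_op_coord[of J K U, OF U]
  note Uop = unitary_opD(1)[OF U]
  have U_in: "?U f \<in> ?K" if "f \<in> ?K" for f
    using that by (intro direct_sumI) (simp_all add: coord bounded_op_in[OF Uop] direct_sum_coord)
  have U_cinner: "cinner (?U f) (?U g) = cinner f g" if "f \<in> ?K" "g \<in> ?K" for f g
    unfolding cinner_l2sum_def
  proof (rule infsum_cong)
    show "cinner (Rep_l2sum (?U f) j) (Rep_l2sum (?U g) j) = cinner (Rep_l2sum f j) (Rep_l2sum g j)" for j
      using that by (simp add: coord unitary_opD(3)[OF U] direct_sum_coord cinner.zero_left)
  qed
  have "bounded_op ?K ?K ?U"
  proof (rule bounded_opI[OF U_in, where B = 1])
    show "?U (f + g) = ?U f + ?U g" if "f \<in> ?K" "g \<in> ?K" for f g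
      using that csubspace_add[OF K' that]
      by (intro l2sum_eqI) (simp add: coord Rep_l2sum_ops bounded_op_add[OF Uop] direct_sum_coord)
    show "?U (c *\<^sub>C f) = c *\<^sub>C ?U f" if "f \<in> ?K" for c f
      using that csubspace_scaleC[OF K' that]
      by (intro l2sum_eqI) (simp add: coord Rep_l2sum_scaleC bounded_op_scaleC[OF Uop] direct_sum_coord
          linear_0[OF bounded_linear.linear[OF bounded_linear_scaleC]])
    show "norm (?U f) \<le> 1 * norm f" if "f \<in> ?K" for f
    proof -
      have "(norm (?U f))\<^sup>2 = (norm f)\<^sup>2"
        using U_cinner[OF that that] by (simp only: cinner_self of_real_eq_iff)
      thus ?thesis by simp
    qed
  qed
  moreover have "?U ` ?K = ?K"
  proof
    show "?U ` ?K \<subseteq> ?K" using U_in by blast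
    show "?K \<subseteq> ?U ` ?K"
    proof
      fix g assume g: "g \<in> ?K"
      have "\<exists>x\<in>K j. U j x = Rep_l2sum g j" if "j \<in> J" for j
        using direct_sum_coord(1)[OF g that] unitary_opD(2)[OF U[OF that]] by (metis imageE)
      then obtain h where h: "\<And>j. j \<in> J \<Longrightarrow> h j \<in> K j" "\<And>j. j \<in> J \<Longrightarrow> U j (h j) = Rep_l2sum g j"
        by metis
      define f where "f = Abs_l2sum (\<lambda>j. if j \<in> J then h j else 0)"
      have "(norm (if j \<in> J then h j else 0))\<^sup>2 = (norm (Rep_l2sum g j))\<^sup>2" for j
        using unitary_op_norm[OF U h(1)] h(2) direct_sum_coord(2)[OF g] by auto
      hence "(\<lambda>j. (norm (if j \<in> J then h j else 0))\<^sup>2) summable_on UNIV"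
        using Rep_l2sum_summable[of g] by simp
      hence f: "Rep_l2sum f j = (if j \<in> J then h j else 0)" for j
        by (simp add: f_def Abs_l2sum_inverse)
      have fK: "f \<in> ?K"
        by (rule direct_sumI) (simp_all add: f h(1))
      have "?U f = g"
        by (rule l2sum_eqI) (simp add: coord fK f h(2) direct_sum_coord(2)[OF g])
      thus "g \<in> ?U ` ?K" using fK by blast
    qed
  qed
  ultimately show ?thesis
    unfolding unitary_op_def using U_cinner by blast
qed

lemma cinner_l2sum_single:
  fixes f g :: "('i, 'a::complex_hilbert) l2sum"
  assumes "\<And>i. i \<noteq> j \<Longrightarrow> Rep_l2sum f i = 0"
  shows "cinner f g = cinner (Rep_l2sum f j) (Rep_l2sum g j)"
proof -
  have "cinner f g = (\<Sum>\<^sub>\<infinity>i\<in>{j}. cinner (Rep_l2sum f i) (Rep_l2sum g i))"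
    unfolding cinner_l2sum_def by (rule infsum_cong_neutral) (use assms in \<open>auto simp: cinner.zero_left\<close>)
  thus ?thesis by simp
qed

lemma summandD:
  assumes "f \<in> summand J K j"
  shows "f \<in> direct_sum J K" "i \<noteq> j \<Longrightarrow> Rep_l2sum f i = 0"
  using assms unfolding summand_def by blast+

lemma single_in_summand:
  assumes K: "\<And>j. j \<in> J \<Longrightarrow> closed_csubspace (K j)" and j: "j \<in> J" and x: "x \<in> K j"
  obtains f where "f \<in> summand J K j" "Rep_l2sum f j = x"
proof -
  define f where "f = Abs_l2sum (\<lambda>i. if i = j then x else 0)"
  have "(\<lambda>i. (norm (if i = j then x else 0))\<^sup>2) summable_on UNIV"
    by (subst summable_on_cong_neutral[where T = "{j}" and g = "\<lambda>_. (norm x)\<^sup>2"]) auto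
  hence f: "Rep_l2sum f i = (if i = j then x else 0)" for i
    by (simp add: f_def Abs_l2sum_inverse)
  have "f \<in> direct_sum J K"
    using j x by (intro direct_sumI) (auto simp: f csubspace_zero[OF closed_csubspaceD(1)[OF K]])
  thus thesis
    by (intro that[of f]) (simp_all add: summand_def f)
qed

lemma hyperinvariant_decomposition_direct_sum:
  fixes K :: "'i \<Rightarrow> 'a::complex_hilbert set"
  assumes K: "\<And>j. j \<in> J \<Longrightarrow> closed_csubspace (K j)" and U: "\<And>j. j \<in> J \<Longrightarrow> unitary_op (K j) (U j)"
    and hyp: "\<And>j. j \<in> J \<Longrightarrow> summand J K j \<in> Hyplat (direct_sum J K) (direct_sum_op J U)"
  shows "hyperinvariant_decomposition (direct_sum J K) (direct_sum_op J U) J (summand J K)"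
proof (rule hyperinvariant_decomposition.intro[OF closed_csubspace_direct_sum[OF K] unitary_op_direct_sum[OF K U]])
  show "cinner f g = 0" if "i \<noteq> j" "f \<in> summand J K i" "g \<in> summand J K j" for i j f g
    using cinner_l2sum_single[of i f g] summandD(2)[OF that(2)] summandD(2)[OF that(3,1)]
    by (simp add: cinner.zero_right)
  show "f = 0" if f: "f \<in> direct_sum J K" "\<And>j g. j \<in> J \<Longrightarrow> g \<in> summand J K j \<Longrightarrow> cinner g f = 0" for f
  proof (rule l2sum_eqI)
    fix j
    show "Rep_l2sum f j = Rep_l2sum 0 j"
    proof (cases "j \<in> J")
      case True
      obtain g where g: "g \<in> summand J K j" "Rep_l2sum g j = Rep_l2sum f j"
        using single_in_summand[of J K j, OF K True direct_sum_coord(1)[OF f(1) True]] by blast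
      have "cinner (Rep_l2sum f j) (Rep_l2sum f j) = 0"
        using f(2)[OF True g(1)] cinner_l2sum_single[of j g f] summandD(2)[OF g(1)] g(2) by simp
      thus ?thesis by (simp add: cinner_self_eq_0 Rep_l2sum_ops)
    qed (simp add: direct_sum_coord(2)[OF f(1)] Rep_l2sum_ops)
  qed
qed (assumption | rule hyp)+

lemma summand_quasisimilar_component:
  fixes K :: "'i \<Rightarrow> 'a::complex_hilbert set"
  assumes K: "\<And>j. j \<in> J \<Longrightarrow> closed_csubspace (K j)" and U: "\<And>j. j \<in> J \<Longrightarrow> unitary_op (K j) (U j)"
    and N: "closed_csubspace (summand J K j)" and j: "j \<in> J"
  shows "quasisimilar (summand J K j) (direct_sum_op J U) (K j) (U j)"
proof -
  have inv: "boundedly_invertible (summand J K j) (K j) (\<lambda>f. Rep_l2sum f j)"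
  proof (rule boundedly_invertibleI[OF _ closed_csubspaceD(1)[OF N], where c = 1])
    show "bounded_op (summand J K j) (K j) (\<lambda>f. Rep_l2sum f j)"
      by (rule bounded_opI[where B = 1])
        (simp_all add: direct_sum_coord(1)[OF summandD(1) j] Rep_l2sum_ops Rep_l2sum_scaleC norm_l2sum_coord_le)
    show "(\<lambda>f. Rep_l2sum f j) ` summand J K j = K j"
    proof
      show "(\<lambda>f. Rep_l2sum f j) ` summand J K j \<subseteq> K j"
        using direct_sum_coord(1)[OF summandD(1) j] by blast
      show "K j \<subseteq> (\<lambda>f. Rep_l2sum f j) ` summand J K j"
        using single_in_summand[of J K j, OF K j] by (metis image_eqI subsetI)
    qed
    fix f assume f: "f \<in> summand J K j"
    have "cinner f f = cinner (Rep_l2sum f j) (Rep_l2sum f j)"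
      by (rule cinner_l2sum_single) (rule summandD(2)[OF f])
    hence "(norm f)\<^sup>2 = (norm (Rep_l2sum f j))\<^sup>2"
      by (simp only: cinner_self of_real_eq_iff)
    thus "norm f \<le> 1 * norm (Rep_l2sum f j)" by simp
  qed
  show ?thesis
  proof (rule similar_imp_quasisimilar[OF inv N K[OF j]])
    fix f assume f: "f \<in> summand J K j"
    note coord = direct_sum_op_coord[of J K U, OF U summandD(1)[OF f]]
    show "Rep_l2sum (direct_sum_op J U f) j = U j (Rep_l2sum f j)"
      by (simp add: coord j)
    have "U i 0 = 0" if "i \<in> J" for i
      by (rule bounded_op_zero[OF unitary_opD(1)[OF U[OF that]] closed_csubspaceD(1)[OF K[OF that]]])
    thus "direct_sum_op J U f \<in> summand J K j"
      using bounded_op_in[OF unitary_opD(1)[OF unitary_op_direct_sum[of J K U, OF K U]] summandD(1)[OF f]]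
        summandD(2)[OF f] by (auto simp: summand_def coord)
  qed
qed

theorem theorem2p11:
  fixes M C :: real
    and J :: "'i set"
    and K :: "'i \<Rightarrow> 'a::complex_hilbert set"
    and U :: "'i \<Rightarrow> 'a \<Rightarrow> 'a"
    and H :: "'b::complex_hilbert set"
    and T :: "'b \<Rightarrow> 'b"
  assumes "M > 0" and "C > 0"
    and "countable J"
    and "\<And>j. j \<in> J \<Longrightarrow> separable_hilbert (K j)"
    and "\<And>j. j \<in> J \<Longrightarrow> unitary_op (K j) (U j)"
    and "\<And>j (L :: 'a set) (R :: 'a \<Rightarrow> 'a).
          j \<in> J \<Longrightarrow> separable_hilbert L \<Longrightarrow> bounded_op L L R \<Longrightarrow> pos_powers_bounded L R M \<Longrightarrow>
          quasisimilar L R (K j) (U j) \<Longrightarrow> neg_powers_bounded L R C"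
    and "\<And>j. j \<in> J \<Longrightarrow> summand J K j \<in> Hyplat (direct_sum J K) (direct_sum_op J U)"
    and "separable_hilbert H" and "bounded_op H H T"
    and "pos_powers_bounded H T M"
    and "quasisimilar H T (direct_sum J K) (direct_sum_op J U)"
  shows "similar H T (direct_sum J K) (direct_sum_op J U) \<and> neg_powers_bounded H T (M\<^sup>2 * C ^ 3)"
proof -
  have K: "closed_csubspace (K j)" if "j \<in> J" for j
    using assms(4)[OF that] by (simp add: separable_hilbert_def)
  have H: "closed_csubspace H"
    using assms(8) by (simp add: separable_hilbert_def)
  interpret D: hyperinvariant_decomposition "direct_sum J K" "direct_sum_op J U" J "summand J K"
    by (rule hyperinvariant_decomposition_direct_sum[OF K assms(5,7)])
  show ?thesis
  proof (rule D.similar_and_neg_powers_bounded[OF H assms(9,1,2,10,11)])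
    fix j and L :: "'b set" and R
    assume j: "j \<in> J" and L: "closed_csubspace L" and R: "bounded_op L L R" "pos_powers_bounded L R M"
      and qs: "quasisimilar L R (summand J K j) (direct_sum_op J U)"
    have "quasisimilar (summand J K j) (direct_sum_op J U) (K j) (U j)"
      by (rule summand_quasisimilar_component[of J K U, OF K assms(5) D.N[OF j] j])
    hence "quasisimilar L R (K j) (U j)"
      by (rule quasisimilar_trans[OF qs _ closed_csubspaceD(1)[OF L] closed_csubspaceD(1)[OF D.N[OF j]]
            closed_csubspaceD(1)[OF K[OF j]]])
    thus "neg_powers_bounded L R C"
    proof (rule neg_powers_bounded_on_isometric_copy[OF K[OF j] L R])
      show "neg_powers_bounded (K j) Q C"
        if "bounded_op (K j) (K j) Q" "pos_powers_bounded (K j) Q M" "quasisimilar (K j) Q (K j) (U j)" for Q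
        by (rule assms(6)[OF j assms(4)[OF j] that])
    qed (use assms(1,2) in auto)
  qed
qed

end
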